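(* Let $m$ be an odd positive integer, $n\ge1$, let $D\subset\mathbb{C}^n$ be open and symmetric, and let $f=\mathcal{I}(F)\in\mathcal{S}(\Omega_D)$, with $F=\sum_{K\in\mathcal{P}(n)}\varepsilon_KF_K$ of class $C^1$, satisfy $\frac{\partial f}{\partial x_h^c}=0$ for some $h\in\{1,\dots,n\}$. Then at every point $x=(\alpha_1+J_1\beta_1,\dots,\alpha_n+J_n\beta_n)\in\Omega_D$ with $\beta_h>0$, $$\Delta_{m+1,h}f(x)=-2(m-1)\frac{\partial}{\partial x_h}f'_{s,h}(x),$$ and for every integer $k\ge1$, $$\Delta_{m+1,h}^{k+1}f(x)=-2(m-1)(m-3)\cdots(m-2k-1)\sum_{j=1}^ka_j^{(k)}\frac{\partial}{\partial x_h}\Big(\beta_h^{j-2k}\sum_{K\in\mathcal{P}(n),\,h\notin K}\big[J_K,\partial_{\beta_h}^j(F'_h)_K(w',\alpha_h+i\beta_h,w'')\big]\Big),$$ or equivalently $$\Delta_{m+1,h}^{k+1}f(x)=-2(m-1)(m-3)\cdots(m-2k-1)\sum_{j=1}^{k+1}a_j^{(k+1)}\frac{\partial}{\partial x_h}\Big(\beta_h^{j-2k-2}\sum_{K\in\mathcal{P}(n),\,h\notin K}\big[J_K,\partial_{\beta_h}^{j-1}F_{K\cup\{h\}}(w',\alpha_h+i\beta_h,w'')\big]\Big),$$ where $(F'_h)_K=\beta_h^{-1}F_{K\cup\{h\}}$, $w'=(\alpha_1+i\beta_1,\dots,\alpha_{h-1}+i\beta_{h-1})$, $w''=(\alpha_{h+1}+i\beta_{h+1},\dots,\alpha_n+i\beta_n)$,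 and $a_j^{(k)}:=\frac{(2k-j-1)!}{(j-1)!\,(k-j)!\,(-2)^{k-j}}$ for $1\le j\le k$. In particular, $f$ is $(\gamma_m+1)$-polyharmonic in any variable, where $\gamma_m=\frac{m-1}{2}$, i.e. $\Delta_{m+1,h}^{\frac{m+1}{2}}f=0$ for any $h=1,\dots,n$.
   Context: $\mathbb{R}_m$ is the real Clifford algebra generated by $e_1,\dots,e_m$ with $e_ie_j+e_je_i=-2\delta_{ij}$; $\mathbb{R}^{m+1}$ is identified with the paravectors $x_0+\sum_{i=1}^m x_ie_i$; $\mathbb{S}=\{x\in\mathbb{R}^{m+1}:x_0=0,\ \sum_{i=1}^m x_i^2=1\}$. Every $x\in\mathbb{R}^{m+1}$ is $\alpha+J\beta$ with $\alpha\in\mathbb{R}$, $\beta\ge0$, $J\in\mathbb{S}$. $\mathcal{P}(n)$ is the set of subsets of $\{1,\dots,n\}$; $\{\varepsilon_K\}_{K\in\mathcal{P}(n)}$ is a basis of $\mathbb{R}^{2^n}$. A set $D\subset\mathbb{C}^n$ is symmetric if it is invariant under conjugation of each single variable, $z\mapsto\bar z^h=(z_1,\dots,\bar z_h,\dots,z_n)$. Its circularization is $\Omega_D=\{(\alpha_1+J_1\beta_1,\dots,\alpha_n+J_n\beta_n):(\alpha_1+i\beta_1,\dots,\alpha_n+i\beta_n)\in D,\ J_1,\dots,J_n\in\mathbb{S}\}\subset(\mathbb{R}^{m+1})^n$. A stem function is $F=\sum_{K}\varepsilon_KF_K:D\to\mathbb{R}_m\otimes\mathbb{R}^{2^n}$,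 $F_K:D\to\mathbb{R}_m$, with $F_K(\bar z^h)=F_K(z)$ if $h\notin K$ and $F_K(\bar z^h)=-F_K(z)$ if $h\in K$. For $K=\{k_1<\dots<k_p\}$ and $a\in\mathbb{R}_m$ put $[J_K,a]=J_{k_1}\cdots J_{k_p}a$ ($[J_\emptyset,a]=a$). $F$ induces the slice function $f=\mathcal{I}(F):\Omega_D\to\mathbb{R}_m$, $f(x)=\sum_K[J_K,F_K(z)]$ for $x=(\alpha_l+J_l\beta_l)_l$, $z=(\alpha_l+i\beta_l)_l$; $\mathcal{S}(\Omega_D)$ is the set of slice functions. Let $\mathcal{J}_h$ be the $\mathbb{R}_m$-linear map with $\mathcal{J}_h(\varepsilon_K)=\varepsilon_{K\cup\{h\}}$ if $h\notin K$, $\mathcal{J}_h(\varepsilon_K)=-\varepsilon_{K\setminus\{h\}}$ if $h\in K$. For a slice function $g=\mathcal{I}(G)$, with $G$ differentiable in $(\alpha_h,\beta_h)$, $\frac{\partial g}{\partial x_h}=\mathcal{I}\big(\frac12(\partial_{\alpha_h}G-\mathcal{J}_h\partial_{\beta_h}G)\big)$ and $\frac{\partial g}{\partial x_h^c}=\mathcal{I}\big(\frac12(\partial_{\alpha_h}G+\mathcal{J}_h\partial_{\beta_h}G)\big)$. The spherical $x_h$-derivative is $f'_{s,h}=\mathcal{I}(F'_h)$, $F'_h=\sum_{h\notin K}\varepsilon_K\beta_h^{-1}F_{K\cup\{h\}}$, defined at the points of $\Omega_D$ with $x_h\notin\mathbb{R}$. The functions to which $\frac{\partial}{\partial x_h}$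 is applied in the claim are slice functions there, induced by stem functions $\sum_{h\notin K}\varepsilon_K(\cdots)$ with the indicated components. $\Delta_{m+1,h}$ is the Laplacian with respect to the $m+1$ real coordinates of $x_h$.
   Formalization: The final claim "polyharmonic in any variable" is proved for each variable x_l with ∂f/∂x_l^c = 0 (in particular x_h); it fails for other variables, e.g. f = Re(x_2)^{m+1} with h = 1. *)

theory Defs
  imports "HOL-Analysis.Analysis"
begin

section \<open>The real Clifford algebra\<close>

text \<open>
  An element of the algebra with generators indexed by \<open>'m\<close> is its family of coordinates in the basis
  \<open>e\<^sub>A\<close> (the increasing product of the generators with index in \<open>A\<close>), so that \<open>axis A 1\<close> is \<open>e\<^sub>A\<close>.
  The componentwise product that the library puts on vectors is not used; the product is
  \<open>\<cdot>\<^sub>c\<close> below.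
\<close>

type_synonym 'm clifford = "real ^ ('m set)"

text \<open>
  \<open>e\<^sub>A e\<^sub>B\<close> is \<open>e\<close> of the symmetric difference, with one sign change for every transposition
  (pairs with \<open>j < i\<close>) and one for every square \<open>e\<^sub>i\<^sup>2 = -1\<close> (pairs with \<open>j = i\<close>).
\<close>

definition cl_sign :: "'m::{finite,linorder} set \<Rightarrow> 'm set \<Rightarrow> real" where
  "cl_sign A B = (\<Prod>i\<in>A. \<Prod>j\<in>B. if j \<le> i then - 1 else 1)"

definition cl_mult :: "'m::{finite,linorder} clifford \<Rightarrow> 'm clifford \<Rightarrow> 'm clifford"
    (infixl "\<cdot>\<^sub>c" 70) where
  "a \<cdot>\<^sub>c b = (\<Sum>A\<in>UNIV. \<Sum>B\<in>UNIV. axis ((A - B) \<union> (B - A)) (cl_sign A B * a $ A * b $ B))"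

definition cl_one :: "'m::{finite,linorder} clifford" where
  "cl_one = axis {} 1"

definition cl_gen :: "'m::{finite,linorder} \<Rightarrow> 'm clifford" where
  "cl_gen i = axis {i} 1"

lemma bilinear_cl_mult: "bilinear (cl_mult :: 'm::{finite,linorder} clifford \<Rightarrow> _)"
proof -
  have ax: "axis i (x + y) = axis i x + (axis i y :: 'm clifford)"
       "axis i (r * x) = r *\<^sub>R (axis i x :: 'm clifford)" for i x y r
    by (simp_all add: axis_def vec_eq_iff)
  show ?thesis
    unfolding bilinear_def
    apply (intro conjI allI linearI)
       apply (simp_all add: cl_mult_def algebra_simps ax sum.distrib scaleR_sum_right)
    done
qed

lemma cl_mult_axis:
  fixes A B :: "'m::{finite,linorder} set"
  shows "axis A x \<cdot>\<^sub>c axis B y = axis ((A - B) \<union> (B - A)) (cl_sign A B * x * y)"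
proof -
  have [simp]: "axis C 0 = (0 :: 'm clifford)" for C
    by (simp add: axis_def vec_eq_iff)
  have [simp]: "axis C t $ C' = (if C' = C then t else 0)" for C C' :: "'m set" and t :: real
    by (simp add: axis_def)
  have "axis A x \<cdot>\<^sub>c axis B y =
    (\<Sum>A'\<in>UNIV. \<Sum>B'\<in>UNIV. if A' = A \<and> B' = B
       then axis ((A - B) \<union> (B - A)) (cl_sign A B * x * y) else 0)"
    unfolding cl_mult_def by (intro sum.cong refl) simp
  also have "\<dots> = (\<Sum>A'\<in>UNIV. if A' = A then (\<Sum>B'\<in>UNIV. if B' = B
       then axis ((A - B) \<union> (B - A)) (cl_sign A B * x * y) else 0) else 0)"
    by (intro sum.cong refl) auto
  finally show ?thesis by simp
qed

lemma cl_gen_square: "cl_gen i \<cdot>\<^sub>c cl_gen i = - cl_one"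
  by (simp only: cl_gen_def cl_mult_axis) (auto simp: cl_one_def cl_sign_def axis_def vec_eq_iff)

lemma cl_gen_anticommute: "i \<noteq> j \<Longrightarrow> cl_gen i \<cdot>\<^sub>c cl_gen j + cl_gen j \<cdot>\<^sub>c cl_gen i = 0"
  by (simp only: cl_gen_def cl_mult_axis) (auto simp: cl_sign_def axis_def vec_eq_iff)

lemma cl_vec_expand: "(a :: 'm::finite clifford) = (\<Sum>A\<in>UNIV. axis A (a $ A))"
  by (simp add: vec_eq_iff axis_def)

lemma cl_one_left: "cl_one \<cdot>\<^sub>c a = a" and cl_one_right: "a \<cdot>\<^sub>c cl_one = a"
proof -
  interpret bilinear: bounded_bilinear cl_mult
    using bilinear_cl_mult bilinear_conv_bounded_bilinear by blast
  show "cl_one \<cdot>\<^sub>c a = a"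
    by (subst (1 2) cl_vec_expand[of a]) (simp add: bilinear.sum_right cl_one_def cl_mult_axis cl_sign_def)
  show "a \<cdot>\<^sub>c cl_one = a"
    by (subst (1 2) cl_vec_expand[of a]) (simp add: bilinear.sum_left cl_one_def cl_mult_axis cl_sign_def)
qed

lemma cl_sign_symdiff:
  fixes A B C :: "'m::{finite,linorder} set"
  shows "cl_sign ((A - B) \<union> (B - A)) C = cl_sign A C * cl_sign B C"
  "cl_sign C ((A - B) \<union> (B - A)) = cl_sign C A * cl_sign C B"
proof -
  have *: "prod f ((A - B) \<union> (B - A)) = prod f A * prod f B"
    if "\<And>x. f x * f x = 1" for f :: "_ \<Rightarrow> real" and A B :: "'m set"
  proof -
    have split: "prod f S = prod f (S - T) * prod f (S \<inter> T)" for S T :: "'m set"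
      by (subst prod.Int_Diff[of S f T]) (simp_all add: mult.commute)
    have "prod f A = prod f (A - B) * prod f (A \<inter> B)" by (rule split)
    moreover have "prod f B = prod f (B - A) * prod f (A \<inter> B)" using split[of B A] by (simp add: Int_commute)
    moreover have "prod f (A \<inter> B) * prod f (A \<inter> B) = 1"
      by (simp add: that flip: prod.distrib)
    moreover have "prod f ((A - B) \<union> (B - A)) = prod f (A - B) * prod f (B - A)"
      by (rule prod.union_disjoint) auto
    ultimately show ?thesis by (simp add: mult_ac)
  qed
  show "cl_sign ((A - B) \<union> (B - A)) C = cl_sign A C * cl_sign B C"
    unfolding cl_sign_def by (rule *) (auto simp flip: prod.distrib intro!: prod.neutral)
  show "cl_sign C ((A - B) \<union> (B - A)) = cl_sign C A * cl_sign C B"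
    unfolding cl_sign_def prod.distrib[symmetric]
    by (intro prod.cong refl *) auto
qed

lemma cl_mult_assoc:
  fixes a b c :: "'m::{finite,linorder} clifford"
  shows "(a \<cdot>\<^sub>c b) \<cdot>\<^sub>c c = a \<cdot>\<^sub>c (b \<cdot>\<^sub>c c)"
proof -
  interpret bilinear: bounded_bilinear cl_mult
    using bilinear_cl_mult bilinear_conv_bounded_bilinear by blast
  have "(axis A x \<cdot>\<^sub>c axis B y) \<cdot>\<^sub>c axis C z = axis A x \<cdot>\<^sub>c (axis B y \<cdot>\<^sub>c axis C z)"
    for A B C :: "'m set" and x y z
    unfolding cl_mult_axis cl_sign_symdiff
    by (rule arg_cong2[where f = axis]) (auto simp: mult_ac)
  then show ?thesis
    by (subst (1 2) cl_vec_expand[of a], subst (1 2) cl_vec_expand[of b],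
        subst (1 2) cl_vec_expand[of c])
       (simp add: bilinear.sum_left bilinear.sum_right)
qed


section \<open>Paravectors, symmetric sets, circularization\<close>

text \<open>The pair \<open>(x\<^sub>0, v)\<close> is the paravector \<open>x\<^sub>0 + (\<Sum>i. v\<^sub>i e\<^sub>i)\<close>.\<close>

type_synonym 'm paravector = "real \<times> (real ^ 'm)"
type_synonym ('m, 'n) pvec = "('m paravector) ^ 'n"
type_synonym 'n cvec = "complex ^ 'n"

definition paravec :: "'m::{finite,linorder} paravector \<Rightarrow> 'm clifford" where
  "paravec x = fst x *\<^sub>R cl_one + (\<Sum>i\<in>UNIV. (snd x $ i) *\<^sub>R cl_gen i)"

definition unit_imag :: "'m::finite paravector set" where
  "unit_imag = {x. fst x = 0 \<and> (\<Sum>i\<in>UNIV. (snd x $ i)\<^sup>2) = 1}"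

definition conj_at :: "'n::finite \<Rightarrow> 'n cvec \<Rightarrow> 'n cvec" where
  "conj_at h z = (\<chi> l. if l = h then cnj (z $ l) else z $ l)"

definition symmetric_set :: "'n::finite cvec set \<Rightarrow> bool" where
  "symmetric_set D \<longleftrightarrow> (\<forall>h. \<forall>z\<in>D. conj_at h z \<in> D)"

text \<open>The point with coordinates \<open>\<alpha>\<^sub>l + J\<^sub>l \<beta>\<^sub>l\<close>, where \<open>z\<^sub>l = \<alpha>\<^sub>l + \<i> \<beta>\<^sub>l\<close>.\<close>

definition slice_point ::
    "'n::finite cvec \<Rightarrow> ('m::finite, 'n) pvec \<Rightarrow> ('m, 'n) pvec" where
  "slice_point z J = (\<chi> l. (Re (z $ l), 0) + Im (z $ l) *\<^sub>R (J $ l))"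

definition circularization ::
    "'n::finite cvec set \<Rightarrow> ('m::finite, 'n) pvec set" where
  "circularization D = {slice_point z J | z J. z \<in> D \<and> (\<forall>l. J $ l \<in> unit_imag)}"

text \<open>\<open>nonreal_part D h\<close> is the part of \<open>D\<close> whose circularization consists of the points with
  \<open>x\<^sub>h\<close> not real.\<close>

definition nonreal_part :: "'n::finite cvec set \<Rightarrow> 'n \<Rightarrow> 'n cvec set" where
  "nonreal_part D h = {z \<in> D. Im (z $ h) \<noteq> 0}"


section \<open>Partial derivatives\<close>

definition dir_deriv ::
    "'a::real_normed_vector \<Rightarrow> ('a \<Rightarrow> 'b::real_normed_vector) \<Rightarrow> 'a \<Rightarrow> 'b" where
  "dir_deriv v f x = vector_derivative (\<lambda>t. f (x + t *\<^sub>R v)) (at 0)"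

definition dir_differentiable ::
    "'a::real_normed_vector \<Rightarrow> ('a \<Rightarrow> 'b::real_normed_vector) \<Rightarrow> 'a \<Rightarrow> bool" where
  "dir_differentiable v f x \<longleftrightarrow> (\<lambda>t::real. f (x + t *\<^sub>R v)) differentiable (at 0)"

definition d_alpha ::
    "'n::finite \<Rightarrow> ('n cvec \<Rightarrow> 'b::real_normed_vector) \<Rightarrow> 'n cvec \<Rightarrow> 'b" where
  "d_alpha h = dir_deriv (axis h 1)"

definition d_beta ::
    "'n::finite \<Rightarrow> ('n cvec \<Rightarrow> 'b::real_normed_vector) \<Rightarrow> 'n cvec \<Rightarrow> 'b" where
  "d_beta h = dir_deriv (axis h \<i>)"

definition C1_on ::
    "('a::real_normed_vector) set \<Rightarrow> ('a \<Rightarrow> 'b::real_normed_vector) \<Rightarrow> bool" where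
  "C1_on U f \<longleftrightarrow> (\<exists>f' :: 'a \<Rightarrow> 'a \<Rightarrow>\<^sub>L 'b.
     (\<forall>x\<in>U. (f has_derivative blinfun_apply (f' x)) (at x)) \<and> continuous_on U f')"

text \<open>\<open>Basis\<close> of the space of paravectors consists of the \<open>m + 1\<close> standard unit vectors.\<close>

definition laplacian_at ::
    "'n::finite \<Rightarrow> (('m::finite, 'n) pvec \<Rightarrow> 'b::real_normed_vector)
      \<Rightarrow> ('m, 'n) pvec \<Rightarrow> 'b" where
  "laplacian_at h f x = (\<Sum>b\<in>Basis. dir_deriv (axis h b) (dir_deriv (axis h b) f) x)"

text \<open>
  \<open>vector_derivative\<close> is total, so an equation about an iterated Laplacian does not by itself say that
  the derivatives exist; on an open set \<open>U\<close>, the following predicate does.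
\<close>

definition iter_laplacian_exists ::
    "'n::finite \<Rightarrow> nat \<Rightarrow> ('m::finite, 'n) pvec set
      \<Rightarrow> (('m, 'n) pvec \<Rightarrow> 'b::real_normed_vector) \<Rightarrow> bool" where
  "iter_laplacian_exists h p U f \<longleftrightarrow> (\<forall>i<p. \<forall>x\<in>U. \<forall>b\<in>Basis.
     dir_differentiable (axis h b) ((laplacian_at h ^^ i) f) x \<and>
     dir_differentiable (axis h b) (dir_deriv (axis h b) ((laplacian_at h ^^ i) f)) x)"

definition polyharmonic_in ::
    "'n::finite \<Rightarrow> nat \<Rightarrow> ('m::finite, 'n) pvec set
      \<Rightarrow> (('m, 'n) pvec \<Rightarrow> 'b::real_normed_vector) \<Rightarrow> bool" where
  "polyharmonic_in h p U f \<longleftrightarrow>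
     iter_laplacian_exists h p U f \<and> (\<forall>x\<in>U. (laplacian_at h ^^ p) f x = 0)"


section \<open>Stem functions and slice functions\<close>

text \<open>
  Values of stem functions lie in the tensor product of the Clifford algebra with the real space
  with basis \<open>\<epsilon>\<^sub>K\<close>; the element \<open>\<Sum>K. \<epsilon>\<^sub>K a\<^sub>K\<close> is the vector with
  component \<open>a\<^sub>K\<close> at \<open>K\<close>, so that \<open>axis K a\<close> is \<open>\<epsilon>\<^sub>K a\<close>.
\<close>

type_synonym ('m, 'n) stem_value = "('m clifford) ^ ('n set)"

definition stem_on ::
    "'n::finite cvec set \<Rightarrow> ('n cvec \<Rightarrow> ('m::finite, 'n) stem_value) \<Rightarrow> bool" where
  "stem_on D F \<longleftrightarrow> (\<forall>z\<in>D. \<forall>h K.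
     F (conj_at h z) $ K = (if h \<in> K then - (F z $ K) else F z $ K))"

text \<open>\<open>imag_prod J K a\<close> is \<open>[J\<^sub>K, a]\<close>, the product in increasing order of the indices.\<close>

definition imag_prod ::
    "('m::{finite,linorder}, 'n::{finite,linorder}) pvec \<Rightarrow> 'n set
      \<Rightarrow> 'm clifford \<Rightarrow> 'm clifford" where
  "imag_prod J K a = foldr (\<lambda>k b. paravec (J $ k) \<cdot>\<^sub>c b) (sorted_list_of_set K) a"

text \<open>\<open>induced D F\<close> is the slice function \<open>\<I>(F)\<close>; its values off the circularization of \<open>D\<close> are
  irrelevant. For a stem function on a symmetric set, the value does not depend on the
  representation \<open>slice_point z J\<close> of \<open>x\<close>.\<close>

definition induced ::
    "'n::{finite,linorder} cvec set
      \<Rightarrow> ('n cvec \<Rightarrow> ('m::{finite,linorder}, 'n) stem_value)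
      \<Rightarrow> ('m, 'n) pvec \<Rightarrow> 'm clifford" where
  "induced D F x = (THE y. \<exists>z\<in>D. \<exists>J. (\<forall>l. J $ l \<in> unit_imag) \<and> x = slice_point z J \<and>
     y = (\<Sum>K\<in>UNIV. imag_prod J K (F z $ K)))"

text \<open>A stem function inducing \<open>g\<close>; on a symmetric \<open>D\<close> it is unique up to its values off \<open>D\<close>.\<close>

definition stem_of ::
    "'n::{finite,linorder} cvec set
      \<Rightarrow> (('m::{finite,linorder}, 'n) pvec \<Rightarrow> 'm clifford)
      \<Rightarrow> 'n cvec \<Rightarrow> ('m, 'n) stem_value" where
  "stem_of D g = (SOME G. stem_on D G \<and> (\<forall>x\<in>circularization D. g x = induced D G x))"

definition stem_J ::
    "'n::finite \<Rightarrow> ('m::finite, 'n) stem_value \<Rightarrow> ('m, 'n) stem_value" where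
  "stem_J h a =
     (\<Sum>K\<in>UNIV. if h \<notin> K then axis (insert h K) (a $ K) else - axis (K - {h}) (a $ K))"

text \<open>\<open>\<partial>g/\<partial>x\<^sub>h\<close> and \<open>\<partial>g/\<partial>x\<^sub>h\<^sup>c\<close> for a slice function \<open>g\<close> on the circularization of \<open>D\<close>.\<close>

definition slice_deriv ::
    "'n::{finite,linorder} cvec set \<Rightarrow> 'n
      \<Rightarrow> (('m::{finite,linorder}, 'n) pvec \<Rightarrow> 'm clifford)
      \<Rightarrow> ('m, 'n) pvec \<Rightarrow> 'm clifford" where
  "slice_deriv D h g = (let G = stem_of D g in
     induced D (\<lambda>z. (1/2) *\<^sub>R (d_alpha h G z - stem_J h (d_beta h G z))))"

definition slice_deriv_conj ::
    "'n::{finite,linorder} cvec set \<Rightarrow> 'n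
      \<Rightarrow> (('m::{finite,linorder}, 'n) pvec \<Rightarrow> 'm clifford)
      \<Rightarrow> ('m, 'n) pvec \<Rightarrow> 'm clifford" where
  "slice_deriv_conj D h g = (let G = stem_of D g in
     induced D (\<lambda>z. (1/2) *\<^sub>R (d_alpha h G z + stem_J h (d_beta h G z))))"

text \<open>\<open>g\<close> is a slice function whose stem function is differentiable in \<open>(\<alpha>\<^sub>h, \<beta>\<^sub>h)\<close>, as is
  presupposed by the two derivatives above.\<close>

definition slice_differentiable ::
    "'n::{finite,linorder} cvec set \<Rightarrow> 'n
      \<Rightarrow> (('m::{finite,linorder}, 'n) pvec \<Rightarrow> 'm clifford) \<Rightarrow> bool" where
  "slice_differentiable D h g \<longleftrightarrow>
     (\<exists>G. stem_on D G \<and> (\<forall>x\<in>circularization D. g x = induced D G x) \<and>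
       (\<forall>z\<in>D. (\<lambda>w. G (z + axis h w)) differentiable (at 0)))"

definition spherical_stem ::
    "'n::finite \<Rightarrow> ('n cvec \<Rightarrow> ('m::finite, 'n) stem_value)
      \<Rightarrow> 'n cvec \<Rightarrow> ('m, 'n) stem_value" where
  "spherical_stem h F z =
     (\<Sum>K | h \<notin> K. axis K (inverse (Im (z $ h)) *\<^sub>R (F z $ insert h K)))"

definition spherical_deriv ::
    "'n::{finite,linorder} cvec set \<Rightarrow> 'n
      \<Rightarrow> (('m::{finite,linorder}, 'n) pvec \<Rightarrow> 'm clifford)
      \<Rightarrow> ('m, 'n) pvec \<Rightarrow> 'm clifford" where
  "spherical_deriv D h f = induced (nonreal_part D h) (spherical_stem h (stem_of D f))"


section \<open>The functions and constants in the formulas for the iterated Laplacian\<close>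

text \<open>Used for \<open>1 \<le> j \<le> k\<close>, where no subtraction is truncated.\<close>

definition lap_coeff :: "nat \<Rightarrow> nat \<Rightarrow> real" where
  "lap_coeff k j = fact (2 * k - j - 1) / (fact (j - 1) * fact (k - j) * (- 2) ^ (k - j))"

text \<open>\<open>\<beta>\<^sub>h\<^bsup>j-2k\<^esup> \<Sum>\<^bsub>h\<notin>K\<^esub> [J\<^sub>K, \<partial>\<^sup>j(F'\<^sub>h)\<^sub>K]\<close>, the derivatives being taken in \<open>\<beta>\<^sub>h\<close>.\<close>

definition spherical_term ::
    "'n::{finite,linorder} cvec set \<Rightarrow> 'n
      \<Rightarrow> ('n cvec \<Rightarrow> ('m::{finite,linorder}, 'n) stem_value) \<Rightarrow> nat \<Rightarrow> nat
      \<Rightarrow> ('m, 'n) pvec \<Rightarrow> 'm clifford" where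
  "spherical_term D h F k j = induced (nonreal_part D h) (\<lambda>z. \<Sum>K | h \<notin> K.
     axis K ((Im (z $ h) powi (int j - 2 * int k)) *\<^sub>R
             ((d_beta h ^^ j) (\<lambda>w. spherical_stem h F w $ K) z)))"

text \<open>\<open>\<beta>\<^sub>h\<^bsup>j-2k-2\<^esup> \<Sum>\<^bsub>h\<notin>K\<^esub> [J\<^sub>K, \<partial>\<^bsup>j-1\<^esup>F\<^bsub>K\<union>{h}\<^esub>]\<close>, the derivatives being taken in \<open>\<beta>\<^sub>h\<close>.\<close>

definition stem_term ::
    "'n::{finite,linorder} cvec set \<Rightarrow> 'n
      \<Rightarrow> ('n cvec \<Rightarrow> ('m::{finite,linorder}, 'n) stem_value) \<Rightarrow> nat \<Rightarrow> nat
      \<Rightarrow> ('m, 'n) pvec \<Rightarrow> 'm clifford" where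
  "stem_term D h F k j = induced (nonreal_part D h) (\<lambda>z. \<Sum>K | h \<notin> K.
     axis K ((Im (z $ h) powi (int j - 2 * int k - 2)) *\<^sub>R
             ((d_beta h ^^ (j - 1)) (\<lambda>w. F w $ insert h K) z)))"

end

theory Submission
  imports Defs "HOL-Complex_Analysis.Cauchy_Integral_Formula"
begin

text \<open>
  Uniqueness of stem functions turns the hypothesis into the Cauchy--Riemann equations
  \<open>\<partial>\<^sub>\<alpha> F\<^sub>K = \<partial>\<^sub>\<beta> F\<^bsub>K\<union>{h}\<^esub>\<close>, \<open>\<partial>\<^sub>\<alpha> F\<^bsub>K\<union>{h}\<^esub> = - \<partial>\<^sub>\<beta> F\<^sub>K\<close> for \<open>h \<notin> K\<close>, so that the coordinates
  \<open>H = F\<^sub>K + \<i> F\<^bsub>K\<union>{h}\<^esub>\<close> are holomorphic in the variable \<open>h\<close> and commute with conjugation. Let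
  \<open>T = \<beta>\<^sup>-\<^sup>1 \<partial>\<^sub>\<beta>\<close> and \<open>\<psi>\<^sub>k[H] = T\<^sup>k (\<beta>\<^sup>-\<^sup>1 Im H)\<close>. Then
  \<open>\<partial>\<^sub>\<alpha>\<^sup>2 \<psi>\<^sub>k = - (2k+3) \<psi>\<^sub>k\<^sub>+\<^sub>1 - \<beta>\<^sup>2 \<psi>\<^sub>k\<^sub>+\<^sub>2\<close>, and for the paravector \<open>\<alpha> + v\<close> with \<open>\<beta> = |v|\<close>
  this says that the Laplacian of \<open>\<psi>\<^sub>k\<^sub>-\<^sub>1[H'] - v \<psi>\<^sub>k[H]\<close> is \<open>m - 2k - 1\<close> times
  \<open>\<psi>\<^sub>k[H'] - v \<psi>\<^sub>k\<^sub>+\<^sub>1[H] = 2 \<partial>\<psi>\<^sub>k/\<partial>x\<^sub>h\<close>. With \<open>\<psi>\<^sub>-\<^sub>1[H'] = - Re H\<close>, the function \<open>f\<close> is minus the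
  case \<open>k = 0\<close>, up to the factors \<open>J\<^sub>l\<close> with \<open>l \<noteq> h\<close>. All \<open>\<psi>\<^sub>k\<close> extend evenly across the real
  axis, so the same computation is valid at the points with \<open>x\<^sub>h\<close> real. The coefficients
  \<open>lap_coeff\<close> are those of the expansion of \<open>T\<^sup>k\<close> in powers of \<open>\<beta>\<close> and \<open>\<partial>\<^sub>\<beta>\<close>.
\<close>

subsection \<open>The coefficients of the iterated operator\<close>

text \<open>Why the recursion closes: if \<open>R k\<close> depends on \<alpha> and \<beta> = |v|
  only and T maps \<open>R k\<close> to \<open>R (k + 1)\<close>, the Laplacian in v of
  \<open>R k\<close> is m \<open>R (k + 1)\<close> + \<beta>^2 \<open>R (k + 2)\<close>, and a
  coordinate factor of v adds 2 \<open>R (k + 1)\<close>. The second \<alpha>-derivative cancels the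
  \<beta>^2 term. The family multiplied by v has the constant 2k+3, the family without v is shifted
  by one index and has 2k+1; the additional 2 makes both factors equal to m-2k-1, so that this
  number comes out of the whole sum. For odd m one such factor is zero. The obstacle is the real
  axis. Polyharmonicity is claimed there too, including existence of all derivatives, while the
  closed expressions contain negative powers of \<beta>. \<open>F\<close> is only of class C^1, but
  all derivatives in the claim are taken in the variable with index h. Freezing the other variables
  reduces everything to functions of one complex variable, where holomorphy supplies derivatives of
  every order.\<close>

lemma lap_coeff_last: "lap_coeff (k + 2) (k + 2) = lap_coeff (k + 1) (k + 1)"
  by (simp add: lap_coeff_def)

lemma lap_coeff_rec_1:
  "lap_coeff (k + 2) 1 = - (2 * real k + 1) * lap_coeff (k + 1) 1"
proof -
  have *: "2 * (k + 2) - 1 - 1 = Suc (Suc (2 * k))" "2 * (k + 1) - 1 - 1 = 2 * k" by auto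
  show ?thesis unfolding lap_coeff_def *
    by (simp add: divide_simps) (simp add: algebra_simps)
qed

text \<open>Differentiating a term of \<open>lap_sum\<close> keeps its index with the exponent as a
  factor, or raises its index by one; the two coefficients add up. The extreme indices receive only
  one contribution each, which gives the two preceding lemmas.\<close>

lemma lap_coeff_rec:
  assumes "1 \<le> i" "i \<le> k"
  shows "lap_coeff (k + 2) (i + 1) =
    (real i - 2 * real k - 1) * lap_coeff (k + 1) (i + 1) + lap_coeff (k + 1) i"
proof -
  \<comment> \<open>This parametrization removes the truncated subtractions: all factorials in the
    numerators become explicit multiples of \<open>fact (p + 2 * q)\<close>.\<close>
  from assms obtain p q where i: "i = Suc p" and k: "k = Suc p + q"
    by (metis Suc_pred' add_diff_inverse_nat less_one linorder_not_less not_less_eq_eq One_nat_def)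
  define F where "F = (fact (p + 2 * q) :: real)"
  have e: "2 * (k + 2) - (i + 1) - 1 = Suc (Suc (Suc (p + 2 * q)))" "2 * (k + 1) - (i + 1) - 1 = Suc (p + 2 * q)"
    "2 * (k + 1) - i - 1 = Suc (Suc (p + 2 * q))"
    "i + 1 - 1 = Suc p" "i - 1 = p" "k + 2 - (i + 1) = Suc q" "k + 1 - (i + 1) = q" "k + 1 - i = Suc q"
    using i k by auto
  have f: "fact (Suc (Suc (Suc (p + 2 * q)))) = (3 + p + 2 * q) * (2 + p + 2 * q) * (1 + p + 2 * q) * F"
    "fact (Suc (Suc (p + 2 * q))) = (2 + p + 2 * q) * (1 + p + 2 * q) * F"
    "fact (Suc (p + 2 * q)) = (1 + p + 2 * q) * F"
    unfolding F_def fact_Suc of_nat_mult of_nat_Suc of_nat_add by (simp_all add: algebra_simps)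
  have "F \<noteq> 0" by (simp add: F_def)
  then show ?thesis unfolding lap_coeff_def e f unfolding i k
    by (simp add: divide_simps del: of_nat_Suc) (simp add: algebra_simps)
qed

text \<open>The value at \<open>t\<close> of \<open>((1/t) d/dt)\<^sup>k (g/t)\<close>, where \<open>g i\<close> is the \<open>i\<close>-th derivative
  of \<open>g\<close> at \<open>t\<close>.\<close>

definition lap_sum :: "nat \<Rightarrow> (nat \<Rightarrow> real) \<Rightarrow> real \<Rightarrow> real" where
  "lap_sum k g t = (\<Sum>i\<le>k. lap_coeff (k + 1) (i + 1) * t powi (int i - 2 * int k - 1) * g i)"

lemma lap_sum_deriv:
  fixes g :: "nat \<Rightarrow> real \<Rightarrow> real"
  assumes "t \<noteq> 0" and g: "\<And>i. (g i has_real_derivative g (Suc i) t) (at t)"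
  shows "((\<lambda>s. lap_sum k (\<lambda>i. g i s) s) has_real_derivative t * lap_sum (Suc k) (\<lambda>i. g i t) t) (at t)"
proof -
  let ?c = "\<lambda>i. lap_coeff (k + 1) (i + 1)" and ?e = "\<lambda>i. int i - 2 * int k - 1"
  have "((\<lambda>s. lap_sum k (\<lambda>i. g i s) s) has_real_derivative
     (\<Sum>i\<le>k. ?c i * (of_int (?e i) * t powi (?e i - 1)) * g i t + ?c i * t powi ?e i * g (Suc i) t)) (at t)"
    unfolding lap_sum_def using \<open>t \<noteq> 0\<close>
    by (auto intro!: derivative_eq_intros g sum.cong)
  also have "(\<Sum>i\<le>k. ?c i * (of_int (?e i) * t powi (?e i - 1)) * g i t + ?c i * t powi ?e i * g (Suc i) t)
     = t * lap_sum (Suc k) (\<lambda>i. g i t) t"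
  proof -
    \<comment> \<open>Both halves of the product rule are written in the monomials
      \<open>B i\<close>; the second half is shifted by one index before the coefficients are
      compared.\<close>
    define B where "B i = t powi (int i - 2 * int k - 2) * g i t" for i
    have p: "t powi (?e i - 1) = t powi (int i - 2 * int k - 2)" for i by (simp add: algebra_simps)
    have q: "t powi ?e i = t powi (int (Suc i) - 2 * int k - 2)" for i by (simp add: algebra_simps)
    have r: "t * t powi (int i - 2 * int (Suc k) - 1) = t powi (int i - 2 * int k - 2)" for i
      using power_int_add_1'[of t "int i - 2 * int (Suc k) - 1"] \<open>t \<noteq> 0\<close> by (simp add: algebra_simps)
    have "(\<Sum>i\<le>k. ?c i * (of_int (?e i) * t powi (?e i - 1)) * g i t + ?c i * t powi ?e i * g (Suc i) t)
      = (\<Sum>i\<le>k. of_int (?e i) * ?c i * B i) + (\<Sum>i\<le>k. ?c i * B (Suc i))"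
      unfolding p q B_def sum.distrib[symmetric] by (intro sum.cong refl) (simp add: algebra_simps)
    also have "(\<Sum>i\<le>k. ?c i * B (Suc i)) = (\<Sum>i\<in>{1..k}. lap_coeff (k + 1) i * B i) + lap_coeff (k+1) (k+1) * B (Suc k)"
    proof -
      have "(\<Sum>i\<le>k. ?c i * B (Suc i)) = (\<Sum>i\<in>{1..Suc k}. lap_coeff (k + 1) i * B i)"
        by (rule sum.reindex_bij_witness[of _ "\<lambda>i. i - 1" Suc]) auto
      then show ?thesis by simp
    qed
    also have "(\<Sum>i\<le>k. of_int (?e i) * ?c i * B i) =
      of_int (?e 0) * ?c 0 * B 0 + (\<Sum>i\<in>{1..k}. of_int (?e i) * ?c i * B i)"
    proof -
      have "{..k} = insert 0 {1..k}" by auto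
      then show ?thesis by simp
    qed
    also have "of_int (?e 0) * ?c 0 * B 0 + (\<Sum>i\<in>{1..k}. of_int (?e i) * ?c i * B i) +
      ((\<Sum>i\<in>{1..k}. lap_coeff (k + 1) i * B i) + lap_coeff (k+1) (k+1) * B (Suc k))
      = lap_coeff (k + 2) 1 * B 0 + (\<Sum>i\<in>{1..k}. lap_coeff (k + 2) (i + 1) * B i) + lap_coeff (k+2) (k+2) * B (Suc k)"
    proof -
      have "(\<Sum>i\<in>{1..k}. lap_coeff (k + 2) (i + 1) * B i) =
        (\<Sum>i\<in>{1..k}. of_int (?e i) * ?c i * B i) + (\<Sum>i\<in>{1..k}. lap_coeff (k + 1) i * B i)"
        unfolding sum.distrib[symmetric]
        by (rule sum.cong) (simp_all only: lap_coeff_rec atLeastAtMost_iff, simp add: algebra_simps)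
      then show ?thesis
        unfolding lap_coeff_last lap_coeff_rec_1 by (simp add: algebra_simps)
    qed
    also have "\<dots> = (\<Sum>i\<le>Suc k. lap_coeff (k + 2) (i + 1) * B i)"
    proof -
      have "{..k} = insert 0 {1..k}" by auto
      then show ?thesis by simp
    qed
    also have "\<dots> = t * lap_sum (Suc k) (\<lambda>i. g i t) t"
      unfolding lap_sum_def sum_distrib_left B_def r[symmetric] by (simp add: mult_ac)
    finally show ?thesis .
  qed
  finally show ?thesis .
qed

subsection \<open>Holomorphic functions commuting with conjugation\<close>

text \<open>Commuting with conjugation is the stem condition for a pair: the real part is even and
  the imaginary part odd in \<beta>. Hence \<open>Im H\<close> vanishes on the real axis, and
  \<beta>^(-1) \<open>Im H\<close> can extend across it.\<close>

definition conj_holomorphic :: "complex set \<Rightarrow> (complex \<Rightarrow> complex) \<Rightarrow> bool" where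
  "conj_holomorphic S H \<longleftrightarrow> open S \<and> H holomorphic_on S \<and> (\<forall>z\<in>S. cnj z \<in> S \<and> H (cnj z) = cnj (H z))"

lemma conj_holomorphic_deriv:
  assumes "conj_holomorphic S H"
  shows "conj_holomorphic S (deriv H)"
proof -
  have S: "open S" and h: "H holomorphic_on S" and c: "\<And>z. z \<in> S \<Longrightarrow> cnj z \<in> S \<and> H (cnj z) = cnj (H z)"
    using assms by (auto simp: conj_holomorphic_def)
  have "deriv H (cnj z) = cnj (deriv H z)" if "z \<in> S" for z
  proof -
    have "(H has_field_derivative deriv H z) (at z)"
      using S h that holomorphic_derivI by blast
    then have "((cnj \<circ> H \<circ> cnj) has_field_derivative cnj (deriv H z)) (at (cnj z))"
      by (subst has_field_derivative_cnj_cnj) (auto simp: has_field_derivative_cnj_cnj)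
    moreover have "\<forall>\<^sub>F x in nhds (cnj z). (cnj \<circ> H \<circ> cnj) x = H x"
      using S c that by (auto simp: eventually_nhds intro!: exI[of _ S])
    ultimately have "(H has_field_derivative cnj (deriv H z)) (at (cnj z))"
      by (subst (asm) DERIV_cong_ev) auto
    then show ?thesis by (rule DERIV_imp_deriv)
  qed
  then show ?thesis
    using S h c by (simp add: conj_holomorphic_def holomorphic_deriv)
qed

lemma conj_holomorphic_higher_deriv:
  "conj_holomorphic S H \<Longrightarrow> conj_holomorphic S ((deriv ^^ n) H)"
  by (induction n) (auto intro: conj_holomorphic_deriv)

lemma conj_holomorphic_DERIV:
  assumes "conj_holomorphic S H" "z \<in> S"
  shows "((deriv ^^ n) H has_field_derivative (deriv ^^ Suc n) H z) (at z)"
  using conj_holomorphic_higher_deriv[OF assms(1), of n] assms(2)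
  by (auto simp: conj_holomorphic_def intro: holomorphic_derivI)

lemma conj_holomorphic_real:
  assumes "conj_holomorphic S H" "z \<in> S" "Im z = 0"
  shows "Im ((deriv ^^ n) H z) = 0"
proof -
  have "cnj z = z" using assms(3) by (simp add: complex_eq_iff)
  then have "(deriv ^^ n) H z = cnj ((deriv ^^ n) H z)"
    using conj_holomorphic_higher_deriv[OF assms(1), of n] assms(2) by (auto simp: conj_holomorphic_def)
  then show ?thesis by (metis complex_cnj complex.sel(2) complex_eq_iff cnj.simps(2) equal_neg_zero neg_equal_zero)
qed

lemma Complex_deriv_snd: "((\<lambda>t. Complex a t) has_vector_derivative \<i>) (at b within A)"
proof -
  have "((\<lambda>t. of_real a + \<i> * of_real t) has_vector_derivative \<i>) (at b within A)"
    by (auto intro!: derivative_eq_intros)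
  then show ?thesis by (simp only: Complex_eq)
qed

lemma Complex_deriv_fst: "((\<lambda>t. Complex t b) has_vector_derivative 1) (at a within A)"
proof -
  have "((\<lambda>t. of_real t + \<i> * of_real b) has_vector_derivative 1) (at a within A)"
    by (auto intro!: derivative_eq_intros)
  then show ?thesis by (simp only: Complex_eq)
qed

lemma Complex_eventually:
  assumes "open S" "Complex a b \<in> S"
  shows "\<forall>\<^sub>F t in nhds b. Complex a t \<in> S"
proof -
  have "open (Complex a -` S)"
    by (rule open_vimage[OF assms(1)])
      (auto intro!: continuous_at_imp_continuous_on has_vector_derivative_continuous[OF Complex_deriv_snd])
  then show ?thesis using assms(2) by (auto simp: eventually_nhds)
qed

text \<open>The free factor \<open>c\<close> lets one lemma treat real parts as well: multiplication
  by \<i> turns \<open>Im\<close> into \<open>Re\<close>, and the powers of \<i> produced by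
  repeated \<beta>-derivatives are absorbed.\<close>

lemma Im_deriv_snd:
  assumes "(G has_field_derivative G') (at (Complex a b))"
  shows "((\<lambda>t. Im (c * G (Complex a t))) has_real_derivative Im (c * \<i> * G')) (at b)"
proof -
  have "((G \<circ> Complex a) has_vector_derivative \<i> * G') (at b)"
    using field_vector_diff_chain_at[OF Complex_deriv_snd assms] by simp
  then have "((\<lambda>t. c * G (Complex a t)) has_vector_derivative c * (\<i> * G')) (at b)"
    by (intro has_vector_derivative_mult_right) (simp add: o_def)
  from bounded_linear.has_vector_derivative[OF bounded_linear_Im this]
  show ?thesis by (simp only: has_real_derivative_iff_has_vector_derivative mult.assoc)
qed

lemma Im_deriv_fst:
  assumes "(G has_field_derivative G') (at (Complex a b))"
  shows "((\<lambda>t. Im (c * G (Complex t b))) has_real_derivative Im (c * G')) (at a)"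
proof -
  have "((G \<circ> (\<lambda>t. Complex t b)) has_vector_derivative 1 * G') (at a)"
    using field_vector_diff_chain_at[OF Complex_deriv_fst assms] by simp
  then have "((\<lambda>t. c * G (Complex t b)) has_vector_derivative c * G') (at a)"
    by (intro has_vector_derivative_mult_right) (simp add: o_def)
  from bounded_linear.has_vector_derivative[OF bounded_linear_Im this]
  show ?thesis by (simp only: has_real_derivative_iff_has_vector_derivative)
qed

text \<open>The \<open>i\<close>-th derivative of \<open>Im H\<close> in the imaginary direction.\<close>

definition im_deriv :: "nat \<Rightarrow> (complex \<Rightarrow> complex) \<Rightarrow> complex \<Rightarrow> real" where
  "im_deriv i H z = Im (\<i> ^ i * (deriv ^^ i) H z)"

lemma im_deriv_snd:
  assumes "conj_holomorphic S H" "Complex a b \<in> S"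
  shows "((\<lambda>t. im_deriv i H (Complex a t)) has_real_derivative im_deriv (Suc i) H (Complex a b)) (at b)"
  unfolding im_deriv_def using Im_deriv_snd[OF conj_holomorphic_DERIV[OF assms]]
  by (simp add: mult_ac)

lemma im_deriv_fst:
  assumes "conj_holomorphic S H" "Complex a b \<in> S"
  shows "((\<lambda>t. im_deriv i H (Complex t b)) has_real_derivative im_deriv i (deriv H) (Complex a b)) (at a)"
  unfolding im_deriv_def using Im_deriv_fst[OF conj_holomorphic_DERIV[OF assms]]
  by (simp add: funpow_swap1)

section \<open>The iterates of \<beta>^(-1) \<partial>_\<beta> and their extension to the real
  axis\<close>

text \<open>In the Taylor series of \<beta>^(-1) \<open>Im H\<close>, the term of degree 2k is
  (-1)^k H^(2k+1) \<beta>^(2k) / (2k+1)!. The iterate T^k kills the lower terms and multiplies this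
  one by 2^k k! \<beta>^(-2k); what remains is (-1)^k / (2k+1)!!.\<close>

definition axis_coeff :: "nat \<Rightarrow> real" where
  "axis_coeff k = (- 1) ^ k / (\<Prod>i\<le>k. 2 * real i + 1)"

text \<open>This is the differential equation for \<open>sph\<close> at \<beta> = 0, where its
  \<beta>^2 term disappears.\<close>

lemma axis_coeff_rec: "axis_coeff k = - (2 * real k + 3) * axis_coeff (Suc k)"
proof -
  have "(\<Prod>i\<le>k. 2 * real i + 1) \<noteq> 0" by auto
  then show ?thesis unfolding axis_coeff_def by (simp add: divide_simps) (simp add: algebra_simps)
qed

text \<open>With \<open>\<beta> = Im z\<close>, this is \<open>(\<beta>\<^sup>-\<^sup>1 \<partial>/\<partial>\<beta>)\<^sup>k (\<beta>\<^sup>-\<^sup>1 Im H)\<close>, extended continuously to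
  the real axis.\<close>

definition sph :: "nat \<Rightarrow> (complex \<Rightarrow> complex) \<Rightarrow> complex \<Rightarrow> real" where
  "sph k H z = (if Im z = 0 then axis_coeff k * Re ((deriv ^^ (2 * k + 1)) H z)
     else lap_sum k (\<lambda>i. im_deriv i H z) (Im z))"

lemma sph_snd_off_axis:
  assumes "conj_holomorphic S H" "Complex a b \<in> S" "b \<noteq> 0"
  shows "((\<lambda>t. sph k H (Complex a t)) has_real_derivative b * sph (Suc k) H (Complex a b)) (at b)"
proof -
  have "((\<lambda>t. lap_sum k (\<lambda>i. im_deriv i H (Complex a t)) t) has_real_derivative b * sph (Suc k) H (Complex a b)) (at b)"
    using lap_sum_deriv[OF assms(3), of "\<lambda>i t. im_deriv i H (Complex a t)"] im_deriv_snd[OF assms(1,2)] assms(3)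
    by (simp add: sph_def)
  moreover have "\<forall>\<^sub>F t in nhds b. sph k H (Complex a t) = lap_sum k (\<lambda>i. im_deriv i H (Complex a t)) t"
    using t1_space_nhds[OF assms(3)] by eventually_elim (simp add: sph_def)
  ultimately show ?thesis by (subst DERIV_cong_ev) auto
qed

lemma sph_fst:
  assumes "conj_holomorphic S H" "Complex a b \<in> S"
  shows "((\<lambda>t. sph k H (Complex t b)) has_real_derivative sph k (deriv H) (Complex a b)) (at a)"
proof (cases "b = 0")
  case False
  then show ?thesis unfolding sph_def lap_sum_def
    by (auto intro!: derivative_eq_intros im_deriv_fst[OF assms] sum.cong)
next
  case True
  have "((\<lambda>t. Re ((deriv ^^ (2 * k + 1)) H (Complex t 0))) has_real_derivative Re ((deriv ^^ (2 * k + 2)) H (Complex a 0))) (at a)"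
    using Im_deriv_fst[of "(deriv ^^ (2 * k + 1)) H" _ a 0 \<i>] conj_holomorphic_DERIV[OF assms, of "2 * k + 1"] True
    by (simp add: mult_ac)
  then have "((\<lambda>t. axis_coeff k * Re ((deriv ^^ (2 * k + 1)) H (Complex t 0))) has_real_derivative axis_coeff k * Re ((deriv ^^ (2 * k + 2)) H (Complex a 0))) (at a)"
    by (rule DERIV_cmult)
  then show ?thesis using True by (simp add: sph_def funpow_swap1)
qed

lemma sph_0: "z \<in> S \<Longrightarrow> conj_holomorphic S H \<Longrightarrow> Im z * sph 0 H z = Im (H z)"
  using conj_holomorphic_real[of S H z 0]
  by (auto simp: sph_def lap_sum_def im_deriv_def lap_coeff_def power_int_minus)

text \<open>For \<open>k = 0\<close> this restates that the second \<beta>-derivative of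
  \<open>Im H\<close> is minus the imaginary part of H''. Applying T to the equation raises every
  index by one, and the derivative of b^2 contributes the 2 that turns 2k+3 into 2k+5.\<close>

lemma sph_pde_off_axis:
  assumes "conj_holomorphic S H" "Complex a b \<in> S" "b \<noteq> 0"
  shows "sph k (deriv (deriv H)) (Complex a b) =
    - (2 * real k + 3) * sph (k + 1) H (Complex a b) - b\<^sup>2 * sph (k + 2) H (Complex a b)"
  using assms(2,3)
proof (induction k arbitrary: a b)
  case 0
  have "{..2} = {0, 1, 2::nat}" "{..Suc 0} = {0, 1}" by auto
  then show ?case using 0
    apply (simp add: sph_def lap_sum_def)
    apply (simp add: im_deriv_def lap_coeff_def power_int_def fact_numeral numeral_2_eq_2 numeral_eq_Suc)
    apply (simp add: field_simps power2_eq_square)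
    done
next
  case (Suc k)
  have H2: "conj_holomorphic S (deriv (deriv H))" using assms(1) by (intro conj_holomorphic_deriv)
  have S: "open S" using assms(1) by (auto simp: conj_holomorphic_def)
  let ?p = "\<lambda>k t. sph k H (Complex a t)"
  have 1: "((\<lambda>t. sph k (deriv (deriv H)) (Complex a t)) has_real_derivative b * sph (Suc k) (deriv (deriv H)) (Complex a b)) (at b)"
    by (rule sph_snd_off_axis[OF H2 Suc.prems])
  have 2: "((\<lambda>t. - (2 * real k + 3) * ?p (k + 1) t - t\<^sup>2 * ?p (k + 2) t) has_real_derivative
      - (2 * real k + 3) * (b * ?p (k + 2) b) - (2 * b * ?p (k + 2) b + b\<^sup>2 * (b * ?p (k + 3) b))) (at b)"
    using sph_snd_off_axis[OF assms(1) Suc.prems, of "k+1"] sph_snd_off_axis[OF assms(1) Suc.prems, of "k+2"]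
    by (auto intro!: derivative_eq_intros simp: numeral_eq_Suc)
  note ev = Complex_eventually[OF S Suc.prems(1)]
  have "\<forall>\<^sub>F t in nhds b. sph k (deriv (deriv H)) (Complex a t) = - (2 * real k + 3) * ?p (k + 1) t - t\<^sup>2 * ?p (k + 2) t"
    using ev t1_space_nhds[OF Suc.prems(2)] by eventually_elim (use Suc.IH in auto)
  with 2 have "((\<lambda>t. sph k (deriv (deriv H)) (Complex a t)) has_real_derivative
      - (2 * real k + 3) * (b * ?p (k + 2) b) - (2 * b * ?p (k + 2) b + b\<^sup>2 * (b * ?p (k + 3) b))) (at b)"
    by (subst DERIV_cong_ev) auto
  from DERIV_unique[OF 1 this] Suc.prems(2)
  have "b * sph (Suc k) (deriv (deriv H)) (Complex a b) = b * (- (2 * real k + 5) * ?p (k + 2) b - b\<^sup>2 * ?p (k + 3) b)"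
    by (simp add: algebra_simps power2_eq_square)
  then have "sph (Suc k) (deriv (deriv H)) (Complex a b) = - (2 * real k + 5) * ?p (k + 2) b - b\<^sup>2 * ?p (k + 3) b"
    using Suc.prems(2) by (simp only: mult_cancel_left) simp
  then show ?case by (simp add: numeral_eq_Suc algebra_simps)
qed

text \<open>With \<open>c = axis_coeff k\<close>, the stronger expansion
  \<open>\<beta>\<^bsup>2k+1\<^esup> sph k H = c H\<^bsup>(2k+1)\<^esup> \<beta>\<^bsup>2k+1\<^esup> + o(\<beta>\<^bsup>2k+2\<^esup>)\<close> passes from \<open>k\<close> to \<open>k + 1\<close> by l'Hopital's rule,
  because the differential equation says
  \<open>\<partial>\<^sub>\<beta> (\<beta>\<^bsup>2k+3\<^esup> sph (k+1) H) = - \<beta>\<^bsup>2k+2\<^esup> sph k H''\<close>.\<close>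

lemma sph_tendsto_axis:
  assumes "conj_holomorphic S H" "Complex a 0 \<in> S"
  shows "((\<lambda>b. (sph k H (Complex a b) - sph k H (Complex a 0)) / b) \<longlongrightarrow> 0) (at 0)"
  using assms
proof (induction k arbitrary: H)
  case 0
  let ?v = "\<lambda>i b. im_deriv i H (Complex a b)"
  have S: "open S" using 0 by (auto simp: conj_holomorphic_def)
  have ev: "\<forall>\<^sub>F t in at 0. Complex a t \<in> S"
    using Complex_eventually[OF S 0(2)] by (simp add: eventually_at_filter eventually_mono)
  have im0: "?v 0 0 = 0" "?v 2 0 = 0"
    using conj_holomorphic_real[OF 0, of 0] conj_holomorphic_real[OF 0, of 2] by (auto simp: im_deriv_def)
  have v1: "?v 1 0 = sph 0 H (Complex a 0)" by (simp add: im_deriv_def sph_def axis_coeff_def)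
  note d = im_deriv_snd[OF 0(1)]
  \<comment> \<open>The limit is half the second \<beta>-derivative of \<open>Im H\<close> at a real
    point; it vanishes because H'' is real there.\<close>
  have lim0: "((\<lambda>b. (?v 1 b - ?v 1 0) / (2 * b)) \<longlongrightarrow> 0) (at 0)"
  proof -
    have "((\<lambda>b. (?v 1 b - ?v 1 0) / b) \<longlongrightarrow> ?v 2 0) (at 0)"
      using d[OF 0(2), of 1] by (simp add: has_field_derivative_iff numeral_2_eq_2)
    then have "((\<lambda>b. (1/2) * ((?v 1 b - ?v 1 0) / b)) \<longlongrightarrow> (1/2) * ?v 2 0) (at 0)"
      by (rule tendsto_mult_left)
    then show ?thesis using im0 by simp
  qed
  have "((\<lambda>b. (?v 0 b - ?v 1 0 * b) / b\<^sup>2) \<longlongrightarrow> 0) (at 0)"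
  proof (rule lhopital[where f' = "\<lambda>b. ?v 1 b - ?v 1 0" and g' = "\<lambda>b. 2 * b"])
    have "isCont (?v 0) 0" using d[OF 0(2), of 0] DERIV_isCont by blast
    then have "((\<lambda>b. ?v 0 b - ?v 1 0 * b) \<longlongrightarrow> ?v 0 0 - ?v 1 0 * 0) (at 0)"
      by (intro tendsto_intros) (simp add: isCont_def)
    then show "((\<lambda>b. ?v 0 b - ?v 1 0 * b) \<longlongrightarrow> 0) (at 0)" using im0 by simp
    show "((\<lambda>b. b\<^sup>2) \<longlongrightarrow> 0) (at (0::real))" by (auto intro!: tendsto_eq_intros)
    show "\<forall>\<^sub>F b in at 0. (b\<^sup>2 :: real) \<noteq> 0" "\<forall>\<^sub>F b in at 0. (2 * b :: real) \<noteq> 0"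
      by (auto simp: eventually_at_filter)
    show "\<forall>\<^sub>F b in at 0. ((\<lambda>b. ?v 0 b - ?v 1 0 * b) has_real_derivative ?v 1 b - ?v 1 0) (at b)"
      using ev
    proof eventually_elim
      case (elim b)
      show ?case using d[OF elim, of 0] by (auto intro!: derivative_eq_intros)
    qed
    show "\<forall>\<^sub>F b in at 0. ((\<lambda>b. b\<^sup>2 :: real) has_real_derivative 2 * b) (at b)"
      by (auto intro!: always_eventually derivative_eq_intros)
  qed (rule lim0)
  then show ?case
  proof (rule tendsto_cong[THEN iffD1, rotated])
    show "\<forall>\<^sub>F b in at 0. (?v 0 b - ?v 1 0 * b) / b\<^sup>2 = (sph 0 H (Complex a b) - sph 0 H (Complex a 0)) / b"
      using ev eventually_neq_at_within[of 0 0]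
    proof eventually_elim
      case (elim b)
      then have "?v 0 b = b * sph 0 H (Complex a b)"
        using sph_0[OF elim(1) 0(1)] by (simp add: im_deriv_def)
      then show ?case using elim(2) v1 by (simp add: divide_simps power2_eq_square) (simp add: algebra_simps)
    qed
  qed
next
  case (Suc k)
  let ?H2 = "deriv (deriv H)"
  have H2: "conj_holomorphic S ?H2" using Suc.prems(1) by (intro conj_holomorphic_deriv)
  have S: "open S" using Suc.prems by (auto simp: conj_holomorphic_def)
  have ev: "\<forall>\<^sub>F t in at 0. Complex a t \<in> S"
    using Complex_eventually[OF S Suc.prems(2)] by (simp add: eventually_at_filter eventually_mono)
  let ?s = "\<lambda>k b. sph k H (Complex a b)" and ?r = "\<lambda>b. sph k ?H2 (Complex a b)"
  \<comment> \<open>With this value the numerator in \<open>lim0\<close> is minus b^(2k+2) times the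
    difference \<open>?r b - ?r 0\<close>, so the induction hypothesis applies, but to H'' instead
    of H; hence the generalization over \<open>H\<close>.\<close>
  have r0: "?r 0 = - (2 * real k + 3) * ?s (Suc k) 0"
    unfolding sph_def using axis_coeff_rec[of k]
    by (simp del: funpow.simps add: funpow_swap1[symmetric]) (simp add: funpow_swap1)
  have lim0: "((\<lambda>b. (- (b ^ (2*k+2) * ?r b) - (2 * real k + 3) * (?s (Suc k) 0 * b ^ (2*k+2))) / ((2 * real k + 4) * b ^ (2 * k + 3))) \<longlongrightarrow> 0) (at 0)"
  proof -
    have "((\<lambda>b. (- 1 / (2 * real k + 4)) * ((?r b - ?r 0) / b)) \<longlongrightarrow> (- 1 / (2 * real k + 4)) * 0) (at 0)"
      by (rule tendsto_mult_left) (rule Suc.IH[OF H2 Suc.prems(2)])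
    then have "((\<lambda>b. (- 1 / (2 * real k + 4)) * ((?r b - ?r 0) / b)) \<longlongrightarrow> 0) (at 0)"
      by (simp only: mult_zero_right)
    then show ?thesis
    proof (rule tendsto_cong[THEN iffD1, rotated])
      show "\<forall>\<^sub>F b in at 0. (- 1 / (2 * real k + 4)) * ((?r b - ?r 0) / b) =
          (- (b ^ (2*k+2) * ?r b) - (2 * real k + 3) * (?s (Suc k) 0 * b ^ (2*k+2))) / ((2 * real k + 4) * b ^ (2 * k + 3))"
        using eventually_neq_at_within[of 0 0]
      proof eventually_elim
        case (elim b)
        have "b ^ (2*k+3) = b * b ^ (2*k+2)" "b ^ (2*k+2) \<noteq> 0" using elim by (simp_all add: numeral_eq_Suc)
        moreover have "- (b ^ (2*k+2) * ?r b) - (2 * real k + 3) * (?s (Suc k) 0 * b ^ (2*k+2)) = - (?r b - ?r 0) * b ^ (2*k+2)"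
          unfolding r0 by (simp add: algebra_simps)
        ultimately show ?case using elim by (simp add: divide_simps)
      qed
    qed
  qed
  have "((\<lambda>b. (b ^ (2*k+3) * ?s (Suc k) b - ?s (Suc k) 0 * b ^ (2*k+3)) / b ^ (2*k+4)) \<longlongrightarrow> 0) (at 0)"
  proof (rule lhopital[OF _ _ _ _ _ _ lim0])
    have "((\<lambda>b. b ^ (2*k+3) * ?s (Suc k) b) \<longlongrightarrow> 0) (at 0)"
    proof (rule tendsto_cong[THEN iffD1])
      \<comment> \<open>Multiplication by b^(2k+3) clears all negative powers. At b = 0 only the
        summand \<open>i = 0\<close> could survive, and it contains \<open>Im H\<close>, which
        vanishes there.\<close>
      let ?e = "\<lambda>b. \<Sum>i\<le>Suc k. lap_coeff (Suc k + 1) (i + 1) * (b ^ i * im_deriv i H (Complex a b))"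
      show "\<forall>\<^sub>F b in at 0. ?e b = b ^ (2*k+3) * ?s (Suc k) b"
        using eventually_neq_at_within[of 0 0]
      proof eventually_elim
        case (elim b)
        have "b ^ (2*k+3) * b powi (int i - 2 * int (Suc k) - 1) = b ^ i" for i
        proof -
          have "b ^ (2*k+3) * b powi (int i - 2 * int (Suc k) - 1) = b powi (int (2*k+3) + (int i - 2 * int (Suc k) - 1))"
            using elim by (subst power_int_add) (simp_all only: power_int_of_nat simp_thms)
          then show ?thesis by (simp add: algebra_simps)
        qed
        then have *: "b ^ (2*k+3) * (c * b powi (int i - 2 * int (Suc k) - 1) * x) = c * (b ^ i * x)" for c x i
          by (metis mult.assoc mult.left_commute)
        show ?case using elim by (simp only: sph_def lap_sum_def sum_distrib_left * complex.sel if_False)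
      qed
      have "isCont (\<lambda>b. im_deriv i H (Complex a b)) 0" for i
        using im_deriv_snd[OF Suc.prems, of i] DERIV_isCont by blast
      then have "(?e \<longlongrightarrow> (\<Sum>i\<le>Suc k. lap_coeff (Suc k + 1) (i + 1) * (0 ^ i * im_deriv i H (Complex a 0)))) (at 0)"
        by (intro tendsto_intros) (auto simp: isCont_def)
      moreover have "(\<Sum>i\<le>Suc k. lap_coeff (Suc k + 1) (i + 1) * (0 ^ i * im_deriv i H (Complex a 0))) = 0"
        using conj_holomorphic_real[OF Suc.prems, of 0]
        by (intro sum.neutral) (auto simp: im_deriv_def power_0_left)
      ultimately show "(?e \<longlongrightarrow> 0) (at 0)" by simp
    qed
    then have "((\<lambda>b. b ^ (2*k+3) * ?s (Suc k) b - ?s (Suc k) 0 * b ^ (2*k+3)) \<longlongrightarrow> 0 - ?s (Suc k) 0 * 0 ^ (2*k+3)) (at 0)"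
      by (intro tendsto_diff tendsto_mult_left tendsto_power tendsto_ident_at)
    then show "((\<lambda>b. b ^ (2*k+3) * ?s (Suc k) b - ?s (Suc k) 0 * b ^ (2*k+3)) \<longlongrightarrow> 0) (at 0)"
      by (simp add: power_0_left)
    show "((\<lambda>b. b ^ (2*k+4)) \<longlongrightarrow> 0) (at (0::real))" by (auto intro!: tendsto_eq_intros)
    show "\<forall>\<^sub>F b in at 0. (b ^ (2*k+4) :: real) \<noteq> 0" "\<forall>\<^sub>F b in at 0. ((2 * real k + 4) * b ^ (2*k+3)) \<noteq> 0"
      by (auto simp: eventually_at_filter add_eq_0_iff)
    show "\<forall>\<^sub>F b in at 0. ((\<lambda>b. b ^ (2*k+4)) has_real_derivative (2 * real k + 4) * b ^ (2*k+3)) (at b)"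
      using DERIV_pow[of "2*k+4"] by (intro always_eventually allI) (simp add: algebra_simps numeral_eq_Suc)
    show "\<forall>\<^sub>F b in at 0. ((\<lambda>b. b ^ (2*k+3) * ?s (Suc k) b - ?s (Suc k) 0 * b ^ (2*k+3)) has_real_derivative
        - (b ^ (2*k+2) * ?r b) - (2 * real k + 3) * (?s (Suc k) 0 * b ^ (2*k+2))) (at b)"
      using ev eventually_neq_at_within[of 0 0]
    proof eventually_elim
      case (elim b)
      have "((\<lambda>b. b ^ (2*k+3) * ?s (Suc k) b - ?s (Suc k) 0 * b ^ (2*k+3)) has_real_derivative
        (2 * real k + 3) * b ^ (2*k+2) * ?s (Suc k) b + b ^ (2*k+3) * (b * ?s (Suc (Suc k)) b)
          - ?s (Suc k) 0 * ((2 * real k + 3) * b ^ (2*k+2))) (at b)"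
      proof -
        have 1: "((\<lambda>b. b ^ (2*k+3)) has_real_derivative (2 * real k + 3) * b ^ (2*k+2)) (at b)"
          using DERIV_pow[of "2*k+3" b] by (simp add: algebra_simps numeral_eq_Suc)
        show ?thesis
          by (rule DERIV_cong[OF DERIV_diff[OF DERIV_mult[OF 1 sph_snd_off_axis[OF Suc.prems(1) elim, of "Suc k"]]
            DERIV_cmult[OF 1]]]) (simp add: mult_ac)
      qed
      moreover have "(2 * real k + 3) * b ^ (2*k+2) * ?s (Suc k) b + b ^ (2*k+3) * (b * ?s (Suc (Suc k)) b)
          - ?s (Suc k) 0 * ((2 * real k + 3) * b ^ (2*k+2)) =
        - (b ^ (2*k+2) * ?r b) - (2 * real k + 3) * (?s (Suc k) 0 * b ^ (2*k+2))"
      proof -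
        define X where "X = b ^ (2*k+2)"
        have X: "b ^ (2*k+3) = b * X" by (simp add: X_def numeral_eq_Suc)
        have r: "?r b = - (2 * real k + 3) * ?s (Suc k) b - b\<^sup>2 * ?s (Suc (Suc k)) b"
          using sph_pde_off_axis[OF Suc.prems(1) elim, of k] by simp
        show ?thesis unfolding X r X_def[symmetric] by (simp add: algebra_simps power2_eq_square)
      qed
      ultimately show ?case by (rule DERIV_cong)
    qed
  qed
  then show ?case
  proof (rule tendsto_cong[THEN iffD1, rotated])
    show "\<forall>\<^sub>F b in at 0. (b ^ (2*k+3) * ?s (Suc k) b - ?s (Suc k) 0 * b ^ (2*k+3)) / b ^ (2*k+4) = (?s (Suc k) b - ?s (Suc k) 0) / b"
      using eventually_neq_at_within[of 0 0]
    proof eventually_elim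
      case (elim b)
      define X where "X = b ^ (2*k+3)"
      have "b ^ (2*k+4) = X * b" by (simp add: X_def numeral_eq_Suc)
      moreover have "X \<noteq> 0" using elim by (simp add: X_def)
      moreover have "X * ?s (Suc k) b - ?s (Suc k) 0 * X = X * (?s (Suc k) b - ?s (Suc k) 0)"
        by (simp add: algebra_simps)
      ultimately show ?case unfolding X_def[symmetric] by simp
    qed
  qed
qed

text \<open>At \<open>b = 0\<close> the claimed derivative is 0, which is exactly the limit of
  difference quotients found above.\<close>

lemma sph_snd:
  assumes "conj_holomorphic S H" "Complex a b \<in> S"
  shows "((\<lambda>t. sph k H (Complex a t)) has_real_derivative b * sph (Suc k) H (Complex a b)) (at b)"
proof (cases "b = 0")
  case True
  then show ?thesis using sph_tendsto_axis[of S H a k] assms by (simp add: has_field_derivative_iff)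
qed (rule sph_snd_off_axis[OF assms])

lemma sph_pde:
  assumes "conj_holomorphic S H" "Complex a b \<in> S"
  shows "sph k (deriv (deriv H)) (Complex a b) =
    - (2 * real k + 3) * sph (k + 1) H (Complex a b) - b\<^sup>2 * sph (k + 2) H (Complex a b)"
proof (cases "b = 0")
  case True
  then show ?thesis unfolding sph_def using axis_coeff_rec[of k]
    by (simp del: funpow.simps add: funpow_swap1[symmetric]) (simp add: funpow_swap1)
qed (rule sph_pde_off_axis[OF assms])

section \<open>Derivatives along lines in the complex plane\<close>

lemma has_vector_derivative_translate:
  fixes f :: "real \<Rightarrow> 'b::real_normed_vector"
  shows "((\<lambda>t. f (t + c)) has_vector_derivative d) (at x) \<longleftrightarrow> (f has_vector_derivative d) (at (x + c))"
proof -
  have *: "((\<lambda>t. g (t + a)) has_vector_derivative d) (at y)" if "(g has_vector_derivative d) (at (y + a))"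
    for g :: "real \<Rightarrow> 'b" and y a
  proof -
    have "((\<lambda>t. t + a) has_vector_derivative 1) (at y)" by (auto intro!: derivative_eq_intros)
    from vector_diff_chain_at[OF this that] show ?thesis by (simp add: o_def)
  qed
  show ?thesis using *[of f x c] *[of "\<lambda>t. f (t + c)" "x + c" "- c"] by auto
qed

lemma deriv_snd_iff:
  fixes q :: "complex \<Rightarrow> 'b::real_normed_vector"
  shows "((\<lambda>t. q (z + t *\<^sub>R \<i>)) has_vector_derivative d) (at 0) \<longleftrightarrow>
    ((\<lambda>t. q (Complex (Re z) t)) has_vector_derivative d) (at (Im z))"
proof -
  have *: "z + t *\<^sub>R \<i> = Complex (Re z) (t + Im z)" for t
    by (simp add: complex_eq_iff)
  show ?thesis unfolding *
    using has_vector_derivative_translate[of "\<lambda>t. q (Complex (Re z) t)" "Im z" d 0] by simp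
qed

lemma deriv_fst_iff:
  fixes q :: "complex \<Rightarrow> 'b::real_normed_vector"
  shows "((\<lambda>t. q (z + t *\<^sub>R 1)) has_vector_derivative d) (at 0) \<longleftrightarrow>
    ((\<lambda>t. q (Complex t (Im z))) has_vector_derivative d) (at (Re z))"
proof -
  have *: "z + t *\<^sub>R 1 = Complex (t + Re z) (Im z)" for t
    by (simp add: complex_eq_iff)
  show ?thesis unfolding *
    using has_vector_derivative_translate[of "\<lambda>t. q (Complex t (Im z))" "Re z" d 0] by simp
qed

lemma eventually_along:
  fixes z :: "'a::real_normed_vector"
  assumes "open S" "z \<in> S"
  shows "\<forall>\<^sub>F t in nhds 0. z + t *\<^sub>R v \<in> S"
proof -
  have "continuous_on UNIV (\<lambda>t. z + t *\<^sub>R v)" by (intro continuous_intros)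
  then have "open ((\<lambda>t. z + t *\<^sub>R v) -` S)" using assms(1) by (simp add: open_vimage)
  then show ?thesis using assms(2) by (auto simp: eventually_nhds)
qed

lemma dir_deriv_eqI:
  assumes "((\<lambda>t. f (x + t *\<^sub>R v)) has_vector_derivative d) (at 0)"
  shows "dir_deriv v f x = d" "dir_differentiable v f x"
  using assms by (auto simp: dir_deriv_def dir_differentiable_def vector_derivative_at differentiableI_vector)

lemma has_vector_derivative_eventually:
  assumes "(f has_vector_derivative d) (at x)" "\<forall>\<^sub>F t in nhds x. f t = g t"
  shows "(g has_vector_derivative d) (at x)"
  using assms has_vector_derivative_cong_ev[where S=UNIV and f=f and g=g and x=x and f'=d] eventually_nhds_x_imp_x[OF assms(2)]
  by (simp add: eventually_mono)

lemma im_deriv_differentiable: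
  assumes "conj_holomorphic S H" "z \<in> S"
  shows "im_deriv i H differentiable (at z)"
proof -
  have "(deriv ^^ i) H differentiable (at z)"
    using conj_holomorphic_DERIV[OF assms, of i] by (metis differentiable_def has_field_derivative_def)
  then have "(\<lambda>z. \<i> ^ i * (deriv ^^ i) H z) differentiable (at z)"
    by (intro differentiable_mult) auto
  then have "(\<lambda>z. Im (\<i> ^ i * (deriv ^^ i) H z)) differentiable (at z)"
    using differentiable_compose[OF bounded_linear_imp_differentiable[OF bounded_linear_Im]] by blast
  then show ?thesis by (simp add: im_deriv_def[abs_def])
qed

lemma Im_differentiable: "Im differentiable (at z)"
  by (rule bounded_linear_imp_differentiable[OF bounded_linear_Im])

lemma off_axis_open: "open S \<Longrightarrow> open {z \<in> S. Im z \<noteq> 0}"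
proof -
  assume "open S"
  moreover have "open {z. Im z \<noteq> 0}" by (intro open_Collect_neq continuous_intros)
  ultimately show ?thesis by (simp add: open_Int Collect_conj_eq)
qed

lemma sph_differentiable:
  assumes "conj_holomorphic S H" "z \<in> S" "Im z \<noteq> 0"
  shows "sph k H differentiable (at z)"
proof -
  have "(\<lambda>z. lap_sum k (\<lambda>i. im_deriv i H z) (Im z)) differentiable (at z)"
    unfolding lap_sum_def using assms(3)
    by (intro differentiable_sum ballI differentiable_mult differentiable_const differentiable_power_int
        Im_differentiable im_deriv_differentiable[OF assms(1,2)]) simp_all
  then obtain D where "((\<lambda>z. lap_sum k (\<lambda>i. im_deriv i H z) (Im z)) has_derivative D) (at z)"
    by (auto simp: differentiable_def)
  moreover have "open {z. Im z \<noteq> 0}" by (intro open_Collect_neq continuous_intros)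
  ultimately have "(sph k H has_derivative D) (at z)"
    by (rule has_derivative_transform_within_open) (auto simp: assms(3) sph_def)
  then show ?thesis by (auto simp: differentiable_def)
qed

section \<open>Iterated \<beta>-derivatives of the spherical derivative off the real axis\<close>

text \<open>The \<beta>-derivative of a generator is again a sum of two generators, with
  \<open>n\<close> lowered, or with \<open>n\<close> and \<open>k\<close> both raised. Membership
  therefore yields existence of all \<beta>-derivatives and also joint differentiability in
  (\<alpha>, \<beta>), without a formula for the iterates.\<close>

inductive_set sph_span :: "(complex \<Rightarrow> complex) \<Rightarrow> (complex \<Rightarrow> real) set" for H where
  base: "(\<lambda>z. c * Im z powi n * sph k H z) \<in> sph_span H"
| add: "p \<in> sph_span H \<Longrightarrow> q \<in> sph_span H \<Longrightarrow> (\<lambda>z. p z + q z) \<in> sph_span H"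

lemma sph_span_differentiable:
  assumes "q \<in> sph_span H" "conj_holomorphic S H" "z \<in> S" "Im z \<noteq> 0"
  shows "q differentiable (at z)"
  using assms(1)
proof induction
  case (base c n k)
  show ?case using assms
    by (intro differentiable_mult differentiable_const differentiable_power_int Im_differentiable
        sph_differentiable) auto
qed (rule differentiable_add)

lemma sph_span_deriv:
  assumes "q \<in> sph_span H"
  shows "\<exists>q'\<in>sph_span H. \<forall>S z. conj_holomorphic S H \<and> z \<in> S \<and> Im z \<noteq> 0 \<longrightarrow>
    ((\<lambda>t. q (z + t *\<^sub>R \<i>)) has_vector_derivative q' z) (at 0)"
  using assms
proof induction
  case (base c n k)
  let ?q = "\<lambda>z. (c * of_int n) * Im z powi (n - 1) * sph k H z + c * Im z powi (n + 1) * sph (Suc k) H z"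
  have "?q \<in> sph_span H" by (intro sph_span.intros)
  moreover have "((\<lambda>t. c * Im (z + t *\<^sub>R \<i>) powi n * sph k H (z + t *\<^sub>R \<i>)) has_vector_derivative ?q z) (at 0)"
    if "conj_holomorphic S H" "z \<in> S" "Im z \<noteq> 0" for S z
  proof -
    have "((\<lambda>t. c * t powi n * sph k H (Complex (Re z) t)) has_real_derivative ?q z) (at (Im z))"
      using sph_snd[of S H "Re z" "Im z" k] that power_int_add_1[of "Im z" n]
      by (auto intro!: derivative_eq_intros)
    then show ?thesis
      using deriv_snd_iff[of "\<lambda>z. c * Im z powi n * sph k H z"]
      by (simp add: has_real_derivative_iff_has_vector_derivative)
  qed
  ultimately show ?case by (intro bexI[of _ ?q]) blast+
next
  case (add p q)
  then obtain p' q' where *: "p' \<in> sph_span H" "q' \<in> sph_span H"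
    "\<And>S z. conj_holomorphic S H \<Longrightarrow> z \<in> S \<Longrightarrow> Im z \<noteq> 0 \<Longrightarrow>
      ((\<lambda>t. p (z + t *\<^sub>R \<i>)) has_vector_derivative p' z) (at 0)"
    "\<And>S z. conj_holomorphic S H \<Longrightarrow> z \<in> S \<Longrightarrow> Im z \<noteq> 0 \<Longrightarrow>
      ((\<lambda>t. q (z + t *\<^sub>R \<i>)) has_vector_derivative q' z) (at 0)"
    by blast
  show ?case
    by (rule bexI[OF _ sph_span.add[OF *(1,2)]]) (auto intro: has_vector_derivative_add *(3,4))
qed

text \<open>Kept as a literal iterated directional derivative, so that it matches
  \<open>d_beta h ^^ j\<close> in \<open>spherical_term\<close>.\<close>

definition sph_iter :: "nat \<Rightarrow> (complex \<Rightarrow> complex) \<Rightarrow> complex \<Rightarrow> real" where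
  "sph_iter j H = (dir_deriv \<i> ^^ j) (sph 0 H)"

lemma sph_iter_span:
  "\<exists>q\<in>sph_span H. \<forall>S z. conj_holomorphic S H \<and> z \<in> S \<and> Im z \<noteq> 0 \<longrightarrow> sph_iter j H z = q z"
proof (induction j)
  case 0
  have "(\<lambda>z. 1 * Im z powi 0 * sph 0 H z) \<in> sph_span H" by (rule sph_span.base)
  then show ?case by (intro bexI) (auto simp: sph_iter_def)
next
  case (Suc j)
  then obtain q where q: "q \<in> sph_span H"
    "\<And>S z. conj_holomorphic S H \<Longrightarrow> z \<in> S \<Longrightarrow> Im z \<noteq> 0 \<Longrightarrow> sph_iter j H z = q z" by blast
  from sph_span_deriv[OF q(1)] obtain q' where q': "q' \<in> sph_span H"
    "\<And>S z. conj_holomorphic S H \<Longrightarrow> z \<in> S \<Longrightarrow> Im z \<noteq> 0 \<Longrightarrow>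
      ((\<lambda>t. q (z + t *\<^sub>R \<i>)) has_vector_derivative q' z) (at 0)" by blast
  have "sph_iter (Suc j) H z = q' z" if "conj_holomorphic S H" "z \<in> S" "Im z \<noteq> 0" for S z
  proof -
    have "open {z \<in> S. Im z \<noteq> 0}" using that by (auto simp: conj_holomorphic_def intro: off_axis_open)
    then have "\<forall>\<^sub>F t in nhds 0. z + t *\<^sub>R \<i> \<in> {z \<in> S. Im z \<noteq> 0}"
      using that by (intro eventually_along) auto
    then have "\<forall>\<^sub>F t in nhds 0. q (z + t *\<^sub>R \<i>) = sph_iter j H (z + t *\<^sub>R \<i>)"
      by eventually_elim (use q(2)[OF that(1)] in auto)
    from has_vector_derivative_eventually[OF q'(2)[OF that] this]
    show ?thesis by (simp add: sph_iter_def dir_deriv_eqI)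
  qed
  then show ?case using q'(1) by blast
qed

lemma sph_iter_deriv:
  assumes "conj_holomorphic S H" "z \<in> S" "Im z \<noteq> 0"
  shows "((\<lambda>t. sph_iter j H (z + t *\<^sub>R \<i>)) has_vector_derivative sph_iter (Suc j) H z) (at 0)"
    "sph_iter j H differentiable (at z)"
proof -
  let ?U = "{z \<in> S. Im z \<noteq> 0}"
  have U: "open ?U" "z \<in> ?U" using assms by (auto simp: conj_holomorphic_def intro: off_axis_open)
  obtain q where q: "q \<in> sph_span H" "\<And>z. z \<in> ?U \<Longrightarrow> sph_iter j H z = q z"
    using sph_iter_span[of H j] assms(1) by auto
  from sph_span_deriv[OF q(1)] obtain q' where q':
    "((\<lambda>t. q (z + t *\<^sub>R \<i>)) has_vector_derivative q' z) (at 0)" using assms by blast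
  have "\<forall>\<^sub>F t in nhds 0. q (z + t *\<^sub>R \<i>) = sph_iter j H (z + t *\<^sub>R \<i>)"
    using eventually_along[OF U, of \<i>] by eventually_elim (use q(2) in auto)
  from has_vector_derivative_eventually[OF q' this]
  show "((\<lambda>t. sph_iter j H (z + t *\<^sub>R \<i>)) has_vector_derivative sph_iter (Suc j) H z) (at 0)"
    by (simp add: sph_iter_def dir_deriv_eqI)
  obtain D where "(q has_derivative D) (at z)"
    using sph_span_differentiable[OF q(1) assms] by (auto simp: differentiable_def)
  then have "(sph_iter j H has_derivative D) (at z)"
    using U by (rule has_derivative_transform_within_open) (simp add: q(2))
  then show "sph_iter j H differentiable (at z)" by (auto simp: differentiable_def)
qed

text \<open>T^(k+1) of \<open>sph 0 H\<close> is T^k of \<beta>^(-1) times the \<beta>-derivative of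
  \<open>sph 0 H\<close>. This has the shape expanded by \<open>lap_sum\<close>, with that
  derivative in place of \<open>Im H\<close>; it is why the first formula of the theorem has
  coefficients of order k and the second of order k+1.\<close>

lemma lap_sum_sph_iter:
  assumes "conj_holomorphic S H" "z \<in> S" "Im z \<noteq> 0"
  shows "lap_sum k (\<lambda>i. sph_iter (Suc i) H z) (Im z) = sph (Suc k) H z"
  using assms(2,3)
proof (induction k arbitrary: z)
  case 0
  have "sph_iter 1 H z = Im z * sph 1 H z"
  proof -
    have "((\<lambda>t. sph 0 H (z + t *\<^sub>R \<i>)) has_vector_derivative Im z * sph 1 H z) (at 0)"
      unfolding deriv_snd_iff using sph_snd[of S H "Re z" "Im z" 0] assms 0
      by (simp add: has_real_derivative_iff_has_vector_derivative)
    then show ?thesis by (simp add: sph_iter_def dir_deriv_eqI)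
  qed
  then show ?case using 0 by (simp add: lap_sum_def lap_coeff_def power_int_minus)
next
  case (Suc k)
  let ?U = "{z \<in> S. Im z \<noteq> 0}"
  have U: "open ?U" "z \<in> ?U" using assms Suc by (auto simp: conj_holomorphic_def intro: off_axis_open)
  have 1: "((\<lambda>t. sph (Suc k) H (z + t *\<^sub>R \<i>)) has_vector_derivative Im z * sph (Suc (Suc k)) H z) (at 0)"
    unfolding deriv_snd_iff using sph_snd[of S H "Re z" "Im z" "Suc k"] assms Suc.prems
    by (simp add: has_real_derivative_iff_has_vector_derivative)
  have "((\<lambda>t. lap_sum k (\<lambda>i. sph_iter (Suc i) H (Complex (Re z) t)) t) has_real_derivative
     Im z * lap_sum (Suc k) (\<lambda>i. sph_iter (Suc i) H (Complex (Re z) (Im z))) (Im z)) (at (Im z))"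
    using sph_iter_deriv(1)[OF assms(1) Suc.prems]
    by (intro lap_sum_deriv Suc.prems)
      (simp add: deriv_snd_iff has_real_derivative_iff_has_vector_derivative)
  then have 2: "((\<lambda>t. lap_sum k (\<lambda>i. sph_iter (Suc i) H (z + t *\<^sub>R \<i>)) (Im (z + t *\<^sub>R \<i>))) has_vector_derivative
     Im z * lap_sum (Suc k) (\<lambda>i. sph_iter (Suc i) H z) (Im z)) (at 0)"
    using deriv_snd_iff[of "\<lambda>z. lap_sum k (\<lambda>i. sph_iter (Suc i) H z) (Im z)"]
    by (simp add: has_real_derivative_iff_has_vector_derivative)
  have "\<forall>\<^sub>F t in nhds 0. lap_sum k (\<lambda>i. sph_iter (Suc i) H (z + t *\<^sub>R \<i>)) (Im (z + t *\<^sub>R \<i>)) = sph (Suc k) H (z + t *\<^sub>R \<i>)"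
    using eventually_along[OF U, of \<i>] by eventually_elim (rule Suc.IH; simp)
  from has_vector_derivative_eventually[OF 2 this] 1
  have "Im z * lap_sum (Suc k) (\<lambda>i. sph_iter (Suc i) H z) (Im z) = Im z * sph (Suc (Suc k)) H z"
    by (rule vector_derivative_unique_at)
  then show ?case using Suc.prems by simp
qed

subsection \<open>Laplacians of axially symmetric functions\<close>

text \<open>The witnesses \<open>g1\<close> and \<open>g2\<close> carry the existence of both
  derivatives along with the value, in a form stable under sums and bounded linear maps.\<close>

definition has_laplacian ::
    "'a::euclidean_space set \<Rightarrow> ('a \<Rightarrow> 'b::real_normed_vector) \<Rightarrow> ('a \<Rightarrow> 'b) \<Rightarrow> bool" where
  "has_laplacian U g L \<longleftrightarrow> (\<exists>g1 g2. \<forall>y\<in>U.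
     (\<forall>b\<in>Basis. ((\<lambda>t. g (y + t *\<^sub>R b)) has_vector_derivative g1 b y) (at 0) \<and>
       ((\<lambda>t. g1 b (y + t *\<^sub>R b)) has_vector_derivative g2 b y) (at 0)) \<and>
     L y = (\<Sum>b\<in>Basis. g2 b y))"

lemma has_laplacian_linear:
  assumes "has_laplacian U g L" "bounded_linear T"
  shows "has_laplacian U (\<lambda>y. T (g y)) (\<lambda>y. T (L y))"
proof -
  obtain g1 g2 where *: "\<And>y b. y \<in> U \<Longrightarrow> b \<in> Basis \<Longrightarrow> ((\<lambda>t. g (y + t *\<^sub>R b)) has_vector_derivative g1 b y) (at 0)"
    "\<And>y b. y \<in> U \<Longrightarrow> b \<in> Basis \<Longrightarrow> ((\<lambda>t. g1 b (y + t *\<^sub>R b)) has_vector_derivative g2 b y) (at 0)"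
    "\<And>y. y \<in> U \<Longrightarrow> L y = (\<Sum>b\<in>Basis. g2 b y)"
    using assms(1) unfolding has_laplacian_def by blast
  interpret T: bounded_linear T by fact
  show ?thesis unfolding has_laplacian_def
    by (rule exI[of _ "\<lambda>b y. T (g1 b y)"], rule exI[of _ "\<lambda>b y. T (g2 b y)"])
      (auto simp: * T.sum intro!: T.has_vector_derivative)
qed

lemma has_laplacian_add:
  assumes "has_laplacian U g L" "has_laplacian U g' L'"
  shows "has_laplacian U (\<lambda>y. g y + g' y) (\<lambda>y. L y + L' y)"
proof -
  obtain g1 g2 where *: "\<And>y b. y \<in> U \<Longrightarrow> b \<in> Basis \<Longrightarrow> ((\<lambda>t. g (y + t *\<^sub>R b)) has_vector_derivative g1 b y) (at 0)"
    "\<And>y b. y \<in> U \<Longrightarrow> b \<in> Basis \<Longrightarrow> ((\<lambda>t. g1 b (y + t *\<^sub>R b)) has_vector_derivative g2 b y) (at 0)"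
    "\<And>y. y \<in> U \<Longrightarrow> L y = (\<Sum>b\<in>Basis. g2 b y)"
    using assms(1) unfolding has_laplacian_def by blast
  obtain h1 h2 where **: "\<And>y b. y \<in> U \<Longrightarrow> b \<in> Basis \<Longrightarrow> ((\<lambda>t. g' (y + t *\<^sub>R b)) has_vector_derivative h1 b y) (at 0)"
    "\<And>y b. y \<in> U \<Longrightarrow> b \<in> Basis \<Longrightarrow> ((\<lambda>t. h1 b (y + t *\<^sub>R b)) has_vector_derivative h2 b y) (at 0)"
    "\<And>y. y \<in> U \<Longrightarrow> L' y = (\<Sum>b\<in>Basis. h2 b y)"
    using assms(2) unfolding has_laplacian_def by blast
  show ?thesis unfolding has_laplacian_def
    by (rule exI[of _ "\<lambda>b y. g1 b y + h1 b y"], rule exI[of _ "\<lambda>b y. g2 b y + h2 b y"])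
      (auto simp: * ** sum.distrib intro!: has_vector_derivative_add)
qed

lemma has_laplacian_zero: "has_laplacian U (\<lambda>y. 0) (\<lambda>y. 0)"
  unfolding has_laplacian_def by (rule exI[of _ "\<lambda>_ _. 0"], rule exI[of _ "\<lambda>_ _. 0"]) auto

lemma has_laplacian_sum:
  assumes "\<And>i. i \<in> I \<Longrightarrow> has_laplacian U (g i) (L i)"
  shows "has_laplacian U (\<lambda>y. \<Sum>i\<in>I. g i y) (\<lambda>y. \<Sum>i\<in>I. L i y)"
  using assms by (induction I rule: infinite_finite_induct) (auto intro: has_laplacian_zero has_laplacian_add)

lemma has_laplacian_cong:
  assumes "has_laplacian U g L" "open U" "\<And>y. y \<in> U \<Longrightarrow> g y = g' y" "\<And>y. y \<in> U \<Longrightarrow> L y = L' y"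
  shows "has_laplacian U g' L'"
proof -
  obtain g1 g2 where *: "\<And>y b. y \<in> U \<Longrightarrow> b \<in> Basis \<Longrightarrow> ((\<lambda>t. g (y + t *\<^sub>R b)) has_vector_derivative g1 b y) (at 0)"
    "\<And>y b. y \<in> U \<Longrightarrow> b \<in> Basis \<Longrightarrow> ((\<lambda>t. g1 b (y + t *\<^sub>R b)) has_vector_derivative g2 b y) (at 0)"
    "\<And>y. y \<in> U \<Longrightarrow> L y = (\<Sum>b\<in>Basis. g2 b y)"
    using assms(1) unfolding has_laplacian_def by blast
  have "((\<lambda>t. g' (y + t *\<^sub>R b)) has_vector_derivative g1 b y) (at 0)" if "y \<in> U" "b \<in> Basis" for y b
    using *(1)[OF that] eventually_mono[OF eventually_along[OF assms(2) that(1)] assms(3)]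
    by (rule has_vector_derivative_eventually)
  then show ?thesis unfolding has_laplacian_def
    by (intro exI[of _ g1] exI[of _ g2]) (use * assms(4) in auto)
qed

lemma Basis_paravector: "(Basis :: 'm::finite paravector set) = insert (1, 0) ((\<lambda>i. (0, axis i 1)) ` UNIV)"
  by (auto simp: Basis_prod_def Basis_vec_def)

lemma sum_Basis_paravector:
  "(\<Sum>b\<in>(Basis :: 'm::finite paravector set). G b) = G (1, 0) + (\<Sum>i\<in>UNIV. G (0, axis i 1))"
proof -
  have "inj (\<lambda>i. (0, axis i 1) :: 'm paravector)" by (auto simp: inj_def axis_eq_axis)
  moreover have "(1, 0) \<notin> range (\<lambda>i. (0, axis i 1) :: 'm paravector)" by auto
  ultimately show ?thesis unfolding Basis_paravector by (simp add: sum.reindex)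
qed

text \<open>The point \<open>\<alpha> + \<i> \<beta>\<close>, \<open>\<beta> \<ge> 0\<close>, of the slice through a paravector.\<close>

definition upper_point :: "'m::finite paravector \<Rightarrow> complex" where
  "upper_point y = Complex (fst y) (norm (snd y))"

text \<open>\<open>R1\<close> and \<open>R2\<close> are the first two \<alpha>-derivatives, and
  \<open>snd\<close> says that T raises the index. The constant \<open>c\<close> is left open
  because the two families used later have the values 3 and 1. Evenness is what makes |v| as smooth
  a variable as needed at v = 0.\<close>

locale radial =
  fixes S :: "complex set" and c :: real and R R1 R2 :: "nat \<Rightarrow> complex \<Rightarrow> real"
  assumes S: "open S" "\<And>z. z \<in> S \<Longrightarrow> cnj z \<in> S"
    and even: "\<And>k z. z \<in> S \<Longrightarrow> R k (cnj z) = R k z"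
    and snd: "\<And>k a b. Complex a b \<in> S \<Longrightarrow>
      ((\<lambda>t. R k (Complex a t)) has_real_derivative b * R (k + 1) (Complex a b)) (at b)"
    and fst1: "\<And>k a b. Complex a b \<in> S \<Longrightarrow>
      ((\<lambda>t. R k (Complex t b)) has_real_derivative R1 k (Complex a b)) (at a)"
    and fst2: "\<And>k a b. Complex a b \<in> S \<Longrightarrow>
      ((\<lambda>t. R1 k (Complex t b)) has_real_derivative R2 k (Complex a b)) (at a)"
    and pde: "\<And>k a b. Complex a b \<in> S \<Longrightarrow>
      R2 k (Complex a b) = - (2 * real k + c) * R (k + 1) (Complex a b) - b\<^sup>2 * R (k + 2) (Complex a b)"
begin

text \<open>Off v = 0 the derivative of |v| has the denominator |v|, which cancels against the
  factor \<open>b\<close> in \<open>snd\<close>. At v = 0 the restriction to the line is a function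
  of |t|; by evenness |t| may be replaced by t.\<close>

lemma radial_snd:
  assumes "upper_point y \<in> S"
  shows "((\<lambda>t. R k (upper_point (y + t *\<^sub>R (0, e)))) has_real_derivative
    (e \<bullet> snd y) * R (k + 1) (upper_point y)) (at 0)"
proof (cases "snd y = 0")
  case False
  let ?n = "norm (snd y)"
  have "((\<lambda>t. norm (snd y + t *\<^sub>R e)) has_derivative (\<lambda>t. (t *\<^sub>R e) \<bullet> sgn (snd y + 0 *\<^sub>R e))) (at 0)"
  proof (rule has_derivative_compose[where g = norm, of "\<lambda>t. snd y + t *\<^sub>R e" "\<lambda>t. t *\<^sub>R e"])
    show "((\<lambda>t. snd y + t *\<^sub>R e) has_derivative (\<lambda>t. t *\<^sub>R e)) (at 0)"
      by (auto intro!: derivative_eq_intros)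
    show "(norm has_derivative (\<lambda>v. v \<bullet> sgn (snd y + 0 *\<^sub>R e))) (at (snd y + 0 *\<^sub>R e))"
      using has_derivative_norm[of "snd y + 0 *\<^sub>R e"] False by (simp add: inner_commute)
  qed
  then have n: "((\<lambda>t. norm (snd y + t *\<^sub>R e)) has_real_derivative (e \<bullet> snd y) / ?n) (at 0)"
    by (simp add: has_field_derivative_def sgn_div_norm mult.commute[of _ "_ / _"] divide_inverse mult_ac)
      (simp add: mult_commute_abs)
  have "((\<lambda>t. R k (Complex (fst y) (norm (snd y + t *\<^sub>R e)))) has_real_derivative
      ?n * R (k + 1) (upper_point y) * ((e \<bullet> snd y) / ?n)) (at 0)"
    using assms snd[of "fst y" ?n k]
    by (intro DERIV_chain2[where f = "\<lambda>t. R k (Complex (fst y) t)", OF _ n]) (simp add: upper_point_def)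
  then show ?thesis using False by (simp add: upper_point_def mult.commute)
next
  case True
  have y: "Complex (fst y) 0 \<in> S" "upper_point y = Complex (fst y) 0"
    using assms True by (auto simp: upper_point_def)
  have "((\<lambda>t. R k (Complex (fst y) (t * norm e))) has_real_derivative 0 * R (k + 1) (Complex (fst y) 0) * norm e) (at 0)"
    by (rule DERIV_chain2[where f = "\<lambda>t. R k (Complex (fst y) t)"])
      (use snd[OF y(1), of k] in \<open>auto intro!: derivative_eq_intros\<close>)
  moreover have "\<forall>\<^sub>F t in nhds 0. R k (upper_point (y + t *\<^sub>R (0, e))) = R k (Complex (fst y) (t * norm e))"
    using eventually_along[OF S(1) y(1), of "Complex 0 (norm e)"]
  proof eventually_elim
    case (elim t)
    moreover have "Complex (fst y) 0 + t *\<^sub>R Complex 0 (norm e) = Complex (fst y) (t * norm e)"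
      by (simp add: complex_eq_iff)
    ultimately have in_S: "Complex (fst y) (t * norm e) \<in> S" by simp
    have "upper_point (y + t *\<^sub>R (0, e)) = Complex (fst y) (\<bar>t\<bar> * norm e)"
      using True by (simp add: upper_point_def)
    moreover have "Complex (fst y) (\<bar>t\<bar> * norm e) = Complex (fst y) (t * norm e) \<or>
       Complex (fst y) (\<bar>t\<bar> * norm e) = cnj (Complex (fst y) (t * norm e))"
      by (auto simp: complex_eq_iff)
    ultimately show ?case using even[OF in_S, of k] by auto
  qed
  ultimately show ?thesis using True by (subst DERIV_cong_ev) auto
qed

lemma radial_fst:
  assumes "upper_point y \<in> S"
  shows "((\<lambda>t. R k (upper_point (y + t *\<^sub>R (1, 0)))) has_real_derivative R1 k (upper_point y)) (at 0)"
    "((\<lambda>t. R1 k (upper_point (y + t *\<^sub>R (1, 0)))) has_real_derivative R2 k (upper_point y)) (at 0)"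
  using fst1[of "fst y" "norm (snd y)" k] fst2[of "fst y" "norm (snd y)" k] assms
    DERIV_shift[of "\<lambda>t. R k (Complex t (norm (snd y)))" _ 0 "fst y"]
    DERIV_shift[of "\<lambda>t. R1 k (Complex t (norm (snd y)))" _ 0 "fst y"]
  by (auto simp: upper_point_def add.commute)

lemma pde_upper_point:
  assumes "upper_point y \<in> S"
  shows "R2 k (upper_point y) = - (2 * real k + c) * R (k + 1) (upper_point y)
    - (norm (snd y))\<^sup>2 * R (k + 2) (upper_point y)"
  using pde[of "fst y" "norm (snd y)" k] assms by (simp add: upper_point_def)

lemma norm_sum_axis:
  fixes v :: "real ^ 'm"
  shows "(\<Sum>i\<in>UNIV. (axis i 1 \<bullet> v)\<^sup>2) = (norm v)\<^sup>2"
  by (simp add: inner_axis' norm_vec_def L2_set_def sum_nonneg)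

text \<open>The m directions of v contribute m \<open>R (k + 1)\<close> + |v|^2
  \<open>R (k + 2)\<close>, and \<open>pde\<close> for the real direction cancels the last
  term.\<close>

lemma laplacian_radial:
  "has_laplacian {y :: 'm::finite paravector. upper_point y \<in> S} (\<lambda>y. R k (upper_point y))
    (\<lambda>y. (real CARD('m) - 2 * real k - c) * R (k + 1) (upper_point y))"
  unfolding has_laplacian_def
proof (intro exI ballI conjI)
  let ?g1 = "\<lambda>b y. fst b * R1 k (upper_point y) + (snd b \<bullet> snd y) * R (k + 1) (upper_point y)"
  let ?g2 = "\<lambda>b y. fst b * R2 k (upper_point y) + (snd b \<bullet> snd b) * R (k + 1) (upper_point y)
    + (snd b \<bullet> snd y)\<^sup>2 * R (k + 2) (upper_point y)"
  fix y :: "'m paravector" assume y: "y \<in> {y. upper_point y \<in> S}"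
  {
    fix b :: "'m paravector" assume "b \<in> Basis"
    then consider "b = (1, 0)" | i where "b = (0, axis i 1)" by (auto simp: Basis_paravector)
    then show "((\<lambda>t. R k (upper_point (y + t *\<^sub>R b))) has_vector_derivative ?g1 b y) (at 0)"
      unfolding has_real_derivative_iff_has_vector_derivative[symmetric]
      by cases (use radial_fst(1)[of y k] radial_snd[of y k] y in auto)
    from \<open>b \<in> Basis\<close> consider "b = (1, 0)" | i where "b = (0, axis i 1)" by (auto simp: Basis_paravector)
    then show "((\<lambda>t. ?g1 b (y + t *\<^sub>R b)) has_vector_derivative ?g2 b y) (at 0)"
      unfolding has_real_derivative_iff_has_vector_derivative[symmetric]
    proof cases
      case 1
      then show "((\<lambda>t. ?g1 b (y + t *\<^sub>R b)) has_real_derivative ?g2 b y) (at 0)"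
        using radial_fst(2)[of y k] y by auto
    next
      case (2 i)
      let ?e = "axis i 1 :: real ^ 'm"
      have "((\<lambda>t. (?e \<bullet> snd y + t) * R (k + 1) (upper_point (y + t *\<^sub>R (0, ?e)))) has_real_derivative
         1 * R (k + 1) (upper_point (y + 0 *\<^sub>R (0, ?e))) + ((?e \<bullet> snd y) * R (k + 1 + 1) (upper_point y)) * (?e \<bullet> snd y + 0)) (at 0)"
        using y by (intro DERIV_mult' DERIV_mult radial_snd) (auto intro!: derivative_eq_intros)
      then show "((\<lambda>t. ?g1 b (y + t *\<^sub>R b)) has_real_derivative ?g2 b y) (at 0)"
        by (simp add: 2 inner_axis' power2_eq_square mult_ac flip: zero_prod_def)
    qed
  }
  show "(real CARD('m) - 2 * real k - c) * R (k + 1) (upper_point y) = (\<Sum>b\<in>Basis. ?g2 b y)"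
    using y by (simp add: sum_Basis_paravector sum.distrib pde_upper_point norm_sum_axis flip: sum_distrib_right)
      (simp add: algebra_simps inner_axis')
qed

text \<open>Compared with the previous lemma there is one cross term, twice the product of the
  derivatives of the two factors; it is the source of the summand 2.\<close>

lemma laplacian_radial_coord:
  "has_laplacian {y :: 'm::finite paravector. upper_point y \<in> S} (\<lambda>y. snd y $ j * R k (upper_point y))
    (\<lambda>y. (real CARD('m) + 2 - 2 * real k - c) * (snd y $ j * R (k + 1) (upper_point y)))"
  unfolding has_laplacian_def
proof (intro exI ballI conjI)
  let ?g1 = "\<lambda>b y. fst b * (snd y $ j * R1 k (upper_point y)) + snd b $ j * R k (upper_point y) +
    snd y $ j * ((snd b \<bullet> snd y) * R (k + 1) (upper_point y))"
  let ?g2 = "\<lambda>b y. fst b * (snd y $ j * R2 k (upper_point y)) +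
    2 * (snd b $ j * (snd b \<bullet> snd y)) * R (k + 1) (upper_point y) +
    snd y $ j * ((snd b \<bullet> snd b) * R (k + 1) (upper_point y) + (snd b \<bullet> snd y)\<^sup>2 * R (k + 2) (upper_point y))"
  fix y :: "'m paravector" assume y: "y \<in> {y. upper_point y \<in> S}"
  {
    fix b :: "'m paravector" assume "b \<in> Basis"
    then consider "b = (1, 0)" | i where "b = (0, axis i 1)" by (auto simp: Basis_paravector)
    then show "((\<lambda>t. snd (y + t *\<^sub>R b) $ j * R k (upper_point (y + t *\<^sub>R b))) has_vector_derivative ?g1 b y) (at 0)"
      unfolding has_real_derivative_iff_has_vector_derivative[symmetric]
    proof cases
      case 1
      then show "((\<lambda>t. snd (y + t *\<^sub>R b) $ j * R k (upper_point (y + t *\<^sub>R b))) has_real_derivative ?g1 b y) (at 0)"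
        using DERIV_cmult[OF radial_fst(1)[of y k], of "snd y $ j"] y by auto
    next
      case (2 i)
      let ?e = "axis i 1 :: real ^ 'm"
      have "((\<lambda>t. (snd y $ j + t * ?e $ j) * R k (upper_point (y + t *\<^sub>R (0, ?e)))) has_real_derivative
         ?e $ j * R k (upper_point (y + 0 *\<^sub>R (0, ?e))) + ((?e \<bullet> snd y) * R (k + 1) (upper_point y)) * (snd y $ j + 0 * ?e $ j)) (at 0)"
        using y by (intro DERIV_mult radial_snd) (auto intro!: derivative_eq_intros)
      then show "((\<lambda>t. snd (y + t *\<^sub>R b) $ j * R k (upper_point (y + t *\<^sub>R b))) has_real_derivative ?g1 b y) (at 0)"
        by (simp add: 2 mult_ac flip: zero_prod_def)
    qed
    from \<open>b \<in> Basis\<close> consider "b = (1, 0)" | i where "b = (0, axis i 1)" by (auto simp: Basis_paravector)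
    then show "((\<lambda>t. ?g1 b (y + t *\<^sub>R b)) has_vector_derivative ?g2 b y) (at 0)"
      unfolding has_real_derivative_iff_has_vector_derivative[symmetric]
    proof cases
      case 1
      then show "((\<lambda>t. ?g1 b (y + t *\<^sub>R b)) has_real_derivative ?g2 b y) (at 0)"
        using DERIV_cmult[OF radial_fst(2)[of y k], of "snd y $ j"] y by auto
    next
      case (2 i)
      let ?e = "axis i 1 :: real ^ 'm"
      have p: "((\<lambda>t. snd y $ j + t * ?e $ j) has_real_derivative ?e $ j) (at 0)"
        "((\<lambda>t. ?e \<bullet> snd y + t) has_real_derivative 1) (at 0)"
        by (auto intro!: derivative_eq_intros)
      have "((\<lambda>t. ?e $ j * R k (upper_point (y + t *\<^sub>R (0, ?e))) +
          (snd y $ j + t * ?e $ j) * ((?e \<bullet> snd y + t) * R (k + 1) (upper_point (y + t *\<^sub>R (0, ?e))))) has_real_derivative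
         ?e $ j * ((?e \<bullet> snd y) * R (k + 1) (upper_point y)) +
          (?e $ j * ((?e \<bullet> snd y + 0) * R (k + 1) (upper_point (y + 0 *\<^sub>R (0, ?e)))) +
           (1 * R (k + 1) (upper_point (y + 0 *\<^sub>R (0, ?e))) + ((?e \<bullet> snd y) * R (k + 1 + 1) (upper_point y)) * (?e \<bullet> snd y + 0)) *
            (snd y $ j + 0 * ?e $ j))) (at 0)"
        using y by (intro DERIV_add DERIV_cmult DERIV_mult p radial_snd) auto
      then show "((\<lambda>t. ?g1 b (y + t *\<^sub>R b)) has_real_derivative ?g2 b y) (at 0)"
        by (simp add: 2 inner_axis' algebra_simps power2_eq_square flip: zero_prod_def)
    qed
  }
  have "(\<Sum>i\<in>UNIV. (axis i 1 :: real ^ 'm) $ j * (axis i 1 \<bullet> snd y)) = (\<Sum>i\<in>UNIV. if i = j then snd y $ i else 0)"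
    by (rule sum.cong, simp, simp only: inner_axis', simp add: axis_def)
  then have s: "(\<Sum>i\<in>UNIV. (axis i 1 :: real ^ 'm) $ j * (axis i 1 \<bullet> snd y)) = snd y $ j" by simp
  have "(\<Sum>b\<in>Basis. ?g2 b y) = snd y $ j * R2 k (upper_point y) +
      2 * (\<Sum>i\<in>UNIV. (axis i 1 :: real ^ 'm) $ j * (axis i 1 \<bullet> snd y)) * R (k + 1) (upper_point y) +
      snd y $ j * (real CARD('m) * R (k + 1) (upper_point y) +
        (\<Sum>i\<in>UNIV. (axis i 1 \<bullet> snd y)\<^sup>2) * R (k + 2) (upper_point y))"
    by (simp add: sum_Basis_paravector sum.distrib sum_distrib_left sum_distrib_right inner_axis' algebra_simps)
  also have "\<dots> = (real CARD('m) + 2 - 2 * real k - c) * (snd y $ j * R (k + 1) (upper_point y))"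
    unfolding s norm_sum_axis using y by (simp add: pde_upper_point algebra_simps)
  finally show "(real CARD('m) + 2 - 2 * real k - c) * (snd y $ j * R (k + 1) (upper_point y)) = (\<Sum>b\<in>Basis. ?g2 b y)"
    by simp
qed

end

section \<open>The two radial families of a holomorphic function\<close>

lemma im_deriv_cnj:
  assumes "conj_holomorphic S H" "z \<in> S"
  shows "im_deriv i H (cnj z) = (- 1) ^ (i + 1) * im_deriv i H z"
proof -
  define W where "W = \<i> ^ i * (deriv ^^ i) H z"
  have "\<i> ^ i * (deriv ^^ i) H (cnj z) = cnj ((- \<i>) ^ i * (deriv ^^ i) H z)"
    using conj_holomorphic_higher_deriv[OF assms(1), of i] assms(2)
    by (simp add: conj_holomorphic_def)
  also have "(- \<i>) ^ i = of_real ((- 1) ^ i) * \<i> ^ i"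
    by (metis of_real_minus of_real_1 of_real_power power_minus)
  finally have "\<i> ^ i * (deriv ^^ i) H (cnj z) = of_real ((- 1) ^ i) * cnj W"
    by (simp add: W_def mult.assoc)
  then have "im_deriv i H (cnj z) = Im (of_real ((- 1) ^ i) * cnj W)" by (simp only: im_deriv_def)
  then show ?thesis unfolding im_deriv_def W_def[symmetric] by simp
qed

lemma sph_cnj:
  assumes "conj_holomorphic S H" "z \<in> S"
  shows "sph k H (cnj z) = sph k H z"
proof (cases "Im z = 0")
  case True
  then have "cnj z = z" by (simp add: complex_eq_iff)
  then show ?thesis by simp
next
  case False
  then show ?thesis
    by (auto simp: sph_def lap_sum_def im_deriv_cnj[OF assms] power_int_minus_left power_minus' intro!: sum.cong)
qed

text \<open>The family of the derivative of \<open>H\<close> with one entry prepended: by the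
  Cauchy-Riemann equations T sends \<open>- Re H\<close> to \<beta>^(-1) times the imaginary part of
  H', which is \<open>sph 0 (deriv H)\<close>.\<close>

definition sph_re :: "nat \<Rightarrow> (complex \<Rightarrow> complex) \<Rightarrow> complex \<Rightarrow> real" where
  "sph_re k H z = (case k of 0 \<Rightarrow> - Re (H z) | Suc k \<Rightarrow> sph k (deriv H) z)"

lemma radial_sph:
  assumes "conj_holomorphic S H"
  shows "radial S 3 (\<lambda>k. sph k H) (\<lambda>k. sph k (deriv H)) (\<lambda>k. sph k (deriv (deriv H)))"
proof
  show "open S" using assms by (simp add: conj_holomorphic_def)
  show "cnj z \<in> S" if "z \<in> S" for z using assms that by (simp add: conj_holomorphic_def)
qed (use sph_cnj[OF assms] sph_snd[OF assms] sph_fst[OF assms] sph_pde[OF assms]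
    sph_fst[OF conj_holomorphic_deriv[OF assms]] in auto)

lemma Re_deriv_fst:
  assumes "conj_holomorphic S H" "Complex a b \<in> S"
  shows "((\<lambda>t. Re (H (Complex t b))) has_real_derivative Re (deriv H (Complex a b))) (at a)"
  using Im_deriv_fst[of H "deriv H (Complex a b)" a b \<i>] conj_holomorphic_DERIV[OF assms, of 0] by simp

lemma radial_sph_re:
  assumes "conj_holomorphic S H"
  shows "radial S 1 (\<lambda>k. sph_re k H) (\<lambda>k. sph_re k (deriv H)) (\<lambda>k. sph_re k (deriv (deriv H)))"
proof
  show "open S" using assms by (simp add: conj_holomorphic_def)
  show "cnj z \<in> S" if "z \<in> S" for z using assms that by (simp add: conj_holomorphic_def)
  note H1 = conj_holomorphic_deriv[OF assms]
  note H2 = conj_holomorphic_deriv[OF H1]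
  show "sph_re k H (cnj z) = sph_re k H z" if "z \<in> S" for k z
    using assms that by (cases k) (auto simp: sph_re_def sph_cnj[OF H1] conj_holomorphic_def)
  fix k a b assume S: "Complex a b \<in> S"
  show "((\<lambda>t. sph_re k H (Complex a t)) has_real_derivative b * sph_re (k + 1) H (Complex a b)) (at b)"
  proof (cases k)
    case 0
    have "((\<lambda>t. - Re (H (Complex a t))) has_real_derivative Im (deriv H (Complex a b))) (at b)"
      using Im_deriv_snd[of H "deriv H (Complex a b)" a b "- \<i>"] conj_holomorphic_DERIV[OF assms S, of 0] by simp
    then show ?thesis using sph_0[OF S H1] 0 by (simp add: sph_re_def)
  qed (simp add: sph_re_def sph_snd[OF H1 S])
  show "((\<lambda>t. sph_re k H (Complex t b)) has_real_derivative sph_re k (deriv H) (Complex a b)) (at a)"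
    using DERIV_minus[OF Re_deriv_fst[OF assms S]] sph_fst[OF H1 S]
    by (cases k) (auto simp: sph_re_def)
  show "((\<lambda>t. sph_re k (deriv H) (Complex t b)) has_real_derivative sph_re k (deriv (deriv H)) (Complex a b)) (at a)"
    using DERIV_minus[OF Re_deriv_fst[OF H1 S]] sph_fst[OF H2 S]
    by (cases k) (auto simp: sph_re_def)
  show "sph_re k (deriv (deriv H)) (Complex a b) =
    - (2 * real k + 1) * sph_re (k + 1) H (Complex a b) - b\<^sup>2 * sph_re (k + 2) H (Complex a b)"
  \<comment> \<open>Only the prepended entry needs a computation; for the others this is
    \<open>sph_pde\<close> for the derivative, with the index lowered by one.\<close>
  proof (cases k)
    case 0
    show ?thesis
    proof (cases "b = 0")
      case True
      then show ?thesis using 0 by (simp add: sph_re_def sph_def axis_coeff_def)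
    next
      case False
      have "sph (Suc 0) (deriv H) (Complex a b) = - Im (deriv H (Complex a b)) / b ^ 3 + Re (deriv (deriv H) (Complex a b)) / b\<^sup>2"
        using False by (simp add: sph_def lap_sum_def lap_coeff_def im_deriv_def power_int_minus field_simps power_int_def)
      moreover have "b * sph 0 (deriv H) (Complex a b) = Im (deriv H (Complex a b))"
        using sph_0[OF S H1] by simp
      ultimately have "b * (- Re (deriv (deriv H) (Complex a b))) =
          b * (- sph 0 (deriv H) (Complex a b) - b\<^sup>2 * sph (Suc 0) (deriv H) (Complex a b))"
        using False by (simp add: field_simps power2_eq_square power3_eq_cube)
      with False have "- Re (deriv (deriv H) (Complex a b)) =
          - sph 0 (deriv H) (Complex a b) - b\<^sup>2 * sph (Suc 0) (deriv H) (Complex a b)"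
        by (simp only: mult_cancel_left simp_thms)
      then show ?thesis using 0 by (simp add: sph_re_def numeral_2_eq_2)
    qed
  next
    case (Suc j)
    then show ?thesis using sph_pde[OF H1 S, of j] by (simp add: sph_re_def algebra_simps)
  qed
qed

subsection \<open>The products \<open>[J\<^sub>K, a]\<close>\<close>

definition vec_upd :: "'n::finite \<Rightarrow> 'a \<Rightarrow> 'a ^ 'n \<Rightarrow> 'a ^ 'n" where
  "vec_upd h y x = (\<chi> l. if l = h then y else x $ l)"

lemma vec_upd_nth [simp]: "vec_upd h y x $ l = (if l = h then y else x $ l)"
  by (simp add: vec_upd_def)

lemma vec_upd_twice [simp]: "vec_upd h y (vec_upd h y' x) = vec_upd h y x"
  by (simp add: vec_eq_iff)

lemma vec_upd_triv [simp]: "vec_upd h (x $ h) x = x"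
  by (simp add: vec_eq_iff)

interpretation cl_mult: bounded_bilinear cl_mult
  using bilinear_cl_mult bilinear_conv_bounded_bilinear by blast

lemma bounded_linear_paravec: "bounded_linear paravec"
  unfolding paravec_def
  by (intro bounded_linear_add bounded_linear_sum bounded_linear_scaleR_const bounded_linear_fst
      bounded_linear_compose[OF bounded_linear_vec_nth bounded_linear_snd])

lemma bounded_linear_imag_prod: "bounded_linear (imag_prod J K)"
proof -
  have "bounded_linear (\<lambda>a. foldr (\<lambda>k b. paravec (J $ k) \<cdot>\<^sub>c b) xs a)" for xs
    by (induction xs) (auto intro: bounded_linear_ident bounded_linear_compose[OF cl_mult.bounded_linear_right])
  then show ?thesis by (simp add: imag_prod_def[abs_def])
qed

lemma imag_prod_cong:
  assumes "\<And>k. k \<in> K \<Longrightarrow> J $ k = J' $ k"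
  shows "imag_prod J K a = imag_prod J' K a"
  unfolding imag_prod_def using assms by (intro foldr_cong) auto

text \<open>The index h occurs once in the sorted list, so the product is a linear map of
  \<open>paravec p\<close> times a fixed factor. Linearity allows absorbing \<beta> into the factor
  at h, replacing the unit by the vector part of the paravector, which is smooth also at \<beta> =
  0.\<close>

lemma bounded_linear_imag_prod_upd:
  assumes "h \<in> K"
  shows "bounded_linear (\<lambda>p. imag_prod (vec_upd h p J) K a)"
proof -
  have d: "distinct (sorted_list_of_set K)" "h \<in> set (sorted_list_of_set K)" using assms by auto
  then obtain ys zs where *: "sorted_list_of_set K = ys @ h # zs" "h \<notin> set ys" "h \<notin> set zs"
    by (metis distinct.simps(2) distinct_append split_list not_distinct_conv_prefix in_set_conv_decomp_first)
  define b where "b = foldr (\<lambda>k b. paravec (J $ k) \<cdot>\<^sub>c b) zs a"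
  define T where "T = foldr (\<lambda>k b. paravec (J $ k) \<cdot>\<^sub>c b) ys"
  have "bounded_linear (\<lambda>a. foldr (\<lambda>k b. paravec (J $ k) \<cdot>\<^sub>c b) xs a)" for xs
    by (induction xs) (auto intro: bounded_linear_ident bounded_linear_compose[OF cl_mult.bounded_linear_right])
  then have T: "bounded_linear T" by (simp add: T_def)
  have "imag_prod (vec_upd h p J) K a = T (paravec p \<cdot>\<^sub>c b)" for p
  proof -
    have "foldr (\<lambda>k b. paravec (vec_upd h p J $ k) \<cdot>\<^sub>c b) xs c = foldr (\<lambda>k b. paravec (J $ k) \<cdot>\<^sub>c b) xs c"
      if "h \<notin> set xs" for xs c
      using that by (intro foldr_cong) auto
    then show ?thesis using * by (simp add: imag_prod_def b_def T_def)
  qed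
  then show ?thesis
    using bounded_linear_compose[OF T bounded_linear_compose[OF cl_mult.bounded_linear_left bounded_linear_paravec]]
    by simp
qed

lemma imag_prod_neg:
  assumes "\<And>k. k \<in> K \<Longrightarrow> J' $ k = (if k \<in> N then - J $ k else J $ k)"
  shows "imag_prod J' K a = (- 1) ^ card (K \<inter> N) *\<^sub>R imag_prod J K a"
proof -
  have *: "foldr (\<lambda>k b. paravec (J' $ k) \<cdot>\<^sub>c b) xs a =
      (- 1) ^ card (set xs \<inter> N) *\<^sub>R foldr (\<lambda>k b. paravec (J $ k) \<cdot>\<^sub>c b) xs a"
    if "distinct xs" "set xs \<subseteq> K" for xs
    using that
  proof (induction xs)
    case (Cons k xs)
    have "insert k (set xs) \<inter> N = (if k \<in> N then insert k (set xs \<inter> N) else set xs \<inter> N)" by auto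
    with Cons show ?case
      by (simp add: assms linear_neg[OF bounded_linear.linear[OF bounded_linear_paravec]] cl_mult.minus_left cl_mult.scaleR_right)
  qed simp
  show ?thesis using *[of "sorted_list_of_set K"] by (simp add: imag_prod_def)
qed

text \<open>Adding the double sum for the square to its transpose makes the mixed terms cancel by
  anticommutation.\<close>

lemma paravec_unit_imag_square:
  fixes p :: "'m::{finite,linorder} paravector"
  assumes "p \<in> unit_imag"
  shows "paravec p \<cdot>\<^sub>c paravec p = - cl_one"
proof -
  let ?v = "snd p" and ?e = "cl_gen :: 'm \<Rightarrow> _"
  have p: "paravec p = (\<Sum>i\<in>UNIV. ?v $ i *\<^sub>R ?e i)" "(\<Sum>i\<in>UNIV. (?v $ i)\<^sup>2) = 1"
    using assms by (auto simp: paravec_def unit_imag_def)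
  have 1: "paravec p \<cdot>\<^sub>c paravec p = (\<Sum>i\<in>UNIV. \<Sum>j\<in>UNIV. (?v $ i * ?v $ j) *\<^sub>R (?e i \<cdot>\<^sub>c ?e j))"
    unfolding p(1) cl_mult.sum_left cl_mult.sum_right
    by (subst sum.swap) (simp add: cl_mult.scaleR_left cl_mult.scaleR_right mult.commute)
  also have 2: "\<dots> = (\<Sum>i\<in>UNIV. \<Sum>j\<in>UNIV. (?v $ i * ?v $ j) *\<^sub>R (?e j \<cdot>\<^sub>c ?e i))"
    by (subst sum.swap) (simp add: mult.commute)
  finally have "paravec p \<cdot>\<^sub>c paravec p + paravec p \<cdot>\<^sub>c paravec p =
     (\<Sum>i\<in>UNIV. \<Sum>j\<in>UNIV. (?v $ i * ?v $ j) *\<^sub>R (?e i \<cdot>\<^sub>c ?e j + ?e j \<cdot>\<^sub>c ?e i))"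
    using 1 by (simp add: sum.distrib scaleR_add_right)
  also have "\<dots> = (\<Sum>i\<in>UNIV. \<Sum>j\<in>UNIV. if j = i then (?v $ i * ?v $ j) *\<^sub>R (- (2 *\<^sub>R cl_one)) else 0)"
    by (intro sum.cong refl) (auto simp: cl_gen_anticommute cl_gen_square scaleR_2)
  also have "\<dots> = (\<Sum>i\<in>UNIV. (?v $ i)\<^sup>2) *\<^sub>R (- (2 *\<^sub>R cl_one))"
    by (simp add: power2_eq_square scaleR_sum_left sum_negf sum_distrib_right)
  finally have "2 *\<^sub>R (paravec p \<cdot>\<^sub>c paravec p) = 2 *\<^sub>R (- cl_one)"
    using p(2) by (simp add: scaleR_2)
  then show ?thesis by (metis scaleR_left_imp_eq zero_neq_numeral)
qed

text \<open>Left multiplication by a unit with square -1 is injective, so the factors can be removed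
  one at a time.\<close>

lemma imag_prod_eq_0:
  assumes "\<And>k. k \<in> K \<Longrightarrow> J $ k \<in> unit_imag" "imag_prod J K a = 0"
  shows "a = 0"
proof -
  have *: "a = 0" if "set xs \<subseteq> K" "foldr (\<lambda>k b. paravec (J $ k) \<cdot>\<^sub>c b) xs a = 0" for xs
    using that
  proof (induction xs)
    case (Cons k xs)
    let ?b = "foldr (\<lambda>k b. paravec (J $ k) \<cdot>\<^sub>c b) xs a"
    have "paravec (J $ k) \<cdot>\<^sub>c (paravec (J $ k) \<cdot>\<^sub>c ?b) = 0" using Cons by (simp add: cl_mult.zero_right)
    then have "- ?b = 0"
      using paravec_unit_imag_square[OF assms(1)[of k]] Cons.prems(1)
      by (simp add: cl_mult_assoc[symmetric] cl_mult.minus_left cl_one_left)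
    then show ?case using Cons by simp
  qed simp
  show ?thesis using *[of "sorted_list_of_set K"] assms(2) by (simp add: imag_prod_def)
qed

subsection \<open>Slice functions and their stem functions\<close>

lemma unit_imag_iff: "p \<in> unit_imag \<longleftrightarrow> fst p = 0 \<and> norm (snd p) = 1"
  by (auto simp: unit_imag_def norm_vec_def L2_set_def)

lemma slice_point_nth: "slice_point z J $ l = (Re (z $ l), 0) + Im (z $ l) *\<^sub>R (J $ l)"
  by (simp add: slice_point_def)

lemma stem_on_conj_set:
  assumes "symmetric_set D" "stem_on D G" "z \<in> D"
  shows "(\<chi> l. if l \<in> N then cnj (z $ l) else z $ l) \<in> D \<and>
    G (\<chi> l. if l \<in> N then cnj (z $ l) else z $ l) $ K = (- 1) ^ card (K \<inter> N) *\<^sub>R (G z $ K)"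
proof -
  have "finite N" by simp
  then show ?thesis
  proof (induction N rule: finite_induct)
    case empty
    then show ?case using assms(3) by simp
  next
    case (insert h N)
    let ?z = "\<chi> l. if l \<in> N then cnj (z $ l) else z $ l"
    have "(\<chi> l. if l \<in> insert h N then cnj (z $ l) else z $ l) = conj_at h ?z"
      using insert by (auto simp: vec_eq_iff conj_at_def)
    moreover have "K \<inter> insert h N = (if h \<in> K then insert h (K \<inter> N) else K \<inter> N)" by auto
    ultimately show ?case using insert assms(1,2)
      by (auto simp: symmetric_set_def stem_on_def)
  qed
qed

text \<open>Let \<open>N\<close> be the indices where two representations of the point have
  different \<beta>. If no \<beta> with index in \<open>K\<close> is zero, the units are negated
  exactly on \<open>N\<close>, and the resulting sign equals the one from the stem condition. If
  some \<beta> with index in \<open>K\<close> is zero, its unit is undetermined, but then the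
  component at \<open>K\<close> vanishes.\<close>

lemma induced_slice_point:
  fixes G :: "'n::{finite,linorder} cvec \<Rightarrow> ('m::{finite,linorder}, 'n) stem_value"
  assumes "symmetric_set D" "stem_on D G" "z \<in> D" "\<And>l. J $ l \<in> unit_imag"
  shows "induced D G (slice_point z J) = (\<Sum>K\<in>UNIV. imag_prod J K (G z $ K))"
  unfolding induced_def
proof (rule the_equality)
  show "\<exists>z'\<in>D. \<exists>J'. (\<forall>l. J' $ l \<in> unit_imag) \<and> slice_point z J = slice_point z' J' \<and>
     (\<Sum>K\<in>UNIV. imag_prod J K (G z $ K)) = (\<Sum>K\<in>UNIV. imag_prod J' K (G z' $ K))"
    using assms by blast
next
  fix y
  assume "\<exists>z'\<in>D. \<exists>J'. (\<forall>l. J' $ l \<in> unit_imag) \<and> slice_point z J = slice_point z' J' \<and>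
     y = (\<Sum>K\<in>UNIV. imag_prod J' K (G z' $ K))"
  then obtain z' J' where z': "z' \<in> D" "\<And>l. J' $ l \<in> unit_imag" "slice_point z J = slice_point z' J'"
    "y = (\<Sum>K\<in>UNIV. imag_prod J' K (G z' $ K))" by blast
  define N where "N = {l. Im (z' $ l) \<noteq> Im (z $ l)}"
  have eq: "Re (z $ l) = Re (z' $ l)" "Im (z $ l) *\<^sub>R snd (J $ l) = Im (z' $ l) *\<^sub>R snd (J' $ l)" for l
    using arg_cong[OF z'(3), of "\<lambda>x. x $ l"] z'(2)[of l] assms(4)[of l]
    by (auto simp: slice_point_nth prod_eq_iff unit_imag_iff)
  have abs: "\<bar>Im (z $ l)\<bar> = \<bar>Im (z' $ l)\<bar>" for l
    using arg_cong[OF eq(2)[of l], of norm] z'(2)[of l] assms(4)[of l] by (simp add: unit_imag_iff)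
  then have Im_N: "Im (z' $ l) = - Im (z $ l)" if "l \<in> N" for l
    using that by (metis (mono_tags, lifting) N_def abs_eq_iff mem_Collect_eq minus_minus)
  have z'_eq: "z' = (\<chi> l. if l \<in> N then cnj (z $ l) else z $ l)"
    using eq(1) Im_N by (auto simp: vec_eq_iff complex_eq_iff N_def)
  have "imag_prod J' K (G z' $ K) = imag_prod J K (G z $ K)" for K
  proof (cases "\<exists>l\<in>K. Im (z $ l) = 0")
    case True
    then obtain l where l: "l \<in> K" "Im (z $ l) = 0" by blast
    then have "conj_at l z = z" by (auto simp: conj_at_def vec_eq_iff complex_eq_iff)
    then have "G z $ K = - (G z $ K)" using assms(2,3) l unfolding stem_on_def by metis
    then have "G z $ K = 0" by (simp add: vec_eq_iff)
    moreover from this have "G z' $ K = 0"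
      using stem_on_conj_set[OF assms(1-3), of N K] by (simp add: z'_eq)
    ultimately show ?thesis
      by (simp add: linear_0[OF bounded_linear.linear[OF bounded_linear_imag_prod]])
  next
    case False
    have "J' $ k = (if k \<in> N then - J $ k else J $ k)" if "k \<in> K" for k
    proof -
      have nz: "Im (z $ k) \<noteq> 0" using False that by auto
      have "snd (J' $ k) = (if k \<in> N then - snd (J $ k) else snd (J $ k))"
      proof (cases "k \<in> N")
        case True
        then have "Im (z $ k) *\<^sub>R snd (J $ k) = Im (z $ k) *\<^sub>R (- snd (J' $ k))"
          using eq(2)[of k] Im_N by simp
        then have "snd (J $ k) = - snd (J' $ k)" using nz by (simp only: scaleR_cancel_left simp_thms)
        then show ?thesis using True by simp
      next
        case k: False
        then show ?thesis using eq(2)[of k] nz by (simp add: N_def)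
      qed
      then show ?thesis using z'(2)[of k] assms(4)[of k] by (auto simp: prod_eq_iff unit_imag_iff)
    qed
    then have "imag_prod J' K (G z' $ K) = (- 1) ^ card (K \<inter> N) *\<^sub>R imag_prod J K (G z' $ K)"
      by (rule imag_prod_neg)
    also have "\<dots> = (- 1) ^ card (K \<inter> N) *\<^sub>R imag_prod J K ((- 1) ^ card (K \<inter> N) *\<^sub>R (G z $ K))"
      using stem_on_conj_set[OF assms(1-3), of N K] by (simp add: z'_eq)
    also have "\<dots> = imag_prod J K (G z $ K)"
      by (simp add: linear_scale[OF bounded_linear.linear[OF bounded_linear_imag_prod]] flip: power_add mult_2)
    finally show ?thesis .
  qed
  then show "y = (\<Sum>K\<in>UNIV. imag_prod J K (G z $ K))" using z'(4) by simp
qed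

lemma induced_cong:
  assumes "\<And>z. z \<in> D \<Longrightarrow> G z = G' z"
  shows "induced D G = induced D G'"
proof
  fix x
  have "(\<exists>z\<in>D. \<exists>J. (\<forall>l. J $ l \<in> unit_imag) \<and> x = slice_point z J \<and> y = (\<Sum>K\<in>UNIV. imag_prod J K (G z $ K))) \<longleftrightarrow>
    (\<exists>z\<in>D. \<exists>J. (\<forall>l. J $ l \<in> unit_imag) \<and> x = slice_point z J \<and> y = (\<Sum>K\<in>UNIV. imag_prod J K (G' z $ K)))" for y
    using assms by (intro bex_cong) auto
  then show "induced D G x = induced D G' x" by (simp add: induced_def)
qed

text \<open>The idea is the orthogonality of the characters \<open>N \<mapsto> (-1)\<^bsup>|K \<inter> N|\<^esup>\<close> of the group of sign changes.\<close>

lemma sign_sum_eq_0: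
  fixes X :: "'n::finite set \<Rightarrow> 'v::real_vector"
  assumes "\<And>N. (\<Sum>K\<in>UNIV. (- 1) ^ card (K \<inter> N) *\<^sub>R X K) = 0"
  shows "X K0 = 0"
proof -
  let ?c = "\<lambda>K l. (if l \<in> K then - 1 else 1) :: real"
  have card: "(- 1) ^ card (K \<inter> N) = prod (?c K) N" for K N :: "'n set"
    by (simp add: prod.If_cases Int_commute)
  have orth: "(\<Sum>N\<in>UNIV. (- 1) ^ card (K0 \<inter> N) * (- 1) ^ card (K \<inter> N)) =
      (if K = K0 then 2 ^ CARD('n) else 0 :: real)" for K
  proof -
    have "(\<Sum>N\<in>UNIV. (- 1) ^ card (K0 \<inter> N) * (- 1) ^ card (K \<inter> N)) =
       (\<Sum>N\<in>Pow UNIV. prod (\<lambda>l. ?c K0 l * ?c K l) N * prod (\<lambda>l. 1) (UNIV - N))"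
      by (simp add: card prod.distrib)
    also have "\<dots> = (\<Prod>l\<in>UNIV. ?c K0 l * ?c K l + 1)"
      by (subst prod_add) auto
    also have "\<dots> = (if K = K0 then 2 ^ CARD('n) else 0)"
    proof (cases "K = K0")
      case True
      then have "(\<Prod>l\<in>UNIV. ?c K0 l * ?c K l + 1) = (\<Prod>l\<in>(UNIV :: 'n set). 2)" by (intro prod.cong) auto
      then show ?thesis using True by simp
    next
      case False
      then obtain l where "(l \<in> K) \<noteq> (l \<in> K0)" by blast
      then have "\<exists>l\<in>UNIV. ?c K0 l * ?c K l + 1 = 0" by (intro bexI[of _ l]) auto
      then show ?thesis using False by (simp only: prod_zero_iff finite_code if_False)
    qed
    finally show ?thesis .
  qed
  have "0 = (\<Sum>N\<in>UNIV. (- 1) ^ card (K0 \<inter> N) *\<^sub>R (\<Sum>K\<in>UNIV. (- 1) ^ card (K \<inter> N) *\<^sub>R X K))"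
    by (simp add: assms)
  also have "\<dots> = (\<Sum>K\<in>UNIV. (\<Sum>N\<in>UNIV. (- 1) ^ card (K0 \<inter> N) * (- 1) ^ card (K \<inter> N)) *\<^sub>R X K)"
    unfolding scaleR_sum_right scaleR_sum_left by (subst sum.swap) simp
  also have "\<dots> = (\<Sum>K\<in>UNIV. if K = K0 then 2 ^ CARD('n) *\<^sub>R X K else 0)"
    unfolding orth by (intro sum.cong) auto
  finally show ?thesis by simp
qed

text \<open>The sign changes of a single tuple of units already separate the components.\<close>

lemma imag_prod_sum_eq_0:
  fixes a :: "('m::{finite,linorder}, 'n::{finite,linorder}) stem_value"
  assumes "\<And>J. (\<And>l. J $ l \<in> unit_imag) \<Longrightarrow> (\<Sum>K\<in>UNIV. imag_prod J K (a $ K)) = 0"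
  shows "a = 0"
proof -
  \<comment> \<open>Any tuple of units serves; an index for the basis vector exists because types
    are nonempty.\<close>
  define J :: "('m, 'n) pvec" where "J = (\<chi> l. (0, axis undefined 1))"
  have J: "J $ l \<in> unit_imag" for l by (simp add: J_def unit_imag_iff)
  have "(\<Sum>K\<in>UNIV. (- 1) ^ card (K \<inter> N) *\<^sub>R imag_prod J K (a $ K)) = 0" for N
  proof -
    define J' where "J' = (\<chi> l. if l \<in> N then - J $ l else J $ l)"
    have "J' $ l \<in> unit_imag" for l using J[of l] by (auto simp: J'_def unit_imag_iff)
    then have "(\<Sum>K\<in>UNIV. imag_prod J' K (a $ K)) = 0" by (rule assms)
    then show ?thesis by (subst (asm) imag_prod_neg[where N = N and J = J]) (auto simp: J'_def)
  qed
  then have "imag_prod J K (a $ K) = 0" for K by (rule sign_sum_eq_0)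
  then have "a $ K = 0" for K using J imag_prod_eq_0 by blast
  then show ?thesis by (simp add: vec_eq_iff)
qed

lemma induced_eq_iff:
  fixes G G' :: "'n::{finite,linorder} cvec \<Rightarrow> ('m::{finite,linorder}, 'n) stem_value"
  assumes "symmetric_set D" "stem_on D G" "stem_on D G'"
    and "\<And>x. x \<in> circularization D \<Longrightarrow> induced D G x = induced D G' x" and "z \<in> D"
  shows "G z = G' z"
proof -
  have "G z - G' z = 0"
  proof (rule imag_prod_sum_eq_0)
    fix J :: "('m, 'n) pvec" assume J: "\<And>l. J $ l \<in> unit_imag"
    then have "slice_point z J \<in> circularization D" using assms(5) by (auto simp: circularization_def)
    from assms(4)[OF this] show "(\<Sum>K\<in>UNIV. imag_prod J K ((G z - G' z) $ K)) = 0"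
      using J assms
      by (simp add: induced_slice_point linear_diff[OF bounded_linear.linear[OF bounded_linear_imag_prod]] sum_subtractf)
  qed
  then show ?thesis by simp
qed

lemma stem_of_eq:
  assumes "symmetric_set D" "stem_on D G" "\<And>x. x \<in> circularization D \<Longrightarrow> g x = induced D G x" "z \<in> D"
  shows "stem_of D g z = G z"
proof -
  have "stem_on D (stem_of D g) \<and> (\<forall>x\<in>circularization D. g x = induced D (stem_of D g) x)"
    unfolding stem_of_def by (rule someI[of _ G]) (use assms in auto)
  then show ?thesis using assms by (intro induced_eq_iff[of D]) auto
qed

subsection \<open>Derivatives of slice functions\<close>

lemma dir_deriv_cong:
  assumes "open U" "x \<in> U" "\<And>y. y \<in> U \<Longrightarrow> f y = g y"
  shows "dir_deriv v f x = dir_deriv v g x"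
proof -
  have "\<forall>\<^sub>F t in nhds 0. f (x + t *\<^sub>R v) = g (x + t *\<^sub>R v)"
    using eventually_along[OF assms(1,2)] by eventually_elim (rule assms(3))
  then have "((\<lambda>t. f (x + t *\<^sub>R v)) has_vector_derivative d) (at 0) \<longleftrightarrow>
      ((\<lambda>t. g (x + t *\<^sub>R v)) has_vector_derivative d) (at 0)" for d
    by (intro iffI) (auto elim!: has_vector_derivative_eventually simp: eq_commute)
  then show ?thesis by (simp add: dir_deriv_def vector_derivative_def)
qed

lemma dir_differentiable_has_deriv:
  "dir_differentiable v f x \<Longrightarrow> ((\<lambda>t. f (x + t *\<^sub>R v)) has_vector_derivative dir_deriv v f x) (at 0)"
  by (simp add: dir_differentiable_def dir_deriv_def vector_derivative_works)

lemma stem_J_nth: "stem_J h a $ K = (if h \<in> K then a $ (K - {h}) else - (a $ insert h K))"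
proof -
  have "stem_J h a $ K = (\<Sum>L\<in>UNIV. if L = (if h \<in> K then K - {h} else insert h K)
     then (if h \<in> K then a $ (K - {h}) else - (a $ insert h K)) else 0)"
    unfolding stem_J_def sum_component
    by (intro sum.cong refl) (auto simp: axis_def)
  then show ?thesis by simp
qed

lemma stem_value_eq_iff:
  fixes a b :: "('m::finite, 'n::finite) stem_value"
  shows "a = b \<longleftrightarrow> (\<forall>K. a $ K = b $ K)"
  by (rule vec_eq_iff)

definition stem_conj :: "'n::finite \<Rightarrow> ('m::finite, 'n) stem_value \<Rightarrow> ('m, 'n) stem_value" where
  "stem_conj l a = (\<chi> K. if l \<in> K then - (a $ K) else a $ K)"

lemma stem_conj_nth: "stem_conj l a $ K = (if l \<in> K then - (a $ K) else a $ K)"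
  by (simp add: stem_conj_def)

lemma stem_on_conj_at: "stem_on D G \<longleftrightarrow> (\<forall>z\<in>D. \<forall>l. G (conj_at l z) = stem_conj l (G z))"
  by (auto simp: stem_on_def stem_value_eq_iff stem_conj_nth)

lemma bounded_linear_stem_conj: "bounded_linear (stem_conj l)"
  by (rule linear_conv_bounded_linear[THEN iffD1])
    (auto intro!: linearI simp: vec_eq_iff stem_conj_nth)

lemma conj_at_axis:
  "conj_at l (z + t *\<^sub>R axis h 1) = conj_at l z + t *\<^sub>R axis h 1"
  "conj_at l (z + t *\<^sub>R axis h \<i>) = conj_at l z + (if l = h then - t else t) *\<^sub>R axis h \<i>"
  by (auto simp: conj_at_def vec_eq_iff axis_def)

text \<open>Conjugating variable l reverses the direction of \<beta>_h exactly when l = h. The map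
  \<open>T\<close> is general so as to cover a whole stem function (\<open>stem_conj\<close>) as
  well as a single component (multiplication by a sign).\<close>

lemma deriv_conj_at:
  assumes "open D" "z \<in> D" "bounded_linear T" and G: "\<And>w. w \<in> D \<Longrightarrow> G (conj_at l w) = T (G w)"
  shows "dir_differentiable (axis h 1) G z \<Longrightarrow> d_alpha h G (conj_at l z) = T (d_alpha h G z)"
    "dir_differentiable (axis h \<i>) G z \<Longrightarrow>
      d_beta h G (conj_at l z) = (if l = h then - 1 else 1) *\<^sub>R T (d_beta h G z)"
proof -
  interpret T: bounded_linear T by fact
  {
    assume "dir_differentiable (axis h 1) G z"
    from T.has_vector_derivative[OF dir_differentiable_has_deriv[OF this]]
    have "((\<lambda>t. T (G (z + t *\<^sub>R axis h 1))) has_vector_derivative T (d_alpha h G z)) (at 0)"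
      by (simp add: d_alpha_def)
    moreover have "\<forall>\<^sub>F t in nhds 0. T (G (z + t *\<^sub>R axis h 1)) = G (conj_at l z + t *\<^sub>R axis h 1)"
      using eventually_along[OF assms(1,2), of "axis h 1"] by eventually_elim (metis G conj_at_axis(1))
    ultimately have "((\<lambda>t. G (conj_at l z + t *\<^sub>R axis h 1)) has_vector_derivative T (d_alpha h G z)) (at 0)"
      by (rule has_vector_derivative_eventually)
    then show "d_alpha h G (conj_at l z) = T (d_alpha h G z)"
      unfolding d_alpha_def by (rule dir_deriv_eqI)
  next
    let ?c = "if l = h then - 1 else 1 :: real"
    assume "dir_differentiable (axis h \<i>) G z"
    from T.has_vector_derivative[OF dir_differentiable_has_deriv[OF this]]
    have 1: "((\<lambda>t. T (G (z + t *\<^sub>R axis h \<i>))) has_vector_derivative T (d_beta h G z)) (at (?c * 0))"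
      by (simp add: d_beta_def)
    have "((\<lambda>t. ?c * t) has_vector_derivative ?c) (at 0)" by (auto intro!: derivative_eq_intros)
    from vector_diff_chain_at[OF this 1]
    have "((\<lambda>t. T (G (z + (?c * t) *\<^sub>R axis h \<i>))) has_vector_derivative ?c *\<^sub>R T (d_beta h G z)) (at 0)"
      by (simp add: o_def)
    moreover have "\<forall>\<^sub>F t in nhds 0. T (G (z + (?c * t) *\<^sub>R axis h \<i>)) = G (conj_at l z + t *\<^sub>R axis h \<i>)"
      using eventually_along[OF assms(1,2), of "?c *\<^sub>R axis h \<i>"]
    proof eventually_elim
      case (elim t)
      have "conj_at l (z + (?c * t) *\<^sub>R axis h \<i>) = conj_at l z + t *\<^sub>R axis h \<i>"
        by (simp add: conj_at_axis)
      then show ?case using G[of "z + (?c * t) *\<^sub>R axis h \<i>"] elim by (simp add: mult.commute)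
    qed
    ultimately have "((\<lambda>t. G (conj_at l z + t *\<^sub>R axis h \<i>)) has_vector_derivative ?c *\<^sub>R T (d_beta h G z)) (at 0)"
      by (rule has_vector_derivative_eventually)
    then show "d_beta h G (conj_at l z) = ?c *\<^sub>R T (d_beta h G z)"
      unfolding d_beta_def by (rule dir_deriv_eqI)
  }
qed

lemma iterated_deriv_conj_at:
  assumes "open D" "symmetric_set D" "z \<in> D"
    and diff: "\<And>i z. z \<in> D \<Longrightarrow> dir_differentiable (axis h \<i>) ((d_beta h ^^ i) g) z"
    and g: "\<And>w. w \<in> D \<Longrightarrow> g (conj_at l w) = s *\<^sub>R g w"
  shows "(d_beta h ^^ j) g (conj_at l z) = (s * (if l = h then (- 1) ^ j else 1)) *\<^sub>R (d_beta h ^^ j) g z"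
  using assms(3)
proof (induction j arbitrary: z)
  case 0
  then show ?case using g by simp
next
  case (Suc j)
  show ?case
    using deriv_conj_at(2)[OF assms(1) Suc.prems bounded_linear_scaleR_right Suc.IH diff[OF Suc.prems]]
    by (cases "l = h") (simp_all add: mult_ac)
qed

text \<open>\<open>stem_of\<close> is determined only on \<open>D\<close>, which suffices since
  \<open>D\<close> is open and the derivatives are local. The sign that \<partial>_\<beta> picks up
  under conjugation at h is compensated by \<open>stem_J h\<close>, so both combinations are stem
  functions and their induced functions can be evaluated.\<close>

lemma slice_derivs:
  fixes G :: "'n::{finite,linorder} cvec \<Rightarrow> ('m::{finite,linorder}, 'n) stem_value"
  assumes D: "open D" "symmetric_set D" "stem_on D G" "\<And>x. x \<in> circularization D \<Longrightarrow> g x = induced D G x"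
    and G: "\<And>z. z \<in> D \<Longrightarrow> dir_differentiable (axis h 1) G z"
      "\<And>z. z \<in> D \<Longrightarrow> dir_differentiable (axis h \<i>) G z"
    and z: "z \<in> D" "\<And>l. J $ l \<in> unit_imag"
  shows "slice_deriv D h g (slice_point z J) =
      (\<Sum>K\<in>UNIV. imag_prod J K (((1/2) *\<^sub>R (d_alpha h G z - stem_J h (d_beta h G z))) $ K))"
    and "slice_deriv_conj D h g (slice_point z J) =
      (\<Sum>K\<in>UNIV. imag_prod J K (((1/2) *\<^sub>R (d_alpha h G z + stem_J h (d_beta h G z))) $ K))"
proof -
  have eq: "d_alpha h (stem_of D g) z = d_alpha h G z" "d_beta h (stem_of D g) z = d_beta h G z" if "z \<in> D" for z
    unfolding d_alpha_def d_beta_def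
    by (rule dir_deriv_cong[OF D(1) that stem_of_eq[OF D(2-4)]]; assumption)+
  have conj: "d_alpha h G (conj_at l z) = stem_conj l (d_alpha h G z)"
    "stem_J h (d_beta h G (conj_at l z)) = stem_conj l (stem_J h (d_beta h G z))" if "z \<in> D" for z l
    using deriv_conj_at[OF D(1) that bounded_linear_stem_conj, of G l l h] G[OF that] D(3)
    by (auto simp: stem_on_conj_at) (auto simp: stem_value_eq_iff stem_J_nth stem_conj_nth)
  have st: "stem_on D (\<lambda>z. (1/2) *\<^sub>R (d_alpha h G z - stem_J h (d_beta h G z)))"
    "stem_on D (\<lambda>z. (1/2) *\<^sub>R (d_alpha h G z + stem_J h (d_beta h G z)))"
    unfolding stem_on_conj_at
    by (simp_all add: conj stem_value_eq_iff stem_conj_nth algebra_simps)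
  have "slice_deriv D h g = induced D (\<lambda>z. (1/2) *\<^sub>R (d_alpha h G z - stem_J h (d_beta h G z)))"
    unfolding slice_deriv_def Let_def by (rule induced_cong) (simp add: eq)
  then show "slice_deriv D h g (slice_point z J) =
      (\<Sum>K\<in>UNIV. imag_prod J K (((1/2) *\<^sub>R (d_alpha h G z - stem_J h (d_beta h G z))) $ K))"
    using induced_slice_point[OF D(2) st(1) z] by simp
  have "slice_deriv_conj D h g = induced D (\<lambda>z. (1/2) *\<^sub>R (d_alpha h G z + stem_J h (d_beta h G z)))"
    unfolding slice_deriv_conj_def Let_def by (rule induced_cong) (simp add: eq)
  then show "slice_deriv_conj D h g (slice_point z J) =
      (\<Sum>K\<in>UNIV. imag_prod J K (((1/2) *\<^sub>R (d_alpha h G z + stem_J h (d_beta h G z))) $ K))"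
    using induced_slice_point[OF D(2) st(2) z] by simp
qed

subsection \<open>Functions of one slice variable\<close>

lemma vec_lambda_axis_sum: "(\<chi> A. g A) = (\<Sum>A\<in>UNIV. axis A (g A :: 'b::real_normed_vector))"
  by (simp add: vec_eq_iff axis_def)

lemma bounded_linear_axis: "bounded_linear (axis A :: 'b::real_normed_vector \<Rightarrow> 'b ^ 'n::finite)"
proof (rule bounded_linear_intro[where K = 1])
  fix x :: 'b
  have "(\<Sum>i\<in>UNIV. (norm (axis A x $ i))\<^sup>2) = (\<Sum>i\<in>UNIV. if i = A then (norm x)\<^sup>2 else 0)"
    by (rule sum.cong) (auto simp: axis_def)
  then show "norm (axis A x :: 'b ^ 'n) \<le> norm x * 1" by (simp add: norm_vec_def L2_set_def)
qed (auto simp: axis_def vec_eq_iff)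

lemma has_vector_derivative_vec_lambda:
  fixes g :: "'n::finite \<Rightarrow> real \<Rightarrow> 'b::real_normed_vector"
  assumes "\<And>A. (g A has_vector_derivative d A) (at x)"
  shows "((\<lambda>t. \<chi> A. g A t) has_vector_derivative (\<chi> A. d A)) (at x)"
  unfolding vec_lambda_axis_sum
  by (intro has_vector_derivative_sum bounded_linear.has_vector_derivative[OF bounded_linear_axis] assms)

lemma differentiable_vec_lambda:
  fixes g :: "'n::finite \<Rightarrow> 'a::real_normed_vector \<Rightarrow> 'b::real_normed_vector"
  assumes "\<And>A. g A differentiable (at x)"
  shows "(\<lambda>t. \<chi> A. g A t) differentiable (at x)"
  unfolding vec_lambda_axis_sum
  by (intro differentiable_sum ballI differentiable_compose[OF bounded_linear_imp_differentiable[OF bounded_linear_axis]] assms) simp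

lemma has_laplacian_vec_lambda:
  fixes g :: "'n::finite \<Rightarrow> 'a::euclidean_space \<Rightarrow> real"
  assumes "\<And>A. has_laplacian U (g A) (L A)"
  shows "has_laplacian U (\<lambda>y. \<chi> A. g A y) (\<lambda>y. \<chi> A. L A y)"
  unfolding vec_lambda_axis_sum
  by (intro has_laplacian_sum has_laplacian_linear[OF assms bounded_linear_axis])

lemma vec_upd_add_axis: "vec_upd h y x + t *\<^sub>R axis h b = vec_upd h (y + t *\<^sub>R b) x"
  by (simp add: vec_eq_iff axis_def)

lemma add_axis_vec_upd: "z + axis h w = vec_upd h (z $ h + w) (z :: 'a::ab_group_add ^ 'n)"
  by (simp add: vec_eq_iff axis_def)

lemma add_scaleR_axis_vec_upd: "z + t *\<^sub>R axis h b = vec_upd h (z $ h + t *\<^sub>R b) z"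
  by (simp add: vec_eq_iff axis_def)

lemma sum_split_insert:
  fixes g :: "'n::finite set \<Rightarrow> 'b::comm_monoid_add"
  shows "(\<Sum>K\<in>UNIV. g K) = (\<Sum>K | h \<notin> K. g K + g (insert h K))"
proof -
  have "(\<Sum>K\<in>UNIV. g K) = (\<Sum>K\<in>{K. h \<notin> K} \<union> {K. h \<in> K}. g K)" by (rule sum.cong) auto
  also have "\<dots> = (\<Sum>K | h \<notin> K. g K) + (\<Sum>K | h \<in> K. g K)" by (rule sum.union_disjoint) auto
  also have "(\<Sum>K | h \<in> K. g K) = (\<Sum>K | h \<notin> K. g (insert h K))"
    by (rule sum.reindex_bij_witness[of _ "insert h" "\<lambda>K. K - {h}"]) (auto simp: insert_absorb)
  finally show ?thesis by (simp add: sum.distrib)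
qed

lemma laplacian_at_vec_upd:
  assumes "has_laplacian U (\<lambda>y. g (vec_upd h y x)) L" "open U" "y \<in> U"
  shows "laplacian_at h g (vec_upd h y x) = L y"
    "b \<in> Basis \<Longrightarrow> dir_differentiable (axis h b) g (vec_upd h y x)"
    "b \<in> Basis \<Longrightarrow> dir_differentiable (axis h b) (dir_deriv (axis h b) g) (vec_upd h y x)"
proof -
  obtain g1 g2 where *: "\<And>y b. y \<in> U \<Longrightarrow> b \<in> Basis \<Longrightarrow> ((\<lambda>t. g (vec_upd h (y + t *\<^sub>R b) x)) has_vector_derivative g1 b y) (at 0)"
    "\<And>y b. y \<in> U \<Longrightarrow> b \<in> Basis \<Longrightarrow> ((\<lambda>t. g1 b (y + t *\<^sub>R b)) has_vector_derivative g2 b y) (at 0)"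
    "\<And>y. y \<in> U \<Longrightarrow> L y = (\<Sum>b\<in>Basis. g2 b y)"
    using assms(1) unfolding has_laplacian_def by blast
  have 1: "((\<lambda>t. g (vec_upd h y x + t *\<^sub>R axis h b)) has_vector_derivative g1 b y) (at 0)" if "y \<in> U" "b \<in> Basis" for y b
    using *(1)[OF that] by (simp add: vec_upd_add_axis)
  have d1: "dir_deriv (axis h b) g (vec_upd h y x) = g1 b y" if "y \<in> U" "b \<in> Basis" for y b
    using dir_deriv_eqI(1)[OF 1[OF that]] .
  have 2: "((\<lambda>t. dir_deriv (axis h b) g (vec_upd h y x + t *\<^sub>R axis h b)) has_vector_derivative g2 b y) (at 0)" if "b \<in> Basis" for b
  proof -
    have "\<forall>\<^sub>F t in nhds 0. g1 b (y + t *\<^sub>R b) = dir_deriv (axis h b) g (vec_upd h y x + t *\<^sub>R axis h b)"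
      using eventually_along[OF assms(2,3), of b] by eventually_elim (simp add: vec_upd_add_axis d1 that)
    then show ?thesis by (rule has_vector_derivative_eventually[OF *(2)[OF assms(3) that]])
  qed
  show "laplacian_at h g (vec_upd h y x) = L y"
    unfolding laplacian_at_def *(3)[OF assms(3)] by (intro sum.cong refl dir_deriv_eqI(1) 2)
  show "b \<in> Basis \<Longrightarrow> dir_differentiable (axis h b) g (vec_upd h y x)"
    using dir_deriv_eqI(2)[OF 1[OF assms(3)]] .
  show "b \<in> Basis \<Longrightarrow> dir_differentiable (axis h b) (dir_deriv (axis h b) g) (vec_upd h y x)"
    using dir_deriv_eqI(2)[OF 2] .
qed

text \<open>For \<open>h \<notin> K\<close>, the functions \<open>F\<^sub>K\<close> and \<open>F\<^bsub>K\<union>{h}\<^esub>\<close>, with all variables but the one with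
  index \<open>h\<close> fixed, are the real and imaginary parts of a holomorphic function with values in the
  complexified Clifford algebra; \<open>holo_comp F h z K A\<close> is its coordinate at \<open>e\<^sub>A\<close>.\<close>

definition holo_comp ::
    "('n::finite cvec \<Rightarrow> ('m::finite, 'n) stem_value) \<Rightarrow> 'n \<Rightarrow> 'n cvec \<Rightarrow> 'n set \<Rightarrow> 'm set \<Rightarrow> complex \<Rightarrow> complex" where
  "holo_comp F h z K A w = Complex (F (vec_upd h w z) $ K $ A) (F (vec_upd h w z) $ insert h K $ A)"

definition slice_dom :: "'n::finite cvec set \<Rightarrow> 'n \<Rightarrow> 'n cvec \<Rightarrow> complex set" where
  "slice_dom D h z = {w. vec_upd h w z \<in> D}"

lemma holo_comp_vec_upd [simp]: "holo_comp F h (vec_upd h w z) = holo_comp F h z"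
  by (simp add: holo_comp_def fun_eq_iff)

lemma slice_dom_self: "z $ h \<in> slice_dom D h z \<longleftrightarrow> z \<in> D"
  by (simp add: slice_dom_def)

lemma iterated_d_beta:
  fixes g :: "'n::finite cvec \<Rightarrow> real ^ 'a::finite" and q :: "nat \<Rightarrow> 'n cvec \<Rightarrow> 'a \<Rightarrow> complex \<Rightarrow> real"
  assumes "open U" "\<And>j z w. q j (vec_upd h w z) = q j z"
    and "\<And>z. z \<in> U \<Longrightarrow> g z = (\<chi> A. q 0 z A (z $ h))"
    and "\<And>j z A. z \<in> U \<Longrightarrow> ((\<lambda>t. q j z A (z $ h + t *\<^sub>R \<i>)) has_vector_derivative q (Suc j) z A (z $ h)) (at 0)"
    and "z \<in> U"
  shows "(d_beta h ^^ j) g z = (\<chi> A. q j z A (z $ h))"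
    "dir_differentiable (axis h \<i>) ((d_beta h ^^ j) g) z"
proof -
  have step: "((\<lambda>t. (d_beta h ^^ j) g (z + t *\<^sub>R axis h \<i>)) has_vector_derivative (\<chi> A. q (Suc j) z A (z $ h))) (at 0)"
    if IH: "\<And>z. z \<in> U \<Longrightarrow> (d_beta h ^^ j) g z = (\<chi> A. q j z A (z $ h))" and z: "z \<in> U" for j z
  proof (rule has_vector_derivative_eventually)
    show "((\<lambda>t. \<chi> A. q j z A (z $ h + t *\<^sub>R \<i>)) has_vector_derivative (\<chi> A. q (Suc j) z A (z $ h))) (at 0)"
      by (intro has_vector_derivative_vec_lambda assms(4) z)
    show "\<forall>\<^sub>F t in nhds 0. (\<chi> A. q j z A (z $ h + t *\<^sub>R \<i>)) = (d_beta h ^^ j) g (z + t *\<^sub>R axis h \<i>)"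
      using eventually_along[OF assms(1) z, of "axis h \<i>"]
      by eventually_elim (simp add: IH, simp add: add_scaleR_axis_vec_upd assms(2))
  qed
  have eq: "(d_beta h ^^ j) g z = (\<chi> A. q j z A (z $ h))" if "z \<in> U" for z j
    using that
  proof (induction j arbitrary: z)
    case (Suc j)
    show ?case using dir_deriv_eqI(1)[OF step[OF Suc.IH Suc.prems]] by (simp add: d_beta_def)
  qed (simp add: assms(3))
  then show "(d_beta h ^^ j) g z = (\<chi> A. q j z A (z $ h))" using assms(5) by blast
  show "dir_differentiable (axis h \<i>) ((d_beta h ^^ j) g) z"
    using dir_deriv_eqI(2)[OF step[OF eq assms(5)]] .
qed

lemma conj_at_vec_upd: "conj_at h (vec_upd h w z) = vec_upd h (cnj w) z"
  by (simp add: conj_at_def vec_eq_iff)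

text \<open>The sign comes from the prepended entry \<open>- Re H\<close> in \<open>sph_re\<close>:
  for \<open>k = 0\<close> the product is empty and the constant is -1.\<close>

abbreviation lap_const :: "nat \<Rightarrow> nat \<Rightarrow> real" where
  "lap_const m k \<equiv> - (\<Prod>i<k. real m - 2 * real i - 1)"

section \<open>Holomorphy in one variable of regular slice functions\<close>

locale slice_regular =
  fixes D :: "'n::{finite,linorder} cvec set"
    and F :: "'n cvec \<Rightarrow> ('m::{finite,linorder}, 'n) stem_value"
    and f :: "('m, 'n) pvec \<Rightarrow> 'm clifford"
    and h :: 'n
  assumes open_D: "open D" and sym_D: "symmetric_set D" and stem_F: "stem_on D F" and C1: "C1_on D F"
    and f_eq: "\<And>x. x \<in> circularization D \<Longrightarrow> f x = induced D F x"
    and regular: "\<And>x. x \<in> circularization D \<Longrightarrow> slice_deriv_conj D h f x = 0"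
begin

lemma F_dir_deriv:
  assumes "(F has_derivative L) (at z)"
  shows "((\<lambda>t. F (z + t *\<^sub>R v)) has_vector_derivative L v) (at 0)"
proof -
  have L: "bounded_linear L" using assms by (rule has_derivative_bounded_linear)
  have "((\<lambda>t. z + t *\<^sub>R v) has_derivative (\<lambda>t. t *\<^sub>R v)) (at 0)" by (auto intro!: derivative_eq_intros)
  from has_derivative_compose[OF this, of F L] assms
  have "((\<lambda>t. F (z + t *\<^sub>R v)) has_derivative (\<lambda>t. L (t *\<^sub>R v))) (at 0)" by simp
  then show ?thesis
    by (simp add: has_vector_derivative_def linear_scale[OF bounded_linear.linear[OF L]])
qed

lemma F_derivative: "z \<in> D \<Longrightarrow> \<exists>L. (F has_derivative L) (at z)"
  using C1 by (auto simp: C1_on_def)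

lemma F_dir_differentiable: "z \<in> D \<Longrightarrow> dir_differentiable v F z"
  using F_derivative F_dir_deriv dir_deriv_eqI(2) by metis

lemma cauchy_riemann:
  assumes "z \<in> D" "h \<notin> K"
  shows "d_alpha h F z $ K = d_beta h F z $ insert h K"
    "d_alpha h F z $ insert h K = - (d_beta h F z $ K)"
proof -
  have "(1/2) *\<^sub>R (d_alpha h F z + stem_J h (d_beta h F z)) = 0"
  proof (rule imag_prod_sum_eq_0)
    fix J :: "('m, 'n) pvec" assume J: "\<And>l. J $ l \<in> unit_imag"
    then have "slice_point z J \<in> circularization D" using assms(1) by (auto simp: circularization_def)
    from regular[OF this] show "(\<Sum>K\<in>UNIV. imag_prod J K (((1/2) *\<^sub>R (d_alpha h F z + stem_J h (d_beta h F z))) $ K)) = 0"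
      using slice_derivs(2)[OF open_D sym_D stem_F f_eq F_dir_differentiable F_dir_differentiable assms(1) J] by simp
  qed
  then have "(d_alpha h F z + stem_J h (d_beta h F z)) $ L = 0" for L by simp
  from this[of K] this[of "insert h K"] assms(2)
  show "d_alpha h F z $ K = d_beta h F z $ insert h K"
    "d_alpha h F z $ insert h K = - (d_beta h F z $ K)"
    by (auto simp: stem_J_nth eq_neg_iff_add_eq_0)
qed

lemma open_slice_dom: "open (slice_dom D h z)"
proof -
  have "continuous_on UNIV (\<lambda>w. vec_upd h w z)"
    unfolding vec_upd_def
  proof (rule continuous_on_vec_lambda)
    show "continuous_on UNIV (\<lambda>w. if l = h then w else z $ l)" for l by (cases "l = h") simp_all
  qed
  then show ?thesis unfolding slice_dom_def using open_vimage[OF open_D] by (simp add: vimage_def)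
qed

text \<open>Class C^1 gives a real derivative \<open>L\<close> of \<open>F\<close>; by the
  Cauchy-Riemann equations its restriction to the direction h acts on each pair of components as
  multiplication by the complex number \<open>Complex ?p ?q\<close>. The stem condition at h is the
  compatibility with conjugation.\<close>

lemma conj_holomorphic_holo_comp:
  assumes "h \<notin> K"
  shows "conj_holomorphic (slice_dom D h z) (holo_comp F h z K A)"
  unfolding conj_holomorphic_def
proof (intro conjI ballI)
  fix w assume w: "w \<in> slice_dom D h z"
  then have wD: "vec_upd h w z \<in> D" by (simp add: slice_dom_def)
  then have cD: "vec_upd h (cnj w) z \<in> D"
    using sym_D conj_at_vec_upd[of h w z] unfolding symmetric_set_def by metis
  then show "cnj w \<in> slice_dom D h z" by (simp add: slice_dom_def)
  have "F (vec_upd h (cnj w) z) $ L = (if h \<in> L then - (F (vec_upd h w z) $ L) else F (vec_upd h w z) $ L)" for L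
    using stem_F wD conj_at_vec_upd[of h w z] unfolding stem_on_def by metis
  then show "holo_comp F h z K A (cnj w) = cnj (holo_comp F h z K A w)"
    using assms by (simp add: holo_comp_def complex_eq_iff)
next
  show "open (slice_dom D h z)" by (rule open_slice_dom)
next
  have "\<exists>c. (holo_comp F h z K A has_field_derivative c) (at w)" if "w \<in> slice_dom D h z" for w
  proof -
    let ?z = "vec_upd h w z"
    have zD: "?z \<in> D" using that by (simp add: slice_dom_def)
    then obtain L where L: "(F has_derivative L) (at ?z)" using F_derivative by blast
    have lin: "linear L" using L by (intro bounded_linear.linear has_derivative_bounded_linear)
    have da: "d_alpha h F ?z = L (axis h 1)" "d_beta h F ?z = L (axis h \<i>)"
      unfolding d_alpha_def d_beta_def by (rule dir_deriv_eqI(1)[OF F_dir_deriv[OF L]])+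
    let ?p = "L (axis h 1) $ K $ A" and ?q = "L (axis h 1) $ insert h K $ A"
    have i: "L (axis h \<i>) $ K $ A = - ?q" "L (axis h \<i>) $ insert h K $ A = ?p"
      using cauchy_riemann[OF zD assms] unfolding da by simp_all
    have "axis h v = Re v *\<^sub>R axis h 1 + Im v *\<^sub>R (axis h \<i> :: 'n cvec)" for v
      by (auto simp: vec_eq_iff axis_def complex_eq_iff)
    then have Lv: "L (axis h v) = Re v *\<^sub>R L (axis h 1) + Im v *\<^sub>R L (axis h \<i>)" for v
      by (metis linear_add[OF lin] linear_scale[OF lin])
    have "((\<lambda>w'. axis h (w' - w)) has_derivative (\<lambda>v. axis h v)) (at w)"
      by (rule bounded_linear.has_derivative[OF bounded_linear_axis]) (auto intro!: derivative_eq_intros)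
    from has_derivative_add[OF has_derivative_const this, of ?z]
    have "((\<lambda>w'. ?z + axis h (w' - w)) has_derivative (\<lambda>v. axis h v)) (at w)" by simp
    moreover have "?z + axis h (w' - w) = vec_upd h w' z" for w'
      by (simp add: vec_eq_iff axis_def)
    ultimately have "((\<lambda>w'. vec_upd h w' z) has_derivative axis h) (at w)" by simp
    from has_derivative_compose[OF this, of F L] L
    have "((\<lambda>w'. F (vec_upd h w' z)) has_derivative (\<lambda>v. L (axis h v))) (at w)" by simp
    then have comp: "((\<lambda>w'. F (vec_upd h w' z) $ M $ A) has_derivative (\<lambda>v. L (axis h v) $ M $ A)) (at w)" for M
      by (intro bounded_linear.has_derivative[OF bounded_linear_vec_nth])
    have "((\<lambda>w'. of_real (F (vec_upd h w' z) $ K $ A) + \<i> * of_real (F (vec_upd h w' z) $ insert h K $ A))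
      has_derivative (\<lambda>v. of_real (L (axis h v) $ K $ A) + \<i> * of_real (L (axis h v) $ insert h K $ A))) (at w)"
      by (intro has_derivative_add has_derivative_mult_right has_derivative_of_real comp)
    moreover have "(\<lambda>v. of_real (L (axis h v) $ K $ A) + \<i> * of_real (L (axis h v) $ insert h K $ A)) = (*) (Complex ?p ?q)"
    proof
      fix v
      have "L (axis h v) $ K $ A = Re v * ?p - Im v * ?q" "L (axis h v) $ insert h K $ A = Re v * ?q + Im v * ?p"
        by (subst Lv, simp add: i)+
      then show "of_real (L (axis h v) $ K $ A) + \<i> * of_real (L (axis h v) $ insert h K $ A) = Complex ?p ?q * v"
        by (simp only:) (simp add: complex_eq_iff algebra_simps)
    qed
    ultimately have "(holo_comp F h z K A has_field_derivative Complex ?p ?q) (at w)"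
      by (simp add: has_field_derivative_def holo_comp_def[abs_def] Complex_eq)
    then show ?thesis by blast
  qed
  then show "holo_comp F h z K A holomorphic_on slice_dom D h z"
    unfolding holomorphic_on_open[OF open_slice_dom] by blast
qed

subsection \<open>Iterated Laplacians\<close>

text \<open>Up to a constant, the \<open>k\<close>-th Laplacian of \<open>f\<close> at \<open>vec_upd h y (slice_point z J)\<close>.\<close>

definition lap_part :: "nat \<Rightarrow> 'n cvec \<Rightarrow> ('m, 'n) pvec \<Rightarrow> 'm paravector \<Rightarrow> 'm clifford" where
  "lap_part k z J y = (\<Sum>K | h \<notin> K.
     imag_prod J K (\<chi> A. sph_re k (holo_comp F h z K A) (upper_point y)) -
     imag_prod (vec_upd h (0, snd y) J) (insert h K) (\<chi> A. sph k (holo_comp F h z K A) (upper_point y)))"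

abbreviation slice_nbhd :: "'n cvec \<Rightarrow> 'm paravector set" where
  "slice_nbhd z \<equiv> {y. upper_point y \<in> slice_dom D h z}"

lemma open_slice_nbhd: "open (slice_nbhd z)"
proof -
  have "continuous_on UNIV (\<lambda>y :: 'm paravector. of_real (fst y) + \<i> * of_real (norm (snd y)))"
    by (intro continuous_intros)
  then have "continuous_on UNIV (upper_point :: 'm paravector \<Rightarrow> _)"
    by (simp add: upper_point_def[abs_def] Complex_eq)
  then show ?thesis using open_slice_dom by (simp add: open_vimage flip: vimage_def)
qed

text \<open>The product is reduced to fixed bounded linear maps applied to coordinates of v times
  radial functions, for which the Laplacian is known.\<close>

lemma sum_imag_prod_snd:
  assumes "h \<in> K"
  shows "imag_prod (vec_upd h (0, v) J) K (a :: 'm clifford) = (\<Sum>i\<in>UNIV. imag_prod (vec_upd h (0, axis i 1) J) K (v $ i *\<^sub>R a))"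
proof -
  have lin: "linear (\<lambda>p. imag_prod (vec_upd h p J) K a)"
    by (rule bounded_linear.linear[OF bounded_linear_imag_prod_upd[OF assms]])
  have "(0 :: real, v) = (\<Sum>i\<in>UNIV. v $ i *\<^sub>R (0, axis i 1 :: (real, 'm) vec))"
    by (simp add: prod_eq_iff vec_eq_iff snd_sum fst_sum axis_def if_distrib cong: if_cong)
  then have "imag_prod (vec_upd h (0, v) J) K a = (\<Sum>i\<in>UNIV. v $ i *\<^sub>R imag_prod (vec_upd h (0, axis i 1) J) K a)"
    by (simp only: linear_sum[OF lin] linear_scale[OF lin])
  then show ?thesis
    by (simp add: linear_scale[OF bounded_linear.linear[OF bounded_linear_imag_prod]])
qed

lemma laplacian_lap_part:
  "has_laplacian (slice_nbhd z) (lap_part k z J) (\<lambda>y. (real CARD('m) - 2 * real k - 1) *\<^sub>R lap_part (k + 1) z J y)"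
proof -
  let ?c = "real CARD('m) - 2 * real k - 1" and ?U = "slice_nbhd z"
  let ?P = "\<lambda>k K y. \<chi> A. sph_re k (holo_comp F h z K A) (upper_point y)"
  let ?Q = "\<lambda>k K i y. \<chi> A. snd y $ i * sph k (holo_comp F h z K A) (upper_point y)"
  let ?J = "\<lambda>i. vec_upd h (0, axis i 1) J"
  have eq: "lap_part k z J = (\<lambda>y. \<Sum>K | h \<notin> K. imag_prod J K (?P k K y) + - (\<Sum>i\<in>UNIV. imag_prod (?J i) (insert h K) (?Q k K i y)))" for k
  proof
    fix y
    have "v *\<^sub>R (\<chi> A. g A) = (\<chi> A. v * g A)" for v :: real and g :: "'m set \<Rightarrow> real" by (simp add: vec_eq_iff)
    then show "lap_part k z J y = (\<Sum>K | h \<notin> K. imag_prod J K (?P k K y) + - (\<Sum>i\<in>UNIV. imag_prod (?J i) (insert h K) (?Q k K i y)))"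
      unfolding lap_part_def by (subst sum_imag_prod_snd) simp_all
  qed
  have "has_laplacian ?U (lap_part k z J) (\<lambda>y. \<Sum>K | h \<notin> K. imag_prod J K (\<chi> A. ?c * sph_re (k + 1) (holo_comp F h z K A) (upper_point y)) +
      - (\<Sum>i\<in>UNIV. imag_prod (?J i) (insert h K) (\<chi> A. ?c * (snd y $ i * sph (k + 1) (holo_comp F h z K A) (upper_point y)))))"
    unfolding eq
  proof (intro has_laplacian_sum has_laplacian_add)
    fix K assume "K \<in> {K. h \<notin> K}"
    then have H: "conj_holomorphic (slice_dom D h z) (holo_comp F h z K A)" for A
      by (simp add: conj_holomorphic_holo_comp)
    show "has_laplacian ?U (\<lambda>y. imag_prod J K (?P k K y))
      (\<lambda>y. imag_prod J K (\<chi> A. ?c * sph_re (k + 1) (holo_comp F h z K A) (upper_point y)))"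
      by (intro has_laplacian_linear[OF _ bounded_linear_imag_prod] has_laplacian_vec_lambda
          radial.laplacian_radial[OF radial_sph_re[OF H]])
    \<comment> \<open>Here the factor is m + 2 - 2k - 3, the same as m - 2k - 1 for the part without
      v.\<close>
    have coord: "has_laplacian ?U (\<lambda>y. snd y $ i * sph k (holo_comp F h z K A) (upper_point y))
      (\<lambda>y. ?c * (snd y $ i * sph (k + 1) (holo_comp F h z K A) (upper_point y)))" for i A
      using radial.laplacian_radial_coord[OF radial_sph[OF H[of A]], of i k] by (simp add: algebra_simps)
    have "has_laplacian ?U (\<lambda>y. imag_prod (?J i) (insert h K) (?Q k K i y))
       (\<lambda>y. imag_prod (?J i) (insert h K) (\<chi> A. ?c * (snd y $ i * sph (k + 1) (holo_comp F h z K A) (upper_point y))))" for i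
      by (intro has_laplacian_linear[OF _ bounded_linear_imag_prod] has_laplacian_vec_lambda coord)
    then show "has_laplacian ?U (\<lambda>y. - (\<Sum>i\<in>UNIV. imag_prod (?J i) (insert h K) (?Q k K i y)))
       (\<lambda>y. - (\<Sum>i\<in>UNIV. imag_prod (?J i) (insert h K) (\<chi> A. ?c * (snd y $ i * sph (k + 1) (holo_comp F h z K A) (upper_point y)))))"
      by (intro has_laplacian_linear[OF _ bounded_linear_minus[OF bounded_linear_ident]] has_laplacian_sum)
  qed
  then show ?thesis
  proof (rule has_laplacian_cong[OF _ open_slice_nbhd])
    have vec: "(\<chi> A. ?c * g A) = ?c *\<^sub>R (\<chi> A. g A)" for g :: "'m set \<Rightarrow> real" by (simp add: vec_eq_iff)
    have lin: "imag_prod J K (?c *\<^sub>R a) = ?c *\<^sub>R imag_prod J K a" for J :: "('m, 'n) pvec" and K a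
      by (rule linear_scale[OF bounded_linear.linear[OF bounded_linear_imag_prod]])
    fix y
    show "(\<Sum>K | h \<notin> K. imag_prod J K (\<chi> A. ?c * sph_re (k + 1) (holo_comp F h z K A) (upper_point y)) +
      - (\<Sum>i\<in>UNIV. imag_prod (?J i) (insert h K) (\<chi> A. ?c * (snd y $ i * sph (k + 1) (holo_comp F h z K A) (upper_point y)))))
      = ?c *\<^sub>R lap_part (k + 1) z J y"
      unfolding eq vec lin scaleR_sum_right scaleR_add_right scaleR_minus_right ..
  qed simp
qed

lemma f_lap_part:
  assumes "\<And>l. J $ l \<in> unit_imag" "y \<in> slice_nbhd z"
  shows "f (vec_upd h y (slice_point z J)) = - lap_part 0 z J y"
proof -
  \<comment> \<open>For v = 0 the normalized vector is 0 and not a unit. Any unit may stand in,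
    since only the product of \<open>p\<close> with |v| enters.\<close>
  define p where "p = (if snd y = 0 then J $ h else (0, sgn (snd y)))"
  define z' where "z' = vec_upd h (upper_point y) z"
  define J' where "J' = vec_upd h p J"
  have p: "p \<in> unit_imag" using assms(1) by (auto simp: p_def unit_imag_iff norm_sgn)
  have py: "norm (snd y) *\<^sub>R p = (0, snd y)"
    using assms(1)[of h] by (auto simp: p_def sgn_div_norm unit_imag_iff zero_prod_def)
  have J': "J' $ l \<in> unit_imag" for l using p assms(1) by (simp add: J'_def)
  have z'D: "z' \<in> D" using assms(2) by (simp add: z'_def slice_dom_def)
  have "vec_upd h y (slice_point z J) = slice_point z' J'"
    using py by (auto simp: vec_eq_iff slice_point_nth z'_def J'_def upper_point_def prod_eq_iff)
  moreover have "slice_point z' J' \<in> circularization D" using z'D J' by (auto simp: circularization_def)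
  ultimately have "f (vec_upd h y (slice_point z J)) = (\<Sum>K\<in>UNIV. imag_prod J' K (F z' $ K))"
    using f_eq induced_slice_point[OF sym_D stem_F z'D J'] by simp
  also have "\<dots> = (\<Sum>K | h \<notin> K. imag_prod J' K (F z' $ K) + imag_prod J' (insert h K) (F z' $ insert h K))"
    by (rule sum_split_insert)
  also have "\<dots> = (\<Sum>K | h \<notin> K. - (imag_prod J K (\<chi> A. sph_re 0 (holo_comp F h z K A) (upper_point y)) -
     imag_prod (vec_upd h (0, snd y) J) (insert h K) (\<chi> A. sph 0 (holo_comp F h z K A) (upper_point y))))"
  proof (rule sum.cong)
    fix K assume "K \<in> {K. h \<notin> K}"
    then have K: "h \<notin> K" by simp
    have lin: "linear (imag_prod J K :: 'm clifford \<Rightarrow> _)" for J K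
      by (rule bounded_linear.linear[OF bounded_linear_imag_prod])
    have "F z' $ K = - (\<chi> A. sph_re 0 (holo_comp F h z K A) (upper_point y))"
      by (simp add: vec_eq_iff sph_re_def holo_comp_def z'_def)
    moreover have "imag_prod J' K (F z' $ K) = imag_prod J K (F z' $ K)"
      using K by (intro imag_prod_cong) (auto simp: J'_def)
    ultimately have 1: "imag_prod J' K (F z' $ K) = - imag_prod J K (\<chi> A. sph_re 0 (holo_comp F h z K A) (upper_point y))"
      by (simp add: linear_neg[OF lin])
    let ?Q = "\<chi> A. sph 0 (holo_comp F h z K A) (upper_point y)"
    have "F z' $ insert h K $ A = norm (snd y) * sph 0 (holo_comp F h z K A) (upper_point y)" for A
      using sph_0[OF _ conj_holomorphic_holo_comp[OF K], of "upper_point y" z A] assms(2)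
      by (simp add: holo_comp_def z'_def upper_point_def)
    then have "F z' $ insert h K = norm (snd y) *\<^sub>R ?Q" by (simp add: vec_eq_iff)
    then have "imag_prod J' (insert h K) (F z' $ insert h K) = norm (snd y) *\<^sub>R imag_prod (vec_upd h p J) (insert h K) ?Q"
      by (simp add: J'_def linear_scale[OF lin])
    also have "\<dots> = imag_prod (vec_upd h (norm (snd y) *\<^sub>R p) J) (insert h K) ?Q"
      using linear_scale[OF bounded_linear.linear[OF bounded_linear_imag_prod_upd[of h "insert h K" J ?Q]], of "norm (snd y)" p] by simp
    finally show "imag_prod J' K (F z' $ K) + imag_prod J' (insert h K) (F z' $ insert h K) =
      - (imag_prod J K (\<chi> A. sph_re 0 (holo_comp F h z K A) (upper_point y)) - imag_prod (vec_upd h (0, snd y) J) (insert h K) ?Q)"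
      using 1 by (simp add: py)
  qed simp
  finally show ?thesis by (simp only: lap_part_def sum_negf)
qed

lemma iterated_laplacian:
  assumes "\<And>l. J $ l \<in> unit_imag" "y \<in> slice_nbhd z"
  shows "(laplacian_at h ^^ k) f (vec_upd h y (slice_point z J)) = lap_const CARD('m) k *\<^sub>R lap_part k z J y"
  using assms(2)
proof (induction k arbitrary: y)
  case 0
  then show ?case using f_lap_part[OF assms(1)] by simp
next
  case (Suc k)
  have "has_laplacian (slice_nbhd z) (\<lambda>y. (laplacian_at h ^^ k) f (vec_upd h y (slice_point z J)))
     (\<lambda>y. lap_const CARD('m) k *\<^sub>R ((real CARD('m) - 2 * real k - 1) *\<^sub>R lap_part (k + 1) z J y))"
    by (rule has_laplacian_cong[OF has_laplacian_linear[OF laplacian_lap_part[of z k J]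
      bounded_linear_scaleR_right[of "lap_const CARD('m) k"]] open_slice_nbhd])
      (simp_all add: Suc.IH)
  from laplacian_at_vec_upd(1)[OF this open_slice_nbhd Suc.prems] show ?case by simp
qed

lemma has_laplacian_iterated:
  assumes "\<And>l. J $ l \<in> unit_imag"
  shows "has_laplacian (slice_nbhd z) (\<lambda>y. (laplacian_at h ^^ k) f (vec_upd h y (slice_point z J)))
     (\<lambda>y. lap_const CARD('m) k *\<^sub>R ((real CARD('m) - 2 * real k - 1) *\<^sub>R lap_part (k + 1) z J y))"
  by (rule has_laplacian_cong[OF has_laplacian_linear[OF laplacian_lap_part[of z k J]
      bounded_linear_scaleR_right[of "lap_const CARD('m) k"]] open_slice_nbhd])
    (simp_all add: iterated_laplacian[OF assms])

text \<open>If the imaginary part is negative, \<open>upper_point\<close> yields the conjugate of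
  \<open>z $ h\<close>, which is admissible by symmetry of \<open>D\<close>.\<close>

lemma slice_point_nbhd:
  assumes "z \<in> D" "\<And>l. J $ l \<in> unit_imag"
  shows "slice_point z J $ h \<in> slice_nbhd z"
proof -
  have "upper_point (slice_point z J $ h) = Complex (Re (z $ h)) \<bar>Im (z $ h)\<bar>"
    using assms(2)[of h] by (simp add: upper_point_def slice_point_nth unit_imag_iff)
  also have "\<dots> = z $ h \<or> \<dots> = cnj (z $ h)" by (auto simp: complex_eq_iff abs_if)
  finally have "vec_upd h (upper_point (slice_point z J $ h)) z = z \<or> vec_upd h (upper_point (slice_point z J $ h)) z = conj_at h z"
    by (metis conj_at_vec_upd vec_upd_triv)
  moreover have "conj_at h z \<in> D" using sym_D assms(1) by (simp add: symmetric_set_def)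
  ultimately show ?thesis using assms(1) by (auto simp: slice_dom_def)
qed

lemma iter_laplacian_exists_circularization: "iter_laplacian_exists h p (circularization D) f"
  unfolding iter_laplacian_exists_def
proof (intro allI impI ballI)
  fix i and x :: "('m, 'n) pvec" and b :: "'m paravector" assume "x \<in> circularization D" "b \<in> Basis"
  then obtain z J where zJ: "z \<in> D" "\<And>l. J $ l \<in> unit_imag" "x = slice_point z J"
    by (auto simp: circularization_def)
  note * = laplacian_at_vec_upd(2,3)[OF has_laplacian_iterated[OF zJ(2), where k = i and z = z] open_slice_nbhd slice_point_nbhd[OF zJ(1,2)]]
  show "dir_differentiable (axis h b) ((laplacian_at h ^^ i) f) x \<and>
     dir_differentiable (axis h b) (dir_deriv (axis h b) ((laplacian_at h ^^ i) f)) x"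
    using *[OF \<open>b \<in> Basis\<close>] zJ by simp
qed

lemma polyharmonic:
  assumes "odd CARD('m)"
  shows "polyharmonic_in h ((CARD('m) - 1) div 2 + 1) (circularization D) f"
  unfolding polyharmonic_in_def
proof (intro conjI ballI)
  let ?p = "(CARD('m) - 1) div 2"
  fix x :: "('m, 'n) pvec" assume "x \<in> circularization D"
  then obtain z J where zJ: "z \<in> D" "\<And>l. J $ l \<in> unit_imag" "x = slice_point z J"
    by (auto simp: circularization_def)
  \<comment> \<open>Oddness makes the factor with index \<open>?p\<close> vanish; the product
    contains it from order \<open>?p + 1\<close> on.\<close>
  have "real CARD('m) - 2 * real ?p - 1 = 0" using assms by (auto elim!: oddE)
  then have "\<exists>i\<in>{..<?p + 1}. real CARD('m) - 2 * real i - 1 = 0" by (intro bexI[of _ ?p]) auto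
  then have "(\<Prod>i<?p + 1. real CARD('m) - 2 * real i - 1) = 0" by (simp only: prod_zero_iff finite_lessThan)
  then show "(laplacian_at h ^^ (?p + 1)) f x = 0"
    using iterated_laplacian[OF zJ(2) slice_point_nbhd[OF zJ(1,2)], where k = "?p + 1"] zJ(3) by simp
qed (rule iter_laplacian_exists_circularization)

end

subsection \<open>The slice derivatives in the formulas\<close>

lemma lower_stem_nth:
  "(\<Sum>K | h \<notin> K. axis K (c K :: 'm::finite clifford)) $ L = (if h \<in> L then 0 else c L)"
proof -
  have "(\<Sum>K | h \<notin> K. axis K (c K)) $ L = (\<Sum>K | h \<notin> K. if K = L then c L else 0)"
    unfolding sum_component by (rule sum.cong) (auto simp: axis_def)
  then show ?thesis by simp
qed

lemma dir_differentiable_axis: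
  fixes G :: "'n::finite cvec \<Rightarrow> 'b::real_normed_vector"
  assumes "(\<lambda>w. G (z + axis h w)) differentiable (at 0)"
  shows "dir_differentiable (axis h b) G z"
proof -
  have "(\<lambda>t::real. t *\<^sub>R b) differentiable (at 0)" by simp
  then have "(\<lambda>t. G (z + axis h (t *\<^sub>R b))) differentiable (at (0::real))"
    by (rule differentiable_compose[of "\<lambda>w. G (z + axis h w)", rotated]) (simp add: assms)
  moreover have "axis h (t *\<^sub>R b) = t *\<^sub>R (axis h b :: 'n cvec)" for t
    by (simp add: vec_eq_iff axis_def)
  ultimately show ?thesis by (simp add: dir_differentiable_def)
qed

lemma differentiable_along_axis:
  assumes "open U" "z \<in> U" "\<And>w. vec_upd h w z \<in> U \<Longrightarrow> G (vec_upd h w z) = g w"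
    and "g differentiable (at (z $ h))"
  shows "(\<lambda>w. G (z + axis h w)) differentiable (at 0)"
proof -
  obtain g' where g': "(g has_derivative g') (at (z $ h))" using assms(4) by (auto simp: differentiable_def)
  have "((\<lambda>w. z $ h + w) has_derivative (\<lambda>w. w)) (at 0)" by (auto intro!: derivative_eq_intros)
  from has_derivative_compose[OF this, of g g'] g'
  have 1: "((\<lambda>w. g (z $ h + w)) has_derivative g') (at 0)" by simp
  have "continuous_on UNIV (\<lambda>w. z + axis h w)"
    by (intro continuous_intros linear_continuous_on bounded_linear_axis)
  then have op: "open ((\<lambda>w. z + axis h w) -` U)" using assms(1) by (simp add: open_vimage)
  have "((\<lambda>w. G (z + axis h w)) has_derivative g') (at 0)"
    by (rule has_derivative_transform_within_open[OF 1 op])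
      (use assms(2,3) in \<open>auto simp: add_axis_vec_upd\<close>)
  then show ?thesis by (auto simp: differentiable_def)
qed

context slice_regular
begin

abbreviation "N \<equiv> nonreal_part D h"

lemma N_iff: "z \<in> N \<longleftrightarrow> z \<in> D \<and> Im (z $ h) \<noteq> 0"
  by (simp add: nonreal_part_def)

lemma open_N: "open N"
proof -
  have "open {z :: 'n cvec. Im (z $ h) \<noteq> 0}" by (intro open_Collect_neq continuous_intros)
  then show ?thesis using open_D by (simp add: nonreal_part_def Collect_conj_eq open_Int)
qed

lemma sym_N: "symmetric_set N"
  using sym_D by (auto simp: symmetric_set_def nonreal_part_def conj_at_def)

lemma circularization_N: "circularization N \<subseteq> (circularization D :: ('m, 'n) pvec set)"
  by (auto simp: circularization_def nonreal_part_def)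

lemma conj_holomorphic_N:
  assumes "z \<in> N" "h \<notin> K"
  shows "conj_holomorphic (slice_dom D h z) (holo_comp F h z K A)" "z $ h \<in> slice_dom D h z" "Im (z $ h) \<noteq> 0"
  using assms conj_holomorphic_holo_comp by (auto simp: N_iff slice_dom_self)

lemma stem_on_lower:
  assumes "\<And>z l K. z \<in> N \<Longrightarrow> h \<notin> K \<Longrightarrow> c (conj_at l z) K = (if l \<in> K then - 1 else 1) *\<^sub>R (c z K :: 'm clifford)"
  shows "stem_on N (\<lambda>z. \<Sum>K | h \<notin> K. axis K (c z K))"
  unfolding stem_on_def lower_stem_nth using assms by simp

lemma differentiable_lower:
  fixes c :: "'n cvec \<Rightarrow> 'n set \<Rightarrow> 'm clifford"
  assumes c: "\<And>z K. z \<in> N \<Longrightarrow> h \<notin> K \<Longrightarrow> c z K = (\<chi> A. q z K A (z $ h))"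
    and upd: "\<And>z w. q (vec_upd h w z) = q z"
    and diff: "\<And>K A. h \<notin> K \<Longrightarrow> q z K A differentiable (at (z $ h))"
    and z: "z \<in> N"
  shows "(\<lambda>w. \<Sum>K | h \<notin> K. axis K (c (z + axis h w) K)) differentiable (at 0)"
proof (rule differentiable_along_axis[OF open_N z])
  show "(\<Sum>K | h \<notin> K. axis K (c (vec_upd h w z) K)) = (\<Sum>K | h \<notin> K. axis K (\<chi> A. q z K A w))"
    if "vec_upd h w z \<in> N" for w
    using c[OF that] by (simp add: upd)
  show "(\<lambda>w. \<Sum>K | h \<notin> K. axis K (\<chi> A. q z K A w)) differentiable (at (z $ h))"
    by (intro differentiable_sum ballI
        differentiable_compose[OF bounded_linear_imp_differentiable[OF bounded_linear_axis]]
        differentiable_vec_lambda diff) auto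
qed

lemma slice_differentiable_induced:
  fixes G :: "'n cvec \<Rightarrow> ('m, 'n) stem_value"
  assumes "stem_on N G" "\<And>z. z \<in> N \<Longrightarrow> (\<lambda>w. G (z + axis h w)) differentiable (at 0)"
  shows "slice_differentiable N h (induced N G)"
  unfolding slice_differentiable_def using assms by blast

text \<open>Each summand has its own stem function and derivative, but only the weighted sum is
  known to be \<open>sph k\<close>. So the derivatives are summed first and then identified by
  uniqueness. All components containing h are zero, so the slice derivative has half the
  \<alpha>-derivative at \<open>K\<close> and minus half the \<beta>-derivative at
  \<open>insert h K\<close>, as in \<open>lap_part\<close>.\<close>

lemma sum_slice_deriv:
  fixes c :: "nat \<Rightarrow> 'n cvec \<Rightarrow> 'n set \<Rightarrow> 'm clifford"
  assumes stem: "\<And>j. j \<in> I \<Longrightarrow> stem_on N (\<lambda>z. \<Sum>K | h \<notin> K. axis K (c j z K))"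
    and diff: "\<And>j z. j \<in> I \<Longrightarrow> z \<in> N \<Longrightarrow> (\<lambda>w. \<Sum>K | h \<notin> K. axis K (c j (z + axis h w) K)) differentiable (at 0)"
    and sum_c: "\<And>z K. z \<in> N \<Longrightarrow> h \<notin> K \<Longrightarrow>
      (\<Sum>j\<in>I. a j *\<^sub>R c j z K) = (\<chi> A. sph k (holo_comp F h z K A) (z $ h))"
    and z: "z \<in> D" "\<And>l. J $ l \<in> unit_imag" "Im (z $ h) > 0"
  shows "(\<Sum>j\<in>I. a j *\<^sub>R slice_deriv N h (induced N (\<lambda>z. \<Sum>K | h \<notin> K. axis K (c j z K))) (slice_point z J)) =
    (1/2) *\<^sub>R lap_part (k + 1) z J (slice_point z J $ h)"
proof -
  define G where "G j z = (\<Sum>K | h \<notin> K. axis K (c j z K))" for j z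
  have zN: "z \<in> N" using z by (simp add: N_iff)
  have dG: "dir_differentiable (axis h b) (G j) z" if "j \<in> I" "z \<in> N" for j z b
    using dir_differentiable_axis[of "G j"] diff[OF that] by (simp add: G_def)
  have H: "conj_holomorphic (slice_dom D h z) (holo_comp F h z K A)" if "h \<notin> K" for K A
    by (rule conj_holomorphic_N(1)[OF zN that])
  have zh: "Complex (Re (z $ h)) (Im (z $ h)) \<in> slice_dom D h z" using z(1) by (simp add: slice_dom_self)
  define A where "A = (\<Sum>j\<in>I. a j *\<^sub>R d_alpha h (G j) z)"
  define B where "B = (\<Sum>j\<in>I. a j *\<^sub>R d_beta h (G j) z)"
  have sum_G: "(\<Sum>j\<in>I. a j *\<^sub>R G j z') $ K = (if h \<in> K then 0 else (\<chi> A. sph k (holo_comp F h z' K A) (z' $ h)))"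
    if "z' \<in> N" for z' K
  proof -
    have "G j z' $ K = (if h \<in> K then 0 else c j z' K)" for j unfolding G_def by (rule lower_stem_nth)
    then show ?thesis using sum_c[OF that, of K] by simp
  qed
  have sum_deriv: "((\<lambda>t. \<chi> K. if h \<in> K then 0 else (\<chi> A. sph k (holo_comp F h z K A) (z $ h + t *\<^sub>R b)))
      has_vector_derivative (\<Sum>j\<in>I. a j *\<^sub>R dir_deriv (axis h b) (G j) z)) (at 0)" for b
  proof (rule has_vector_derivative_eventually)
    have "((\<lambda>t. a j *\<^sub>R G j (z + t *\<^sub>R axis h b)) has_vector_derivative a j *\<^sub>R dir_deriv (axis h b) (G j) z) (at 0)" if "j \<in> I" for j
      by (rule bounded_linear.has_vector_derivative[OF bounded_linear_scaleR_right
          dir_differentiable_has_deriv[OF dG[OF that zN]]])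
    then show "((\<lambda>t. \<Sum>j\<in>I. a j *\<^sub>R G j (z + t *\<^sub>R axis h b)) has_vector_derivative (\<Sum>j\<in>I. a j *\<^sub>R dir_deriv (axis h b) (G j) z)) (at 0)"
      by (rule has_vector_derivative_sum)
    show "\<forall>\<^sub>F t in nhds 0. (\<Sum>j\<in>I. a j *\<^sub>R G j (z + t *\<^sub>R axis h b)) =
        (\<chi> K. if h \<in> K then 0 else (\<chi> A. sph k (holo_comp F h z K A) (z $ h + t *\<^sub>R b)))"
      using eventually_along[OF open_N zN, of "axis h b"]
    proof eventually_elim
      case (elim t)
      have "(z + t *\<^sub>R axis h b) $ h = z $ h + t *\<^sub>R b" by (simp add: axis_def)
      moreover have "holo_comp F h (z + t *\<^sub>R axis h b) = holo_comp F h z"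
        unfolding add_scaleR_axis_vec_upd by simp
      ultimately show ?case using sum_G[OF elim] by (simp add: stem_value_eq_iff)
    qed
  qed
  have vec: "((\<lambda>t. \<chi> K. if h \<in> K then 0 else (\<chi> A. sph k (holo_comp F h z K A) (z $ h + t *\<^sub>R b)))
      has_vector_derivative (\<chi> K. if h \<in> K then 0 else (\<chi> A. r K A))) (at 0)"
    if "\<And>K A. h \<notin> K \<Longrightarrow> ((\<lambda>t. sph k (holo_comp F h z K A) (z $ h + t *\<^sub>R b)) has_vector_derivative r K A) (at 0)" for b r
  proof (rule has_vector_derivative_vec_lambda)
    fix K :: "'n set"
    show "((\<lambda>t. if h \<in> K then 0 else (\<chi> A. sph k (holo_comp F h z K A) (z $ h + t *\<^sub>R b)))
      has_vector_derivative (if h \<in> K then 0 else (\<chi> A. r K A))) (at 0)"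
      using that[of K] by (cases "h \<in> K") (auto intro!: has_vector_derivative_vec_lambda)
  qed
  have "A = (\<chi> K. if h \<in> K then 0 else (\<chi> A. sph k (deriv (holo_comp F h z K A)) (z $ h)))"
  proof (rule vector_derivative_unique_at)
    show "((\<lambda>t. \<chi> K. if h \<in> K then 0 else (\<chi> A. sph k (holo_comp F h z K A) (z $ h + t *\<^sub>R 1))) has_vector_derivative A) (at 0)"
      using sum_deriv[of 1] by (simp add: A_def d_alpha_def)
    show "((\<lambda>t. \<chi> K. if h \<in> K then 0 else (\<chi> A. sph k (holo_comp F h z K A) (z $ h + t *\<^sub>R 1))) has_vector_derivative
       (\<chi> K. if h \<in> K then 0 else (\<chi> A. sph k (deriv (holo_comp F h z K A)) (z $ h)))) (at 0)"
      by (rule vec) (use sph_fst[OF H zh] in \<open>simp only: deriv_fst_iff has_real_derivative_iff_has_vector_derivative complex_surj simp_thms\<close>)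
  qed
  then have A: "A $ K = (if h \<in> K then 0 else (\<chi> A. sph_re (k + 1) (holo_comp F h z K A) (z $ h)))" for K
    by (simp add: sph_re_def)
  have "B = (\<chi> K. if h \<in> K then 0 else (\<chi> A. Im (z $ h) * sph (Suc k) (holo_comp F h z K A) (z $ h)))"
  proof (rule vector_derivative_unique_at)
    show "((\<lambda>t. \<chi> K. if h \<in> K then 0 else (\<chi> A. sph k (holo_comp F h z K A) (z $ h + t *\<^sub>R \<i>))) has_vector_derivative B) (at 0)"
      using sum_deriv[of \<i>] by (simp add: B_def d_beta_def)
    show "((\<lambda>t. \<chi> K. if h \<in> K then 0 else (\<chi> A. sph k (holo_comp F h z K A) (z $ h + t *\<^sub>R \<i>))) has_vector_derivative
       (\<chi> K. if h \<in> K then 0 else (\<chi> A. Im (z $ h) * sph (Suc k) (holo_comp F h z K A) (z $ h)))) (at 0)"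
      by (rule vec) (use sph_snd[OF H zh] in \<open>simp only: deriv_snd_iff has_real_derivative_iff_has_vector_derivative complex_surj simp_thms\<close>)
  qed
  then have B: "B $ K = (if h \<in> K then 0 else Im (z $ h) *\<^sub>R (\<chi> A. sph (Suc k) (holo_comp F h z K A) (z $ h)))" for K
    by (simp add: vec_eq_iff)
  have lin: "linear (imag_prod J K :: 'm clifford \<Rightarrow> _)" for J and K :: "'n set"
    by (rule bounded_linear.linear[OF bounded_linear_imag_prod])
  have "(\<Sum>j\<in>I. a j *\<^sub>R slice_deriv N h (induced N (G j)) (slice_point z J)) =
    (\<Sum>j\<in>I. a j *\<^sub>R (\<Sum>K\<in>UNIV. imag_prod J K (((1/2) *\<^sub>R (d_alpha h (G j) z - stem_J h (d_beta h (G j) z))) $ K)))"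
  proof (rule sum.cong)
    fix j assume j: "j \<in> I"
    have "stem_on N (G j)" using stem[OF j] by (simp add: G_def[abs_def])
    then show "a j *\<^sub>R slice_deriv N h (induced N (G j)) (slice_point z J) =
      a j *\<^sub>R (\<Sum>K\<in>UNIV. imag_prod J K (((1/2) *\<^sub>R (d_alpha h (G j) z - stem_J h (d_beta h (G j) z))) $ K))"
      using slice_derivs(1)[OF open_N sym_N _ refl dG[OF j] dG[OF j] zN z(2)] by simp
  qed simp
  also have "\<dots> = (\<Sum>K\<in>UNIV. imag_prod J K (\<Sum>j\<in>I. a j *\<^sub>R ((1/2) *\<^sub>R (d_alpha h (G j) z - stem_J h (d_beta h (G j) z))) $ K))"
    unfolding scaleR_sum_right by (subst sum.swap) (simp only: linear_sum[OF lin] linear_scale[OF lin])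
  also have "\<dots> = (\<Sum>K\<in>UNIV. imag_prod J K (((1/2) *\<^sub>R (A - stem_J h B)) $ K))"
  proof (intro sum.cong refl arg_cong[where f = "imag_prod J _"])
    fix K
    have "stem_J h B $ K = (\<Sum>j\<in>I. a j *\<^sub>R (stem_J h (d_beta h (G j) z) $ K))"
      by (simp add: stem_J_nth B_def sum_negf)
    then show "(\<Sum>j\<in>I. a j *\<^sub>R ((1/2) *\<^sub>R (d_alpha h (G j) z - stem_J h (d_beta h (G j) z))) $ K) = ((1/2) *\<^sub>R (A - stem_J h B)) $ K"
      by (simp add: A_def sum_subtractf scaleR_diff_right scaleR_sum_right mult.commute)
  qed
  also have "\<dots> = (\<Sum>K | h \<notin> K. (1/2) *\<^sub>R (imag_prod J K (\<chi> A. sph_re (k + 1) (holo_comp F h z K A) (z $ h)) -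
      Im (z $ h) *\<^sub>R imag_prod J (insert h K) (\<chi> A. sph (k + 1) (holo_comp F h z K A) (z $ h))))"
    unfolding sum_split_insert[of _ h]
  proof (rule sum.cong)
    fix K assume "K \<in> {K. h \<notin> K}"
    then have K: "h \<notin> K" by simp
    let ?P = "\<chi> A. sph_re (k + 1) (holo_comp F h z K A) (z $ h)" and ?Q = "\<chi> A. sph (k + 1) (holo_comp F h z K A) (z $ h)"
    have 1: "((1/2) *\<^sub>R (A - stem_J h B)) $ K = (1/2) *\<^sub>R ?P"
      "((1/2) *\<^sub>R (A - stem_J h B)) $ insert h K = (1/2) *\<^sub>R - (Im (z $ h) *\<^sub>R ?Q)"
      using K by (simp_all add: A B stem_J_nth)
    show "imag_prod J K (((1/2) *\<^sub>R (A - stem_J h B)) $ K) + imag_prod J (insert h K) (((1/2) *\<^sub>R (A - stem_J h B)) $ insert h K) =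
      (1/2) *\<^sub>R (imag_prod J K ?P - Im (z $ h) *\<^sub>R imag_prod J (insert h K) ?Q)"
      unfolding 1 linear_scale[OF lin] linear_neg[OF lin] by (simp add: scaleR_diff_right)
  qed simp
  also have "\<dots> = (1/2) *\<^sub>R lap_part (k + 1) z J (slice_point z J $ h)"
    unfolding lap_part_def scaleR_sum_right
  proof (rule sum.cong)
    fix K
    let ?y = "slice_point z J $ h"
    let ?Q = "\<chi> A. sph (k + 1) (holo_comp F h z K A) (z $ h)"
    \<comment> \<open>Positivity of \<beta>_h enters here: for a negative value the upper point
      would be the conjugate.\<close>
    have y: "upper_point ?y = z $ h"
      using z(2)[of h] z(3) by (simp add: upper_point_def slice_point_nth unit_imag_iff)
    have "(0, snd ?y) = Im (z $ h) *\<^sub>R (J $ h)"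
      using z(2)[of h] by (simp add: slice_point_nth prod_eq_iff unit_imag_iff)
    then have "imag_prod (vec_upd h (0, snd ?y) J) (insert h K) ?Q = Im (z $ h) *\<^sub>R imag_prod J (insert h K) ?Q"
      using linear_scale[OF bounded_linear.linear[OF bounded_linear_imag_prod_upd[of h "insert h K" J ?Q]], of "Im (z $ h)" "J $ h"]
      by simp
    then show "(1/2) *\<^sub>R (imag_prod J K (\<chi> A. sph_re (k + 1) (holo_comp F h z K A) (z $ h)) - Im (z $ h) *\<^sub>R imag_prod J (insert h K) ?Q) =
      (1/2) *\<^sub>R (imag_prod J K (\<chi> A. sph_re (k + 1) (holo_comp F h z K A) (upper_point ?y)) -
        imag_prod (vec_upd h (0, snd ?y) J) (insert h K) (\<chi> A. sph (k + 1) (holo_comp F h z K A) (upper_point ?y)))"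
      unfolding y by simp
  qed simp
  finally show ?thesis by (simp add: G_def[abs_def])
qed

lemma F_insert_nth: "F z $ insert h K $ A = im_deriv 0 (holo_comp F h z K A) (z $ h)"
  by (simp add: im_deriv_def holo_comp_def)

lemma d_beta_upper:
  assumes "h \<notin> K" "z \<in> D"
  shows "(d_beta h ^^ j) (\<lambda>w. F w $ insert h K) z = (\<chi> A. im_deriv j (holo_comp F h z K A) (z $ h))"
    "dir_differentiable (axis h \<i>) ((d_beta h ^^ j) (\<lambda>w. F w $ insert h K)) z"
proof -
  let ?q = "\<lambda>j z A. im_deriv j (holo_comp F h z K A)"
  have "((\<lambda>t. ?q j z A (z $ h + t *\<^sub>R \<i>)) has_vector_derivative ?q (Suc j) z A (z $ h)) (at 0)" if "z \<in> D" for z j A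
    using im_deriv_snd[OF conj_holomorphic_holo_comp[OF assms(1)], of "Re (z $ h)" "Im (z $ h)" z j A] that
    by (simp add: deriv_snd_iff has_real_derivative_iff_has_vector_derivative slice_dom_self)
  note * = iterated_d_beta[OF open_D, of ?q h "\<lambda>w. F w $ insert h K", OF _ _ this assms(2)]
  show "(d_beta h ^^ j) (\<lambda>w. F w $ insert h K) z = (\<chi> A. im_deriv j (holo_comp F h z K A) (z $ h))"
    "dir_differentiable (axis h \<i>) ((d_beta h ^^ j) (\<lambda>w. F w $ insert h K)) z"
    by (rule *; simp add: vec_eq_iff F_insert_nth)+
qed

lemma d_beta_lower:
  assumes "h \<notin> K" "z \<in> D"
  shows "dir_differentiable (axis h \<i>) ((d_beta h ^^ j) (\<lambda>w. F w $ K)) z"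
proof -
  \<comment> \<open>The exponent is \<open>j + 1\<close> because \<open>F w $ K\<close> is a real
    part, and the real part is the imaginary part after multiplication by \<i>.\<close>
  let ?q = "\<lambda>j z A w. Im (\<i> ^ (j + 1) * (deriv ^^ j) (holo_comp F h z K A) w)"
  have "((\<lambda>t. ?q j z A (z $ h + t *\<^sub>R \<i>)) has_vector_derivative ?q (Suc j) z A (z $ h)) (at 0)" if "z \<in> D" for z j A
  proof -
    have "Complex (Re (z $ h)) (Im (z $ h)) \<in> slice_dom D h z" using that by (simp add: slice_dom_self)
    from Im_deriv_snd[OF conj_holomorphic_DERIV[OF conj_holomorphic_holo_comp[OF assms(1)] this, of j A], of "\<i> ^ (j + 1)"]
    show ?thesis
      unfolding deriv_snd_iff[of "?q j z A"] by (simp add: has_real_derivative_iff_has_vector_derivative mult_ac)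
  qed
  from iterated_d_beta(2)[OF open_D, of ?q h "\<lambda>w. F w $ K", OF _ _ this assms(2)]
  show ?thesis by (simp add: vec_eq_iff holo_comp_def)
qed

lemma d_beta_differentiable:
  "z \<in> D \<Longrightarrow> dir_differentiable (axis h \<i>) ((d_beta h ^^ j) (\<lambda>w. F w $ K)) z"
  using d_beta_lower[of K z j] d_beta_upper(2)[of "K - {h}" z j] by (cases "h \<in> K") (auto simp: insert_absorb)

lemma spherical_stem_sph:
  assumes "z \<in> N" "h \<notin> K"
  shows "inverse (Im (z $ h)) *\<^sub>R (F z $ insert h K) = (\<chi> A. sph 0 (holo_comp F h z K A) (z $ h))"
proof -
  note H = conj_holomorphic_N[OF assms]
  have "F z $ insert h K $ A = Im (z $ h) * sph 0 (holo_comp F h z K A) (z $ h)" for A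
    using sph_0[OF H(2) H(1)] by (simp add: holo_comp_def)
  then show ?thesis using H(3) by (simp add: vec_eq_iff)
qed

lemma spherical_stem_nth:
  "h \<notin> K \<Longrightarrow> spherical_stem h F z $ K = inverse (Im (z $ h)) *\<^sub>R (F z $ insert h K)"
  unfolding spherical_stem_def lower_stem_nth by simp

lemma d_beta_spherical:
  assumes "h \<notin> K" "z \<in> N"
  shows "(d_beta h ^^ j) (\<lambda>w. spherical_stem h F w $ K) z = (\<chi> A. sph_iter j (holo_comp F h z K A) (z $ h))"
    "dir_differentiable (axis h \<i>) ((d_beta h ^^ j) (\<lambda>w. spherical_stem h F w $ K)) z"
proof -
  let ?q = "\<lambda>j z A. sph_iter j (holo_comp F h z K A)"
  have "((\<lambda>t. ?q j z A (z $ h + t *\<^sub>R \<i>)) has_vector_derivative ?q (Suc j) z A (z $ h)) (at 0)" if "z \<in> N" for z j A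
    using sph_iter_deriv(1)[OF conj_holomorphic_N[OF that assms(1)]] .
  note * = iterated_d_beta[OF open_N, of ?q h "\<lambda>w. spherical_stem h F w $ K", OF _ _ this assms(2)]
  show "(d_beta h ^^ j) (\<lambda>w. spherical_stem h F w $ K) z = (\<chi> A. sph_iter j (holo_comp F h z K A) (z $ h))"
    "dir_differentiable (axis h \<i>) ((d_beta h ^^ j) (\<lambda>w. spherical_stem h F w $ K)) z"
    by (rule *; simp add: spherical_stem_nth[OF assms(1)] spherical_stem_sph[OF _ assms(1)] sph_iter_def)+
qed

lemma F_conj_at: "z \<in> D \<Longrightarrow> F (conj_at l z) $ K = (if l \<in> K then - 1 else 1) *\<^sub>R (F z $ K)"
  using stem_F by (simp add: stem_on_def)

lemma Im_conj_at: "Im (conj_at l z $ h) = (if l = h then - Im (z $ h) else Im (z $ h))"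
  by (simp add: conj_at_def)

lemma spherical_stem_conj_at:
  assumes "z \<in> N" "h \<notin> K"
  shows "spherical_stem h F (conj_at l z) $ K = (if l \<in> K then - 1 else 1) *\<^sub>R spherical_stem h F z $ K"
  using assms by (simp add: spherical_stem_nth Im_conj_at F_conj_at N_iff)

abbreviation spherical_coeff :: "nat \<Rightarrow> nat \<Rightarrow> 'n cvec \<Rightarrow> 'n set \<Rightarrow> 'm clifford" where
  "spherical_coeff k j z K \<equiv> (Im (z $ h) powi (int j - 2 * int k)) *\<^sub>R
     ((d_beta h ^^ j) (\<lambda>w. spherical_stem h F w $ K) z)"

abbreviation stem_coeff :: "nat \<Rightarrow> nat \<Rightarrow> 'n cvec \<Rightarrow> 'n set \<Rightarrow> 'm clifford" where
  "stem_coeff k j z K \<equiv> (Im (z $ h) powi (int j - 2 * int k - 2)) *\<^sub>R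
     ((d_beta h ^^ (j - 1)) (\<lambda>w. F w $ insert h K) z)"

text \<open>Under conjugation at h the power of \<beta> and the j-th \<beta>-derivative of an even
  function both change by (-1)^j, so the product is even, as a component with h not in
  \<open>K\<close> must be.\<close>

lemma spherical_coeff_regular:
  shows "stem_on N (\<lambda>z. \<Sum>K | h \<notin> K. axis K (spherical_coeff k j z K))"
    "z \<in> N \<Longrightarrow> (\<lambda>w. \<Sum>K | h \<notin> K. axis K (spherical_coeff k j (z + axis h w) K)) differentiable (at 0)"
proof -
  show "stem_on N (\<lambda>z. \<Sum>K | h \<notin> K. axis K (spherical_coeff k j z K))"
  proof (rule stem_on_lower)
    fix z l K assume *: "z \<in> N" "h \<notin> K"
    have "(d_beta h ^^ j) (\<lambda>w. spherical_stem h F w $ K) (conj_at l z) =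
        ((if l \<in> K then - 1 else 1) * (if l = h then (- 1) ^ j else 1)) *\<^sub>R (d_beta h ^^ j) (\<lambda>w. spherical_stem h F w $ K) z"
      by (rule iterated_deriv_conj_at[OF open_N sym_N *(1)])
        (rule d_beta_spherical(2)[OF *(2)], assumption, rule spherical_stem_conj_at[OF _ *(2)])
    then show "spherical_coeff k j (conj_at l z) K = (if l \<in> K then - 1 else 1) *\<^sub>R spherical_coeff k j z K"
      using *(2) by (auto simp: Im_conj_at power_int_minus_left)
  qed
next
  assume z: "z \<in> N"
  let ?q = "\<lambda>z K A w. Im w powi (int j - 2 * int k) * sph_iter j (holo_comp F h z K A) w"
  show "(\<lambda>w. \<Sum>K | h \<notin> K. axis K (spherical_coeff k j (z + axis h w) K)) differentiable (at 0)"
  proof (rule differentiable_lower[where q = ?q, OF _ _ _ z])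
    show "spherical_coeff k j z K = (\<chi> A. ?q z K A (z $ h))" if "z \<in> N" "h \<notin> K" for z K
      by (simp add: d_beta_spherical(1)[OF that(2,1)] vec_eq_iff)
    show "?q z K A differentiable (at (z $ h))" if "h \<notin> K" for K A
      using conj_holomorphic_N[OF z that]
      by (intro differentiable_mult differentiable_power_int Im_differentiable sph_iter_deriv(2)) auto
  qed simp
qed

text \<open>Parity as before: the component at \<open>insert h K\<close> is odd in \<beta>, so its
  (j-1)-st derivative again has the sign (-1)^j. For \<open>j = 0\<close> the truncated
  \<open>j - 1\<close> would break this count.\<close>

lemma stem_coeff_regular:
  assumes "j \<ge> 1"
  shows "stem_on N (\<lambda>z. \<Sum>K | h \<notin> K. axis K (stem_coeff k j z K))"
    "z \<in> N \<Longrightarrow> (\<lambda>w. \<Sum>K | h \<notin> K. axis K (stem_coeff k j (z + axis h w) K)) differentiable (at 0)"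
proof -
  show "stem_on N (\<lambda>z. \<Sum>K | h \<notin> K. axis K (stem_coeff k j z K))"
  proof (rule stem_on_lower)
    fix z l K assume *: "z \<in> N" "h \<notin> K"
    have zD: "z \<in> D" using * by (simp add: N_iff)
    have "(d_beta h ^^ (j - 1)) (\<lambda>w. F w $ insert h K) (conj_at l z) =
        ((if l \<in> insert h K then - 1 else 1) * (if l = h then (- 1) ^ (j - 1) else 1)) *\<^sub>R (d_beta h ^^ (j - 1)) (\<lambda>w. F w $ insert h K) z"
      by (rule iterated_deriv_conj_at[OF open_D sym_D zD d_beta_differentiable F_conj_at])
    moreover obtain i where "j = Suc i" using assms by (cases j) auto
    ultimately show "stem_coeff k j (conj_at l z) K = (if l \<in> K then - 1 else 1) *\<^sub>R stem_coeff k j z K"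
      using *(2) by (auto simp: Im_conj_at power_int_minus_left)
  qed
next
  assume z: "z \<in> N"
  let ?q = "\<lambda>z K A w. Im w powi (int j - 2 * int k - 2) * im_deriv (j - 1) (holo_comp F h z K A) w"
  show "(\<lambda>w. \<Sum>K | h \<notin> K. axis K (stem_coeff k j (z + axis h w) K)) differentiable (at 0)"
  proof (rule differentiable_lower[where q = ?q, OF _ _ _ z])
    show "stem_coeff k j z K = (\<chi> A. ?q z K A (z $ h))" if "z \<in> N" "h \<notin> K" for z K
      using that by (simp add: d_beta_upper(1) vec_eq_iff N_iff)
    show "?q z K A differentiable (at (z $ h))" if "h \<notin> K" for K A
      using conj_holomorphic_N[OF z that]
      by (intro differentiable_mult differentiable_power_int Im_differentiable im_deriv_differentiable) auto
  qed simp
qed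

lemma spherical_regular:
  shows "stem_on N (spherical_stem h F)"
    "z \<in> N \<Longrightarrow> (\<lambda>w. spherical_stem h F (z + axis h w)) differentiable (at 0)"
proof -
  show "stem_on N (spherical_stem h F)"
    unfolding spherical_stem_def[abs_def]
    by (rule stem_on_lower) (use spherical_stem_conj_at in \<open>simp add: spherical_stem_nth\<close>)
next
  assume z: "z \<in> N"
  show "(\<lambda>w. spherical_stem h F (z + axis h w)) differentiable (at 0)"
    unfolding spherical_stem_def
  proof (rule differentiable_lower[where q = "\<lambda>z K A. sph 0 (holo_comp F h z K A)", OF _ _ _ z])
    show "sph 0 (holo_comp F h z K A) differentiable at (z $ h)" if "h \<notin> K" for K A
      using conj_holomorphic_N[OF z that] by (rule sph_differentiable)
  qed (simp_all add: spherical_stem_sph)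
qed

lemma spherical_deriv_eq: "spherical_deriv D h f = induced N (spherical_stem h F)"
  unfolding spherical_deriv_def
proof (rule induced_cong)
  fix z assume "z \<in> N"
  then have "stem_of D f z = F z"
    by (intro stem_of_eq[OF sym_D stem_F f_eq]) (auto simp: N_iff)
  then show "spherical_stem h (stem_of D f) z = spherical_stem h F z" by (simp add: spherical_stem_def)
qed

text \<open>The last two sums expand the same function \<open>sph k\<close>, once from the
  \<beta>-derivatives of the spherical derivative and once from those of \<open>F\<close>; this is
  their equivalence. The first formula is the one-term sum with \<open>k = 0\<close>.\<close>

lemma slice_deriv_formulas:
  assumes z: "z \<in> D" "\<And>l. J $ l \<in> unit_imag" "Im (z $ h) > 0"
  shows "slice_deriv N h (spherical_deriv D h f) (slice_point z J) = (1/2) *\<^sub>R lap_part 1 z J (slice_point z J $ h)"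
    "k \<ge> 1 \<Longrightarrow> (\<Sum>j=1..k. lap_coeff k j *\<^sub>R slice_deriv N h (spherical_term D h F k j) (slice_point z J)) =
      (1/2) *\<^sub>R lap_part (k + 1) z J (slice_point z J $ h)"
    "(\<Sum>j=1..k+1. lap_coeff (k + 1) j *\<^sub>R slice_deriv N h (stem_term D h F k j) (slice_point z J)) =
      (1/2) *\<^sub>R lap_part (k + 1) z J (slice_point z J $ h)"
proof -
  show "slice_deriv N h (spherical_deriv D h f) (slice_point z J) = (1/2) *\<^sub>R lap_part 1 z J (slice_point z J $ h)"
    using sum_slice_deriv[of "{0}" "\<lambda>j z K. inverse (Im (z $ h)) *\<^sub>R (F z $ insert h K)" "\<lambda>_. 1" 0, OF _ _ _ z]
      spherical_regular spherical_stem_sph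
    by (simp add: spherical_deriv_eq spherical_stem_def[abs_def])
  show "(\<Sum>j=1..k. lap_coeff k j *\<^sub>R slice_deriv N h (spherical_term D h F k j) (slice_point z J)) =
      (1/2) *\<^sub>R lap_part (k + 1) z J (slice_point z J $ h)" if k: "k \<ge> 1"
    unfolding spherical_term_def
  proof (rule sum_slice_deriv[OF spherical_coeff_regular _ z])
    fix z K assume zK: "z \<in> N" "h \<notin> K"
    obtain i where i: "k = Suc i" using k by (cases k) auto
    have "(\<Sum>j=1..k. lap_coeff k j * (Im (z $ h) powi (int j - 2 * int k) * sph_iter j H (z $ h))) =
      lap_sum i (\<lambda>j. sph_iter (Suc j) H (z $ h)) (Im (z $ h))" for H
      unfolding lap_sum_def i
      by (rule sum.reindex_bij_witness[of _ Suc "\<lambda>j. j - 1"]) (auto simp: algebra_simps)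
    moreover have "spherical_coeff k j z K $ A = Im (z $ h) powi (int j - 2 * int k) * sph_iter j (holo_comp F h z K A) (z $ h)" for j A
      by (simp add: d_beta_spherical(1)[OF zK(2,1)])
    ultimately have "(\<Sum>j=1..k. lap_coeff k j *\<^sub>R spherical_coeff k j z K) $ A = sph k (holo_comp F h z K A) (z $ h)" for A
      using lap_sum_sph_iter[OF conj_holomorphic_N[OF zK], of i A]
      by (simp only: sum_component vector_scaleR_component real_scaleR_def i)
    then show "(\<Sum>j=1..k. lap_coeff k j *\<^sub>R spherical_coeff k j z K) = (\<chi> A. sph k (holo_comp F h z K A) (z $ h))"
      by (simp only: vec_eq_iff vec_lambda_beta simp_thms)
  qed
  show "(\<Sum>j=1..k+1. lap_coeff (k + 1) j *\<^sub>R slice_deriv N h (stem_term D h F k j) (slice_point z J)) =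
      (1/2) *\<^sub>R lap_part (k + 1) z J (slice_point z J $ h)"
    unfolding stem_term_def
  proof (rule sum_slice_deriv[OF _ _ _ z])
    fix z K assume zK: "z \<in> N" "h \<notin> K"
    have "(\<Sum>j=1..k+1. lap_coeff (k + 1) j * (Im (z $ h) powi (int j - 2 * int k - 2) * im_deriv (j - 1) H (z $ h))) =
      lap_sum k (\<lambda>j. im_deriv j H (z $ h)) (Im (z $ h))" for H
      unfolding lap_sum_def
      by (rule sum.reindex_bij_witness[of _ Suc "\<lambda>j. j - 1"]) (auto simp: algebra_simps)
    moreover have "stem_coeff k j z K $ A = Im (z $ h) powi (int j - 2 * int k - 2) * im_deriv (j - 1) (holo_comp F h z K A) (z $ h)" for j A
      using zK by (simp add: d_beta_upper(1) N_iff)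
    ultimately have "(\<Sum>j=1..k+1. lap_coeff (k + 1) j *\<^sub>R stem_coeff k j z K) $ A = sph k (holo_comp F h z K A) (z $ h)" for A
      using conj_holomorphic_N(3)[OF zK]
      by (simp only: sum_component vector_scaleR_component real_scaleR_def sph_def if_False)
    then show "(\<Sum>j=1..k+1. lap_coeff (k + 1) j *\<^sub>R stem_coeff k j z K) = (\<chi> A. sph k (holo_comp F h z K A) (z $ h))"
      by (simp only: vec_eq_iff vec_lambda_beta simp_thms)
  qed (use stem_coeff_regular in auto)
qed

end

theorem theorem3p9:
  fixes D :: "'n::{finite,linorder} cvec set"
    and F :: "'n cvec \<Rightarrow> ('m::{finite,linorder}, 'n) stem_value"
    and f :: "('m, 'n) pvec \<Rightarrow> 'm clifford"
    and h :: 'n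
  assumes "odd CARD('m)"
    and "open D" and "symmetric_set D"
    and "stem_on D F" and "C1_on D F"
    and "\<forall>x\<in>circularization D. f x = induced D F x"
    and "\<forall>x\<in>circularization D. slice_deriv_conj D h f x = 0"
  shows
    "\<comment> \<open>existence of the derivatives in the formulas\<close>
     ((\<forall>p. iter_laplacian_exists h p (circularization (nonreal_part D h)) f) \<and>
      (\<forall>K i. \<forall>z\<in>D. dir_differentiable (axis h \<i>) ((d_beta h ^^ i) (\<lambda>w. F w $ K)) z) \<and>
      slice_differentiable (nonreal_part D h) h (spherical_deriv D h f) \<and>
      (\<forall>k\<ge>1. \<forall>j\<in>{1..k}. slice_differentiable (nonreal_part D h) h (spherical_term D h F k j)) \<and>
      (\<forall>k\<ge>1. \<forall>j\<in>{1..k+1}. slice_differentiable (nonreal_part D h) h (stem_term D h F k j)))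
     \<and>
     \<comment> \<open>the formulas\<close>
     (\<forall>z\<in>D. \<forall>J. (\<forall>l. J $ l \<in> unit_imag) \<and> Im (z $ h) > 0 \<longrightarrow>
       laplacian_at h f (slice_point z J) =
         (- 2 * (real CARD('m) - 1)) *\<^sub>R
           slice_deriv (nonreal_part D h) h (spherical_deriv D h f) (slice_point z J) \<and>
       (\<forall>k\<ge>1.
         (laplacian_at h ^^ (k + 1)) f (slice_point z J) =
           (- 2 * (\<Prod>i=0..k. real CARD('m) - 2 * real i - 1)) *\<^sub>R
             (\<Sum>j=1..k. lap_coeff k j *\<^sub>R
               slice_deriv (nonreal_part D h) h (spherical_term D h F k j) (slice_point z J)) \<and>
         (laplacian_at h ^^ (k + 1)) f (slice_point z J) =
           (- 2 * (\<Prod>i=0..k. real CARD('m) - 2 * real i - 1)) *\<^sub>R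
             (\<Sum>j=1..k+1. lap_coeff (k + 1) j *\<^sub>R
               slice_deriv (nonreal_part D h) h (stem_term D h F k j) (slice_point z J))))
     \<and>
     \<comment> \<open>polyharmonicity in every variable in which the hypothesis holds\<close>
     (\<forall>l. (\<forall>x\<in>circularization D. slice_deriv_conj D l f x = 0) \<longrightarrow>
       polyharmonic_in l ((CARD('m) - 1) div 2 + 1) (circularization D) f)"
proof -
  \<comment> \<open>Stated for every \<open>l\<close>: the formulas use it for h, polyharmonicity
    for each variable in which the hypothesis holds.\<close>
  have regular_in: "slice_regular D F f l" if "\<forall>x\<in>circularization D. slice_deriv_conj D l f x = 0" for l
    using assms that by unfold_locales auto
  interpret slice_regular D F f h by (rule regular_in) fact
  have laplacian: "(laplacian_at h ^^ p) f (slice_point z J) = lap_const CARD('m) p *\<^sub>R lap_part p z J (slice_point z J $ h)"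
    if "z \<in> D" "\<And>l. J $ l \<in> unit_imag" for z J p
    using iterated_laplacian[OF that(2) slice_point_nbhd[OF that]] by simp
  show ?thesis
  proof (intro conjI allI impI ballI)
    show "iter_laplacian_exists h p (circularization N) f" for p
      using iter_laplacian_exists_circularization[of p] circularization_N
      unfolding iter_laplacian_exists_def by blast
    show "dir_differentiable (axis h \<i>) ((d_beta h ^^ i) (\<lambda>w. F w $ K)) z" if "z \<in> D" for K i z
      by (rule d_beta_differentiable[OF that])
    show "slice_differentiable N h (spherical_deriv D h f)"
      unfolding spherical_deriv_eq by (rule slice_differentiable_induced[OF spherical_regular])
    show "slice_differentiable N h (spherical_term D h F k j)" for k j
      unfolding spherical_term_def by (rule slice_differentiable_induced[OF spherical_coeff_regular])
    show "slice_differentiable N h (stem_term D h F k j)" if "j \<in> {1..k+1}" for k j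
      unfolding stem_term_def using that by (intro slice_differentiable_induced stem_coeff_regular) auto
    show "polyharmonic_in l ((CARD('m) - 1) div 2 + 1) (circularization D) f"
      if "\<forall>x\<in>circularization D. slice_deriv_conj D l f x = 0" for l
      by (rule slice_regular.polyharmonic[OF regular_in[OF that] assms(1)])
  next
    fix z and J :: "('m, 'n) pvec"
    assume "z \<in> D" "(\<forall>l. J $ l \<in> unit_imag) \<and> Im (z $ h) > 0"
    then have z: "z \<in> D" "\<And>l. J $ l \<in> unit_imag" "Im (z $ h) > 0" by auto
    show "laplacian_at h f (slice_point z J) = (- 2 * (real CARD('m) - 1)) *\<^sub>R
        slice_deriv N h (spherical_deriv D h f) (slice_point z J)"
      using laplacian[OF z(1,2), of 1] slice_deriv_formulas(1)[OF z] by simp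
    fix k :: nat assume k: "1 \<le> k"
    \<comment> \<open>The product in the statement has k+1 factors, as in \<open>lap_const\<close>
      of order k+1; its factor 2 cancels the 1/2 in the definition of the slice derivative.\<close>
    have "{0..k} = {..<k + 1}" by auto
    then have "(laplacian_at h ^^ (k + 1)) f (slice_point z J) =
        (- 2 * (\<Prod>i=0..k. real CARD('m) - 2 * real i - 1)) *\<^sub>R (1/2) *\<^sub>R lap_part (k + 1) z J (slice_point z J $ h)"
      unfolding laplacian[OF z(1,2)] by simp
    then show "(laplacian_at h ^^ (k + 1)) f (slice_point z J) =
        (- 2 * (\<Prod>i=0..k. real CARD('m) - 2 * real i - 1)) *\<^sub>R
          (\<Sum>j=1..k. lap_coeff k j *\<^sub>R slice_deriv N h (spherical_term D h F k j) (slice_point z J))"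
      "(laplacian_at h ^^ (k + 1)) f (slice_point z J) =
        (- 2 * (\<Prod>i=0..k. real CARD('m) - 2 * real i - 1)) *\<^sub>R
          (\<Sum>j=1..k+1. lap_coeff (k + 1) j *\<^sub>R slice_deriv N h (stem_term D h F k j) (slice_point z J))"
      unfolding slice_deriv_formulas(2)[OF z k] slice_deriv_formulas(3)[OF z] by assumption+
  qed
qed

end
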